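(* Let $(X,d,\mathfrak{m})$ be an $\mathrm{RCD}^*(K,N)$ space with heat kernel $p_t(x,y)$ and canonical diffusion $(X_t)$, $(\mathbb{P}^x)$ as in the context. Assume (A1): there exist $1\le n<\infty$, $T_0>0$ and constants $c_3,c_4>0$ such that $p_t(x,y)\le c_3t^{-n/2}\exp\left(-\frac{d^2(x,y)}{c_4t}\right)$ for all $x,y\in\operatorname{supp}\mathfrak{m}$, $t\in(0,T_0]$; and (A2): there exist $c_1,c_2>0$ such that $\mathfrak{m}(B_r(x))\le c_1r^ne^{c_2r^2}$ for all $r>0$ and all $x\in\operatorname{supp}\mathfrak m$. Let $V\ge0$ be measurable with $\|V\|_{L^p(X)}<\infty$ for some $p>1$, and suppose $\gamma:=1-\frac{n}{2p}>0$. Let $q=\frac{p}{p-1}$, choose $T_1<T_0\wedge\frac{q}{c_4c_2}$, and set $$C_1:=\left(\frac{c_1c_3^q\,q\,\Gamma(\frac n2+1)}{c_4\left(\frac{q-c_2T_1c_4}{c_4}\right)^{\frac n2+1}}\right)^{1/q}.$$ Then for each $\rho>0$, $$\mathbb{E}^x\left[\exp\left(\int_0^tV(X_s)ds\right)\right]\le\exp\left(\rho\left(t\max\left\{\frac1{T_0},\frac{c_4c_2}{q},\left(\frac{C_1\|V\|_{L^p(X)}}{\gamma(1-e^{-\rho})}\right)^{1/\gamma}\right\}+1\right)\right)$$ for all $t\ge0$ and all $x\in\operatorname{supp}\mathfrak{m}$.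
   Context: $(X,d,\mathfrak{m})$: complete separable geodesic metric space with $\sigma$-finite Borel measure, balls of positive finite measure. Cheeger energy $\mathrm{Ch}(f)=\frac12\inf\{\liminf_n\int|Df_n|^2d\mathfrak{m}: f_n$ Lipschitz, $f_n\to f$ in $L^2\}$ with $|Dg|(x)=\limsup_{y\to x}|g(x)-g(y)|/d(x,y)$, and $\mathrm{Ch}(f)=\frac12\int|Df|_w^2d\mathfrak m$; $\Delta$ is the self-adjoint operator of $2\mathrm{Ch}$. $\mathrm{RCD}^*(K,N)$ ($K\in\mathbb{R}$, $N\in[1,\infty)$) means: $\mathrm{Ch}$ quadratic; $\mathfrak{m}(B_r(x_0))\le ce^{c'r^2}$ for some $x_0$, $c,c'>0$; Sobolev functions with $|Df|_w\le1$ have 1-Lipschitz representatives; and the weak Bochner inequality $\frac12\int|Df|_w^2\Delta g-\int\langle Df,D\Delta f\rangle g\ge K\int|Df|_w^2g+\frac1N\int(\Delta f)^2g$ for $f\in\mathcal{D}(\Delta)$, $\Delta f\in\mathcal D(\mathrm{Ch})$, $0\le g\in\mathcal{D}(\Delta)\cap L^\infty$, $\Delta g\in L^\infty$. $p_t(x,y)$ is the locally Hölder continuous representative on $\operatorname{supp}\mathfrak m\times\operatorname{supp}\mathfrak m\times(0,\infty)$ of the heat kernel of $\frac12\Delta$. The canonical diffusion is the diffusion associated with $\mathrm{Ch}$, $\mathbb{P}^x$ having transition density $p_t$, so $\mathbb{E}^x[f(X_t)]=\int p_t(x,y)f(y)d\mathfrak m(y)$ for every $x$. *)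

theory Defs
  imports "HOL-Probability.Probability"
begin

definition geodesic_space :: "'a::metric_space itself \<Rightarrow> bool" where
  "geodesic_space _ \<longleftrightarrow> (\<forall>x y::'a. \<exists>g::real \<Rightarrow> 'a. g 0 = x \<and> g 1 = y \<and>
      (\<forall>s\<in>{0..1}. \<forall>t\<in>{0..1}. dist (g s) (g t) = \<bar>s - t\<bar> * dist x y))"

definition mm_space :: "'a::polish_space measure \<Rightarrow> bool" where
  "mm_space m \<longleftrightarrow> geodesic_space TYPE('a) \<and> sets m = sets borel \<and> sigma_finite_measure m \<and>
     (\<forall>x r. r > 0 \<longrightarrow> 0 < emeasure m (ball x r) \<and> emeasure m (ball x r) < \<infinity>)"

definition msupp :: "'a::metric_space measure \<Rightarrow> 'a set" where
  "msupp m = {x. \<forall>r>0. emeasure m (ball x r) > 0}"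

definition L2 :: "'a measure \<Rightarrow> ('a \<Rightarrow> real) set" where
  "L2 m = {f. f \<in> borel_measurable m \<and> integrable m (\<lambda>x. (f x)\<^sup>2)}"

definition Linf :: "'a measure \<Rightarrow> ('a \<Rightarrow> real) set" where
  "Linf m = {f. f \<in> borel_measurable m \<and> (\<exists>C. AE x in m. \<bar>f x\<bar> \<le> C)}"

definition L2_conv :: "'a measure \<Rightarrow> (nat \<Rightarrow> 'a \<Rightarrow> real) \<Rightarrow> ('a \<Rightarrow> real) \<Rightarrow> bool" where
  "L2_conv m fs f \<longleftrightarrow> f \<in> L2 m \<and> (\<forall>n. fs n \<in> borel_measurable m) \<and>
     ((\<lambda>n. \<integral>\<^sup>+ x. ennreal ((fs n x - f x)\<^sup>2) \<partial>m) \<longlonglongrightarrow> 0)"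

definition L2_weak_conv :: "'a measure \<Rightarrow> (nat \<Rightarrow> 'a \<Rightarrow> real) \<Rightarrow> ('a \<Rightarrow> real) \<Rightarrow> bool" where
  "L2_weak_conv m fs f \<longleftrightarrow> f \<in> L2 m \<and> (\<forall>n. fs n \<in> L2 m) \<and>
     (\<forall>\<phi>\<in>L2 m. (\<lambda>n. \<integral>x. fs n x * \<phi> x \<partial>m) \<longlonglongrightarrow> (\<integral>x. f x * \<phi> x \<partial>m))"

definition lipschitz :: "('a::metric_space \<Rightarrow> real) \<Rightarrow> bool" where
  "lipschitz f \<longleftrightarrow> (\<exists>C. C-lipschitz_on UNIV f)"

text \<open>Local slope |Dg|(x) = limsup_{y \<rightarrow> x} |g x - g y| / d(x,y) (taken to be 0 at isolated points).\<close>
definition lslope :: "('a::metric_space \<Rightarrow> real) \<Rightarrow> 'a \<Rightarrow> real" where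
  "lslope g x = real_of_ereal (max 0 (Limsup (at x) (\<lambda>y. ereal (\<bar>g x - g y\<bar> / dist x y))))"

definition Cheeger :: "'a::metric_space measure \<Rightarrow> ('a \<Rightarrow> real) \<Rightarrow> ennreal" where
  "Cheeger m f = (1/2) * (INF fs \<in> {fs. (\<forall>n. lipschitz (fs n)) \<and> L2_conv m fs f}.
        liminf (\<lambda>n. \<integral>\<^sup>+ x. ennreal ((lslope (fs n) x)\<^sup>2) \<partial>m))"

definition DCh :: "'a::metric_space measure \<Rightarrow> ('a \<Rightarrow> real) set" where
  "DCh m = {f \<in> L2 m. Cheeger m f < \<infinity>}"

text \<open>Relaxed slopes and the minimal one (Ambrosio--Gigli--Savare); this is |Df|_w.\<close>
definition relaxed_slope :: "'a::metric_space measure \<Rightarrow> ('a \<Rightarrow> real) \<Rightarrow> ('a \<Rightarrow> real) \<Rightarrow> bool" where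
  "relaxed_slope m f G \<longleftrightarrow> G \<in> L2 m \<and>
     (\<exists>fs Gt. (\<forall>n. lipschitz (fs n)) \<and> L2_conv m fs f \<and>
        L2_weak_conv m (\<lambda>n. lslope (fs n)) Gt \<and> (AE x in m. Gt x \<le> G x))"

definition wug :: "'a::metric_space measure \<Rightarrow> ('a \<Rightarrow> real) \<Rightarrow> 'a \<Rightarrow> real" where
  "wug m f = (SOME G. relaxed_slope m f G \<and>
      (\<forall>G'. relaxed_slope m f G' \<longrightarrow> (\<integral>x. (G x)\<^sup>2 \<partial>m) \<le> (\<integral>x. (G' x)\<^sup>2 \<partial>m)))"

text \<open>Pointwise inner product <Df,Dg> by polarization (Ch quadratic).\<close>
definition dinner :: "'a::metric_space measure \<Rightarrow> ('a \<Rightarrow> real) \<Rightarrow> ('a \<Rightarrow> real) \<Rightarrow> 'a \<Rightarrow> real" where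
  "dinner m f g x = ((wug m (\<lambda>y. f y + g y) x)\<^sup>2 - (wug m (\<lambda>y. f y - g y) x)\<^sup>2) / 4"

text \<open>Bilinear form associated with 2 Ch.\<close>
definition Eform :: "'a::metric_space measure \<Rightarrow> ('a \<Rightarrow> real) \<Rightarrow> ('a \<Rightarrow> real) \<Rightarrow> real" where
  "Eform m f g = (\<integral>x. dinner m f g x \<partial>m)"

definition Dlap :: "'a::metric_space measure \<Rightarrow> ('a \<Rightarrow> real) set" where
  "Dlap m = {f \<in> DCh m. \<exists>h\<in>L2 m. \<forall>g\<in>DCh m. Eform m f g = - (\<integral>x. h x * g x \<partial>m)}"

definition lap :: "'a::metric_space measure \<Rightarrow> ('a \<Rightarrow> real) \<Rightarrow> 'a \<Rightarrow> real" where
  "lap m f = (SOME h. h \<in> L2 m \<and> (\<forall>g\<in>DCh m. Eform m f g = - (\<integral>x. h x * g x \<partial>m)))"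

definition RCD_star :: "'a::polish_space measure \<Rightarrow> real \<Rightarrow> real \<Rightarrow> bool" where
  "RCD_star m K N \<longleftrightarrow> mm_space m \<and> 1 \<le> N \<and>
    \<comment> \<open>Cheeger energy is quadratic\<close>
    (\<forall>f\<in>L2 m. \<forall>g\<in>L2 m. Cheeger m (\<lambda>x. f x + g x) + Cheeger m (\<lambda>x. f x - g x)
        = 2 * Cheeger m f + 2 * Cheeger m g) \<and>
    \<comment> \<open>volume growth\<close>
    (\<exists>x0 c c'. c > 0 \<and> c' > 0 \<and> (\<forall>r>0. emeasure m (ball x0 r) \<le> ennreal (c * exp (c' * r\<^sup>2)))) \<and>
    \<comment> \<open>Sobolev-to-Lipschitz property\<close>
    (\<forall>f\<in>DCh m. (AE x in m. wug m f x \<le> 1) \<longrightarrow>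
        (\<exists>g. 1-lipschitz_on UNIV g \<and> (AE x in m. f x = g x))) \<and>
    \<comment> \<open>weak Bochner inequality\<close>
    (\<forall>f g. f \<in> Dlap m \<and> lap m f \<in> DCh m \<and> g \<in> Dlap m \<and> g \<in> Linf m \<and>
        (AE x in m. 0 \<le> g x) \<and> lap m g \<in> Linf m \<longrightarrow>
      (1/2) * (\<integral>x. (wug m f x)\<^sup>2 * lap m g x \<partial>m) - (\<integral>x. dinner m f (lap m f) x * g x \<partial>m)
        \<ge> K * (\<integral>x. (wug m f x)\<^sup>2 * g x \<partial>m) + (1/N) * (\<integral>x. (lap m f x)\<^sup>2 * g x \<partial>m))"

text \<open>u solves the heat equation d/dt u = (1/2) \<Delta> u in L^2 with initial datum f,
  i.e. u t = exp(t\<Delta>/2) f (the solution is unique since \<Delta> is self-adjoint and nonpositive).\<close>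
definition heat_flow :: "'a::metric_space measure \<Rightarrow> ('a \<Rightarrow> real) \<Rightarrow> (real \<Rightarrow> 'a \<Rightarrow> real) \<Rightarrow> bool" where
  "heat_flow m f u \<longleftrightarrow> f \<in> L2 m \<and> (\<forall>t\<ge>0. u t \<in> L2 m) \<and> (AE x in m. u 0 x = f x) \<and>
     (\<forall>t\<ge>0. ((\<lambda>s. \<integral>x. (u s x - u t x)\<^sup>2 \<partial>m) \<longlongrightarrow> 0) (at t within {0..})) \<and>
     (\<forall>t>0. u t \<in> Dlap m \<and>
        ((\<lambda>s. \<integral>x. ((u s x - u t x) / (s - t) - (1/2) * lap m (u t) x)\<^sup>2 \<partial>m) \<longlongrightarrow> 0) (at t))"

definition loc_holder_on :: "('b::metric_space \<Rightarrow> real) \<Rightarrow> 'b set \<Rightarrow> bool" where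
  "loc_holder_on F S \<longleftrightarrow> (\<forall>z\<in>S. \<exists>r>0. \<exists>\<alpha>. 0 < \<alpha> \<and> \<alpha> \<le> 1 \<and> (\<exists>C.
      \<forall>z1\<in>S \<inter> ball z r. \<forall>z2\<in>S \<inter> ball z r. \<bar>F z1 - F z2\<bar> \<le> C * dist z1 z2 powr \<alpha>))"

definition heat_kernel :: "'a::metric_space measure \<Rightarrow> (real \<Rightarrow> 'a \<Rightarrow> 'a \<Rightarrow> real) \<Rightarrow> bool" where
  "heat_kernel m p \<longleftrightarrow>
     loc_holder_on (\<lambda>(x, y, t). p t x y) (msupp m \<times> msupp m \<times> {0<..}) \<and>
     (\<forall>f\<in>L2 m. \<exists>u. heat_flow m f u \<and>
        (\<forall>t>0. AE x in m. u t x = (\<integral>y. p t x y * f y \<partial>m)))"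

text \<open>Finite-dimensional distributions prescribed by the transition density p; the list
  contains (time increment, Borel set) pairs.\<close>
fun fdd :: "'a measure \<Rightarrow> (real \<Rightarrow> 'a \<Rightarrow> 'a \<Rightarrow> real) \<Rightarrow> (real \<times> 'a set) list \<Rightarrow> 'a \<Rightarrow> ennreal" where
  "fdd m p [] x = 1"
| "fdd m p ((s, A) # L) x = (\<integral>\<^sup>+ y. ennreal (p s x y) * indicator A y * fdd m p L y \<partial>m)"

text \<open>(X_t) under (P x) is a diffusion (continuous paths) started at x, Markov with transition
  density p: P^x(X_{t_1} \<in> A_1, ..., X_{t_k} \<in> A_k) given by the iterated kernel integrals.\<close>
definition canonical_diffusion ::
    "'a::metric_space measure \<Rightarrow> (real \<Rightarrow> 'a \<Rightarrow> 'a \<Rightarrow> real) \<Rightarrow> ('a \<Rightarrow> 'w measure) \<Rightarrow> (real \<Rightarrow> 'w \<Rightarrow> 'a) \<Rightarrow> bool" where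
  "canonical_diffusion m p P X \<longleftrightarrow> (\<forall>x\<in>msupp m.
      prob_space (P x) \<and>
      (\<forall>t\<ge>0. X t \<in> borel_measurable (P x)) \<and>
      (AE \<omega> in P x. X 0 \<omega> = x \<and> continuous_on {0..} (\<lambda>t. X t \<omega>)) \<and>
      (\<forall>L. (\<forall>(s, A)\<in>set L. s > 0 \<and> A \<in> sets borel) \<longrightarrow>
          emeasure (P x) {\<omega> \<in> space (P x). \<forall>i<length L.
              X (sum_list (map fst (take (Suc i) L))) \<omega> \<in> snd (L ! i)}
          = fdd m p L x))"

definition ennexp :: "ennreal \<Rightarrow> ennreal" where
  "ennexp a = (if a = \<infinity> then \<infinity> else ennreal (exp (enn2real a)))"

end

theory Submission
  imports Defs
begin

text \<open>
  Write \<open>T\<^sub>s V x = \<integral> p\<^sub>s(x,y) V(y) dm(y)\<close> and let \<open>\<tau>\<close> be the reciprocal of the maximum in the exponent. Expanding the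
  exponential and using the Markov property, the exponential moment is the sum of the iterates of
  \<open>u \<mapsto> 1 + \<integral>\<^sub>0\<^sup>t T\<^sub>s(V u(t - s)) ds\<close>, so it is enough that \<open>exp (\<rho> (t / \<tau> + 1))\<close> is a supersolution of this
  renewal equation with \<open>T\<^sub>s V\<close> replaced by an upper bound that does not depend on the starting point.

  The plain Khasminskii argument, which bounds the integral of \<open>T\<^sub>s V\<close> over one time step, would give the rate
  \<open>1 / T1\<close> as well: \<open>C1\<close> controls the \<open>L\<^sup>q\<close> norm of \<open>p\<^sub>s\<close> only up to time \<open>T1\<close>, and \<open>T1\<close> may be much smaller
  than \<open>\<tau>\<close>. Up to time \<open>\<tau>\<close> one therefore combines the Gaussian bound with \<open>\<integral> p\<^sub>s dm = 1\<close>. Interpolating between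
  the two, and using that (A1), (A2) and \<open>\<integral> p\<^sub>s dm = 1\<close> force \<open>c1 c3 c4\<^sup>n\<^sup>/\<^sup>2 \<Gamma>(n/2 + 1) \<ge> 1\<close>, the constant for
  \<open>T1 \<rightarrow> 0\<close> is still correct up to a factor that is at most \<open>1 + 3/2 (1 - \<gamma>) (s / \<tau>)\<^sup>1\<^sup>/\<^sup>2\<close>, and at most
  \<open>exp (1 - \<gamma>)\<close>. After a suitable time the monotonicity of \<open>s \<mapsto> sup T\<^sub>s V\<close> takes over. The resulting loss is
  compensated by the slack in Khasminskii's lemma: the supersolution property only needs the primitive \<open>W\<close> of the
  rescaled kernel bound to have a tangent line \<open>A + B z\<close> with \<open>A \<le> 1\<close> and \<open>A + B / \<rho> \<le> 1 / (1 - exp (- \<rho>))\<close>.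
\<close>

section \<open>Explicit inequalities for exponential and logarithm\<close>

text \<open>The choice of the tangent line: \<open>A + B / \<rho>\<close> is the mean of
  \<open>A + B z\<close> under the exponential law of rate \<rho>. The kernel bound decreases in
  time, so \<open>W\<close> is concave and lies below its tangent lines. Among them, the one
  touching at \<open>z = 1 / \<rho>\<close> makes the mean smallest, with value
  \<open>W (1 / \<rho>)\<close>. The touching point \<open>v0\<close> must however stay where the
  kernel estimate is available, which is \<open>v0 \<le> 1\<close>, and
  \<open>v0 \<le> 36/49\<close> if \<gamma> < 1/3. If \<open>1 / \<rho>\<close> lies beyond this
  range, \<open>v0\<close> is its right end and
  \<open>1/\<rho> + 1/2 \<le> 1 / (1 - exp (- \<rho>))\<close> compensates. For \<gamma> \<ge> 2/3
  the constant factor \<open>exp (1 - \<gamma>)\<close> is cheap enough to take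
  \<open>v0 = 1\<close> for every \<rho>. For small \<gamma>, both the condition
  \<open>A \<le> 1\<close> and the polynomial inequality behind the loss factor break down near
  \<open>v = 1\<close>; \<open>36/49\<close> avoids this and has the rational root
  \<open>6/7\<close>. What remains are inequalities in two real variables between exponentials,
  logarithms and roots. They are reduced to rational arithmetic on finitely many intervals by Pade
  bounds.\<close>

lemma ln_add_one_lower_bound:
  fixes x :: real assumes "0 \<le> x" shows "2 * x / (2 + x) \<le> ln (1 + x)"
proof -
  let ?F = "\<lambda>y::real. ln (1 + y) - 2 * y / (2 + y)"
  have "?F 0 \<le> ?F x"
  proof (rule DERIV_nonneg_imp_nondecreasing[OF assms])
    fix y :: real assume y: "0 \<le> y" "y \<le> x"
    have "(?F has_real_derivative (1 / (1 + y) - (2 * (2 + y) - 2 * y) / (2 + y)^2)) (at y)"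
      using y by (auto intro!: derivative_eq_intros simp: power2_eq_square)
    moreover have "0 \<le> 1 / (1 + y) - (2 * (2 + y) - 2 * y) / (2 + y)^2"
    proof -
      have "1 / (1 + y) - (2 * (2 + y) - 2 * y) / (2 + y)^2 = y^2 / ((1 + y) * (2 + y)^2)"
        using y by (simp add: divide_simps) (simp add: power2_eq_square algebra_simps)
      then show ?thesis using y by simp
    qed
    ultimately show "\<exists>z. DERIV ?F y :> z \<and> 0 \<le> z" by blast
  qed
  then show ?thesis by simp
qed

text \<open>The (1,1) Pade approximant. It is the logarithmic bound read backwards:
  \<open>x = 2 y / (2 - y)\<close> solves \<open>2 x / (2 + x) = y\<close>.\<close>

lemma exp_le_pade:
  fixes y :: real assumes "0 \<le> y" "y < 2" shows "exp y \<le> (2 + y) / (2 - y)"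
proof -
  define x where "x = 2 * y / (2 - y)"
  have x: "0 \<le> x" "1 + x = (2 + y) / (2 - y)" "2 * x / (2 + x) = y"
    using assms by (auto simp: x_def field_simps)
  have "y \<le> ln (1 + x)" using ln_add_one_lower_bound[OF x(1)] x(3) by simp
  then have "exp y \<le> 1 + x" using x(1) by (metis add_pos_nonneg exp_le_cancel_iff exp_ln zero_less_one)
  then show ?thesis using x by simp
qed

text \<open>The square of the (3,3) Pade approximant of \<open>exp (y / 2)\<close>.\<close>
lemma exp_le_pade_square:
  fixes y :: real assumes y: "0 \<le> y" "y \<le> 8"
  shows "0 < 960 - 240 * y + 24 * y\<^sup>2 - y ^ 3"
    and "exp y * (960 - 240 * y + 24 * y\<^sup>2 - y ^ 3)\<^sup>2 \<le> (960 + 240 * y + 24 * y\<^sup>2 + y ^ 3)\<^sup>2"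
proof -
  let ?N = "\<lambda>z::real. 960 + 240 * z + 24 * z\<^sup>2 + z ^ 3"
  let ?M = "\<lambda>z::real. 960 - 240 * z + 24 * z\<^sup>2 - z ^ 3"
  have Mpos: "0 < ?M z" if "0 \<le> z" "z \<le> 8" for z
  proof -
    have "0 \<le> (8 - z) * ((z - 8)\<^sup>2 + 48)" using that by simp
    moreover have "?M z = (8 - z) * ((z - 8)\<^sup>2 + 48) + 64" by (simp add: power2_eq_square power3_eq_cube algebra_simps)
    ultimately show ?thesis by simp
  qed
  show "0 < 960 - 240 * y + 24 * y\<^sup>2 - y ^ 3" using Mpos y by simp
  let ?F = "\<lambda>z. 2 * ln (?N z) - 2 * ln (?M z) - z"
  have "?F 0 \<le> ?F y"
  proof (rule DERIV_nonneg_imp_nondecreasing[OF y(1)])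
    fix z assume z: "0 \<le> z" "z \<le> y"
    have M: "0 < ?M z" using Mpos z y by simp
    have N: "0 < ?N z" using z by (simp add: add_pos_nonneg)
    have dN: "((\<lambda>z. ln (?N z)) has_real_derivative (240 + 48 * z + 3 * z\<^sup>2) / ?N z) (at z)"
      using N by (auto intro!: derivative_eq_intros)
    have dM: "((\<lambda>z. ln (?M z)) has_real_derivative (- 240 + 48 * z - 3 * z\<^sup>2) / ?M z) (at z)"
      using M by (auto intro!: derivative_eq_intros)
    have "(?F has_real_derivative 2 * ((240 + 48 * z + 3 * z\<^sup>2) / ?N z) - 2 * ((- 240 + 48 * z - 3 * z\<^sup>2) / ?M z) - 1) (at z)"
      by (intro DERIV_diff DERIV_cmult dN dM DERIV_ident)
    \<comment> \<open>All lower powers cancel, as they must for a Pade approximant, and the single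
      monomial left over makes the sign evident.\<close>
    moreover have "2 * ((240 + 48 * z + 3 * z\<^sup>2) / ?N z) - 2 * ((- 240 + 48 * z - 3 * z\<^sup>2) / ?M z) - 1
        = z ^ 6 / (?N z * ?M z)"
    proof -
      have aux: "2 * (P / n) - 2 * (Q / k) - 1 = R / (n * k)"
        if "n > 0" "k > 0" "2 * P * k - 2 * Q * n - n * k = R" for n k P Q R :: real
        using that by (simp add: field_simps)
      show ?thesis
        by (rule aux[OF N M]) (simp add: power2_eq_square power3_eq_cube algebra_simps eval_nat_numeral)
    qed
    ultimately show "\<exists>d. DERIV ?F z :> d \<and> 0 \<le> d" using M N by auto
  qed
  then have le: "y + 2 * ln (?M y) \<le> 2 * ln (?N y)" by simp
  have M: "0 < ?M y" and N: "0 < ?N y" using Mpos y by (auto simp: add_pos_nonneg)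
  have "exp (y + 2 * ln (?M y)) \<le> exp (2 * ln (?N y))" using le by (simp only: exp_le_cancel_iff)
  moreover have "exp (2 * ln z) = z\<^sup>2" if "0 < z" for z :: real
    using that by (simp add: exp_double)
  ultimately show "exp y * (?M y)\<^sup>2 \<le> (?N y)\<^sup>2" using M N by (simp only: exp_add)
qed

section \<open>Rational certificates for values of exp and ln\<close>

lemma exp_minus_ge_of_pade:
  fixes b e0 :: real
  assumes b: "0 \<le> b" "b \<le> 8" and e0: "0 < e0"
    "e0 * (960 + 240 * b + 24 * b\<^sup>2 + b ^ 3)\<^sup>2 \<le> (960 - 240 * b + 24 * b\<^sup>2 - b ^ 3)\<^sup>2"
  shows "e0 \<le> exp (- b)"
proof -
  note M = exp_le_pade_square[OF b]
  have "e0 * exp b * (960 - 240 * b + 24 * b\<^sup>2 - b ^ 3)\<^sup>2 \<le> e0 * (960 + 240 * b + 24 * b\<^sup>2 + b ^ 3)\<^sup>2"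
    using M(2) e0 by (simp add: mult.assoc)
  also have "\<dots> \<le> 1 * (960 - 240 * b + 24 * b\<^sup>2 - b ^ 3)\<^sup>2" using e0 by simp
  finally have "e0 * exp b \<le> 1" using M(1) by (subst (asm) mult_le_cancel_right) (auto simp: power2_eq_square)
  then show ?thesis by (simp add: exp_minus field_simps)
qed

lemma ln_ge_of_pade:
  fixes a L0 :: real
  assumes L0: "0 \<le> L0" "L0 \<le> 8" and a: "0 < a"
    "(960 + 240 * L0 + 24 * L0\<^sup>2 + L0 ^ 3)\<^sup>2 \<le> a * (960 - 240 * L0 + 24 * L0\<^sup>2 - L0 ^ 3)\<^sup>2"
  shows "L0 \<le> ln a"
proof -
  note M = exp_le_pade_square[OF L0]
  have "exp L0 * (960 - 240 * L0 + 24 * L0\<^sup>2 - L0 ^ 3)\<^sup>2 \<le> a * (960 - 240 * L0 + 24 * L0\<^sup>2 - L0 ^ 3)\<^sup>2"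
    using M(2) a by linarith
  then have "exp L0 \<le> a" using M(1) by (subst (asm) mult_le_cancel_right) (auto simp: power2_eq_square)
  then show ?thesis using a by (metis exp_ln exp_le_cancel_iff)
qed

text \<open>The left-hand side is the beginning of the expansion of the right-hand side at
  \<open>r = 0\<close>. Below 2 this is the (1,1) Pade bound; from 2 on, the left-hand side is at
  most 1. It serves the small \<open>r\<close>, for which \<open>1 / r\<close> is not an admissible
  touching point.\<close>

lemma one_div_one_minus_exp_lower_bound:
  fixes r :: real assumes "0 < r" shows "1 / r + 1 / 2 \<le> 1 / (1 - exp (- r))"
proof (cases "r < 2")
  case True
  have "exp (- r) \<ge> (2 - r) / (2 + r)"
    using exp_le_pade[of r] assms True by (simp add: exp_minus field_simps)
  then have "1 - exp (- r) \<le> 2 * r / (2 + r)" using assms by (simp add: field_simps)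
  then have "1 / (2 * r / (2 + r)) \<le> 1 / (1 - exp (- r))"
    using assms by (intro divide_left_mono) auto
  moreover have "1 / (2 * r / (2 + r)) = 1 / r + 1 / 2" using assms by (simp add: field_simps)
  ultimately show ?thesis by simp
next
  case False
  then have "1 / r + 1 / 2 \<le> 1" by (simp add: field_simps)
  also have "1 \<le> 1 / (1 - exp (- r))" using assms by (simp add: field_simps)
  finally show ?thesis .
qed

text \<open>The claim amounts to \<open>exp r \<le> (A r + B) / (B - (1 - A) r)\<close>. Both sides agree at \<open>r = 0\<close>, and the quadratic
  hypothesis says that the logarithmic derivative of the right-hand side is at least 1.\<close>
lemma one_minus_exp_mult_affine_le:
  fixes A B r :: real
  assumes r: "0 < r" and A: "0 \<le> A" "A \<le> 1" and B: "0 < B"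
    and quad: "\<And>y. 0 \<le> y \<Longrightarrow> 0 \<le> A * (1 - A) * y\<^sup>2 - (2 * A - 1) * B * y + B * (1 - B)"
  shows "A + B / r \<le> 1 / (1 - exp (- r))"
proof (cases "B - (1 - A) * r > 0")
  case False
  then have "A + B / r \<le> 1" using r by (simp add: field_simps)
  also have "1 \<le> 1 / (1 - exp (- r))" using r by (simp add: field_simps)
  finally show ?thesis .
next
  case True
  let ?F = "\<lambda>y. ln (A * y + B) - ln (B - (1 - A) * y) - y"
  have "?F 0 \<le> ?F r"
  proof (rule DERIV_nonneg_imp_nondecreasing[OF less_imp_le[OF r]])
    fix y :: real assume y: "0 \<le> y" "y \<le> r"
    have "(1 - A) * y \<le> (1 - A) * r" using y A by (intro mult_left_mono) auto
    then have p1: "B - (1 - A) * y > 0" using True by linarith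
    have p2: "A * y + B > 0" using A B y by (simp add: add_nonneg_pos)
    have "((\<lambda>y. ln (A * y + B)) has_real_derivative A / (A * y + B)) (at y)"
      "((\<lambda>y. ln (B - (1 - A) * y)) has_real_derivative - (1 - A) / (B - (1 - A) * y)) (at y)"
      using p1 p2 by (auto intro!: derivative_eq_intros)
    then have "(?F has_real_derivative (A / (A * y + B) - - (1 - A) / (B - (1 - A) * y) - 1)) (at y)"
      by (intro DERIV_diff DERIV_ident)
    moreover have "A / (A * y + B) - - (1 - A) / (B - (1 - A) * y) - 1
        = (A * (1 - A) * y\<^sup>2 - (2 * A - 1) * B * y + B * (1 - B)) / ((A * y + B) * (B - (1 - A) * y))"
      using p1 p2 by (simp add: divide_simps) (simp add: power2_eq_square algebra_simps)
    moreover have "0 \<le> (A * (1 - A) * y\<^sup>2 - (2 * A - 1) * B * y + B * (1 - B)) / ((A * y + B) * (B - (1 - A) * y))"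
      using quad[OF y(1)] p1 p2 by (intro divide_nonneg_pos mult_pos_pos)
    ultimately show "\<exists>z. DERIV ?F y :> z \<and> 0 \<le> z" by auto
  qed
  then have "r + ln (B - (1 - A) * r) \<le> ln (A * r + B)" by simp
  then have "exp (r + ln (B - (1 - A) * r)) \<le> exp (ln (A * r + B))" by (simp only: exp_le_cancel_iff)
  moreover have "A * r + B > 0" using A B r by (simp add: add_nonneg_pos)
  ultimately have "exp r * (B - (1 - A) * r) \<le> A * r + B" using True by (simp add: exp_add)
  then have "B - (1 - A) * r \<le> exp (- r) * (A * r + B)"
    by (simp add: exp_minus field_simps)
  then have "(A * r + B) * (1 - exp (- r)) \<le> r" by (simp add: algebra_simps)
  then show ?thesis using r by (simp add: field_simps)
qed

text \<open>The line is the tangent at 1 of \<open>exp (1 - g) * z powr g\<close>. With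
  \<open>d = 1 - g\<close> and \<open>u = exp (- d)\<close>, the three coefficients of the quadratic
  in the affine criterion are nonnegative once \<open>u \<ge> 2 d\<close>. The bound
  \<open>u \<ge> 1 - d\<close> yields this exactly for \<open>d \<le> 1/3\<close>, hence the
  threshold \<open>2/3\<close>.\<close>

lemma profile_large_gamma:
  fixes g r :: real
  assumes g: "2 / 3 \<le> g" "g < 1" and r: "0 < r"
  shows "(1 - g) * exp (1 - g) \<le> 1"
    and "(1 - g) * exp (1 - g) + g * exp (1 - g) / r \<le> 1 / (1 - exp (- r))"
proof -
  define d where "d = 1 - g"
  have d: "0 < d" "d \<le> 1 / 3" using g by (auto simp: d_def)
  define u where "u = exp (- d)"
  have u: "u \<ge> 1 - d" "u \<le> 1" "u > 0" "exp d = 1 / u"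
    using exp_ge_add_one_self[of "- d"] d by (auto simp: u_def exp_minus field_simps)
  have u2: "u \<ge> 2 * d" using u(1) d by linarith
  have e: "exp (1 - g) = 1 / u" using u by (simp add: d_def)
  show A1: "(1 - g) * exp (1 - g) \<le> 1"
  proof -
    have "d / u \<le> 1" using u(3) u2 d(1) by (simp add: divide_le_eq)
    then show ?thesis unfolding e by (simp add: d_def)
  qed
  show "(1 - g) * exp (1 - g) + g * exp (1 - g) / r \<le> 1 / (1 - exp (- r))"
  proof (rule one_minus_exp_mult_affine_le[OF r])
    show "0 \<le> (1 - g) * exp (1 - g)" "(1 - g) * exp (1 - g) \<le> 1" "0 < g * exp (1 - g)"
      using A1 g by auto
    fix y :: real assume y: "0 \<le> y"
    have "0 \<le> (d * (u - d) * y\<^sup>2 + (1 - d) * (u - 2 * d) * y + (1 - d) * (u - (1 - d))) / u\<^sup>2"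
      using u u2 d y by (intro divide_nonneg_nonneg add_nonneg_nonneg mult_nonneg_nonneg) auto
    also have "\<dots> = (1 - g) * exp (1 - g) * (1 - (1 - g) * exp (1 - g)) * y\<^sup>2
        - (2 * ((1 - g) * exp (1 - g)) - 1) * (g * exp (1 - g)) * y + g * exp (1 - g) * (1 - g * exp (1 - g))"
      unfolding e using u(3) by (simp add: divide_simps d_def) (simp add: algebra_simps power2_eq_square)
    finally show "0 \<le> \<dots>" .
  qed
qed

text \<open>Bound for the \<open>L\<^sup>q\<close> norm of the kernel at time \<open>v \<tau>\<close>, relative to the constant valid for small times.\<close>
definition loss_factor :: "real \<Rightarrow> real \<Rightarrow> real" where
  "loss_factor g v = (if 2 / 3 \<le> g then exp (1 - g) else 1 + 3 / 2 * (1 - g) * sqrt v)"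

section \<open>The inequality for the touching point 1/r, interval by interval\<close>

text \<open>On \<open>[a, b]\<close> the numbers \<open>e0\<close>, \<open>L0\<close>, \<open>s0\<close> bound \<open>exp (- r)\<close>, \<open>ln r\<close> and \<open>3 / sqrt r\<close>. With these bounds the claim is a
  quadratic inequality in \<open>g\<close>; \<open>disc\<close> says that it has no real root, or that its minimum on \<open>[0, 1/3]\<close> is at \<open>1/3\<close>.\<close>
lemma quadratic_piece:
  fixes a b e0 L0 s0 g r :: real
  assumes g: "0 \<le> g" "g \<le> 1 / 3" and r: "a \<le> r" "r \<le> b" and a: "1 < a" and b: "b \<le> 8"
    and e0: "e0 > 0" "e0 < 1" "e0 * (960 + 240 * b + 24 * b\<^sup>2 + b ^ 3)\<^sup>2 \<le> (960 - 240 * b + 24 * b\<^sup>2 - b ^ 3)\<^sup>2"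
    and L0: "0 < L0" "L0 \<le> 8" "(960 + 240 * L0 + 24 * L0\<^sup>2 + L0 ^ 3)\<^sup>2 \<le> a * (960 - 240 * L0 + 24 * L0\<^sup>2 - L0 ^ 3)\<^sup>2"
    and s0: "0 < s0" "9 \<le> s0\<^sup>2 * a"
    and disc: "(s0 * (1 - e0) - L0 - 3 * e0)\<^sup>2 \<le> 12 * e0 * L0
       \<or> (2 * L0 \<le> s0 * (1 - e0) - L0 - 3 * e0 \<and> s0 * (1 - e0) - L0 - 3 * e0 \<le> 3 * e0 + L0)"
  shows "(1 - exp (- r)) * (1 + 3 * g / (1 + 3 * g) / sqrt r) \<le> 1 + g * ln r"
proof -
  have "e0 \<le> exp (- b)" using a b r e0 by (intro exp_minus_ge_of_pade) auto
  also have "\<dots> \<le> exp (- r)" using r by simp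
  finally have e1: "e0 \<le> exp (- r)" .
  have "L0 \<le> ln a" using a L0 by (intro ln_ge_of_pade) auto
  also have "\<dots> \<le> ln r" using a r by simp
  finally have L1: "L0 \<le> ln r" .
  have s1: "3 / sqrt r \<le> s0"
  proof -
    have "3 = sqrt 9" by (simp add: real_sqrt_unique)
    also have "\<dots> \<le> sqrt (s0\<^sup>2 * r)"
      using s0 r a by (intro real_sqrt_le_mono order_trans[OF s0(2)] mult_left_mono) auto
    also have "\<dots> = s0 * sqrt r" using s0 by (simp add: real_sqrt_mult)
    finally show ?thesis using a r by (simp add: field_simps)
  qed
  define e where "e = exp (- r)"
  have e: "e0 \<le> e" "0 < e" "e < 1" using e1 a r by (auto simp: e_def)
  define L where "L = ln r"
  define m where "m = s0 * (1 - e0) - L0 - 3 * e0"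
  have Q0: "0 \<le> e0 - g * m + 3 * g\<^sup>2 * L0"
    using disc
  proof
    assume "(s0 * (1 - e0) - L0 - 3 * e0)\<^sup>2 \<le> 12 * e0 * L0"
    then have "m\<^sup>2 \<le> 12 * e0 * L0" by (simp add: m_def)
    moreover have "12 * L0 * (e0 - g * m + 3 * g\<^sup>2 * L0) = (6 * L0 * g - m)\<^sup>2 + (12 * e0 * L0 - m\<^sup>2)"
      by (simp add: power2_eq_square algebra_simps)
    ultimately have "0 \<le> 12 * L0 * (e0 - g * m + 3 * g\<^sup>2 * L0)" by simp
    then show ?thesis using L0(1) by (simp add: zero_le_mult_iff)
  next
    assume "2 * L0 \<le> s0 * (1 - e0) - L0 - 3 * e0 \<and> s0 * (1 - e0) - L0 - 3 * e0 \<le> 3 * e0 + L0"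
    then have h: "2 * L0 \<le> m" "m \<le> 3 * e0 + L0" by (auto simp: m_def)
    have "e0 - g * m + 3 * g\<^sup>2 * L0 = (e0 - m / 3 + L0 / 3) + (1 / 3 - g) * (m - 2 * L0) + 3 * L0 * (1 / 3 - g)\<^sup>2"
      by (simp add: power2_eq_square algebra_simps)
    moreover have "0 \<le> (1 / 3 - g) * (m - 2 * L0)" using h g by simp
    moreover have "0 \<le> 3 * L0 * (1 / 3 - g)\<^sup>2" using L0 by simp
    ultimately show ?thesis using h L0 by linarith
  qed
  \<comment> \<open>This is the claim multiplied by \<open>1 + 3 g\<close>. Once the three
    transcendental values are replaced by their rational bounds, the difference of the two sides is
    exactly the quadratic in \<open>Q0\<close>.\<close>
  have "(1 - e) * (1 + 3 * g + g * (3 / sqrt r)) \<le> (1 + 3 * g) * (1 + g * L)"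
  proof -
    have "(1 - e) * (g * (3 / sqrt r)) \<le> (1 - e0) * (g * s0)"
      using s1 e g a r by (intro mult_mono) auto
    moreover have "(1 - e) * (1 + 3 * g) \<le> (1 - e0) * (1 + 3 * g)"
      using e g by (intro mult_right_mono) auto
    moreover have "(1 + 3 * g) * (1 + g * L0) \<le> (1 + 3 * g) * (1 + g * L)"
      using g L1 by (auto intro!: mult_left_mono simp: L_def)
    moreover have "(1 - e0) * (1 + 3 * g) + (1 - e0) * (g * s0) \<le> (1 + 3 * g) * (1 + g * L0)"
      using Q0 by (simp add: m_def algebra_simps power2_eq_square)
    ultimately show ?thesis unfolding distrib_left by linarith
  qed
  then have "(1 - e) * ((1 + 3 * g + g * (3 / sqrt r)) / (1 + 3 * g)) \<le> 1 + g * L"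
    using g by (simp add: field_simps)
  moreover have eq: "(1 + 3 * g + g * (3 / sqrt r)) / (1 + 3 * g) = 1 + 3 * g / (1 + 3 * g) / sqrt r"
    using g by (simp add: divide_simps)
  ultimately show ?thesis by (simp only: e_def L_def)
qed

text \<open>This is \<open>W (1 / r) \<le> 1 / (1 - exp (- r))\<close> in disguise:
  \<open>W (1 / r)\<close> equals \<open>(1 + c / sqrt r) / r powr g\<close> with the coefficient
  \<open>c = 3 g (1 - g) / (1 + 2 g)\<close>, and \<open>1 + g ln r \<le> r powr g\<close>. The
  bound \<open>34/25\<close> is slightly below \<open>49/36\<close>, so every touching point
  \<open>1 / r \<le> 36/49\<close> is covered.\<close>

lemma jensen_small_gamma:
  fixes g r :: real
  assumes g: "0 < g" "g \<le> 1 / 3" and r: "34 / 25 \<le> r"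
  shows "(1 - exp (- r)) * (1 + 3 * g * (1 - g) / (1 + 2 * g) / sqrt r) \<le> 1 + g * ln r"
proof -
  have "(1 - g) * (1 + 3 * g) \<le> 1 + 2 * g" by (simp add: algebra_simps)
  then have "3 * g * ((1 - g) * (1 + 3 * g)) \<le> 3 * g * (1 + 2 * g)" using g by (intro mult_left_mono) auto
  then have c: "3 * g * (1 - g) / (1 + 2 * g) \<le> 3 * g / (1 + 3 * g)" using g by (simp add: field_simps)
  have "(1 - exp (- r)) * (1 + 3 * g * (1 - g) / (1 + 2 * g) / sqrt r)
      \<le> (1 - exp (- r)) * (1 + 3 * g / (1 + 3 * g) / sqrt r)"
    using c r by (intro mult_left_mono add_left_mono divide_right_mono) auto
  also have "\<dots> \<le> 1 + g * ln r"
  proof (cases "r \<le> 43 / 10")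
    case False
    have "1455 / 1000 \<le> ln (43 / 10 :: real)" by (rule ln_ge_of_pade) (auto simp: power2_eq_square power3_eq_cube)
    also have "\<dots> \<le> ln r" using False by (intro ln_mono) auto
    finally have L: "1455 / 1000 \<le> ln r" .
    have s: "207 / 100 \<le> sqrt r" using False by (intro real_le_rsqrt) (auto simp: power2_eq_square power3_eq_cube)
    have "3 \<le> (1455 / 1000) * (207 / 100 :: real)" by simp
    also have "\<dots> \<le> ln r * sqrt r" using L s by (intro mult_mono) auto
    finally have "3 / sqrt r \<le> ln r" using False by (simp add: divide_le_eq)
    then have "g * (3 / sqrt r) \<le> g * ln r" using g by (intro mult_left_mono) auto
    moreover have "3 * g / (1 + 3 * g) / sqrt r \<le> g * (3 / sqrt r)"
    proof -
      have "3 * g / (1 + 3 * g) \<le> 3 * g" using g by (simp add: field_simps)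
      from divide_right_mono[OF this, of "sqrt r"] show ?thesis using r by (simp add: mult.commute)
    qed
    moreover have "(1 - exp (- r)) * (1 + 3 * g / (1 + 3 * g) / sqrt r) \<le> 1 * (1 + 3 * g / (1 + 3 * g) / sqrt r)"
      using g r by (intro mult_right_mono) auto
    moreover have "1 * (1 + 3 * g / (1 + 3 * g) / sqrt r) = 1 + 3 * g / (1 + 3 * g) / sqrt r" by (rule mult_1)
    ultimately show ?thesis by argo
  next
    case True
    consider "r \<le> 73/50" | "73/50 \<le> r" "r \<le> 79/50" | "79/50 \<le> r" "r \<le> 43/25" | "43/25 \<le> r" "r \<le> 19/10"
      | "19/10 \<le> r" "r \<le> 53/25" | "53/25 \<le> r" "r \<le> 12/5" | "12/5 \<le> r" "r \<le> 14/5"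
      | "14/5 \<le> r" "r \<le> 17/5" | "17/5 \<le> r" by linarith
    then show ?thesis
    proof cases
      case 1 then show ?thesis using g r
        by (intro quadratic_piece[of g "34 / 25" r "73 / 50" "1161 / 5000" "1537 / 5000" "2573 / 1000"]) (auto simp: power2_eq_square power3_eq_cube)
    next
      case 2 then show ?thesis using g
        by (intro quadratic_piece[of g "73 / 50" r "79 / 50" "2059 / 10000" "473 / 1250" "2483 / 1000"]) (auto simp: power2_eq_square power3_eq_cube)
    next
      case 3 then show ?thesis using g
        by (intro quadratic_piece[of g "79 / 50" r "43 / 25" "179 / 1000" "2287 / 5000" "2387 / 1000"]) (auto simp: power2_eq_square power3_eq_cube)
    next
      case 4 then show ?thesis using g
        by (intro quadratic_piece[of g "43 / 25" r "19 / 10" "299 / 2000" "5423 / 10000" "286 / 125"]) (auto simp: power2_eq_square power3_eq_cube)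
    next
      case 5 then show ?thesis using g
        by (intro quadratic_piece[of g "19 / 10" r "53 / 25" "3 / 25" "3209 / 5000" "2177 / 1000"]) (auto simp: power2_eq_square power3_eq_cube)
    next
      case 6 then show ?thesis using g
        by (intro quadratic_piece[of g "53 / 25" r "12 / 5" "453 / 5000" "7513 / 10000" "2061 / 1000"]) (auto simp: power2_eq_square power3_eq_cube)
    next
      case 7 then show ?thesis using g
        by (intro quadratic_piece[of g "12 / 5" r "14 / 5" "607 / 10000" "4377 / 5000" "1937 / 1000"]) (auto simp: power2_eq_square power3_eq_cube)
    next
      case 8 then show ?thesis using g
        by (intro quadratic_piece[of g "14 / 5" r "17 / 5" "333 / 10000" "2059 / 2000" "1793 / 1000"]) (auto simp: power2_eq_square power3_eq_cube)
    next
      case 9 then show ?thesis using g True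
        by (intro quadratic_piece[of g "17 / 5" r "43 / 10" "27 / 2000" "12237 / 10000" "1627 / 1000"]) (auto simp: power2_eq_square power3_eq_cube)
    qed
  qed
  finally show ?thesis .
qed

text \<open>For \<open>g \<ge> 1/3\<close> two crude estimates decouple \<open>g\<close> from
  \<open>r\<close>: \<open>g ln r \<ge> ln r / 3\<close>, and the coefficient is at most
  \<open>403/1000\<close> for all \<open>g\<close>. On \<open>[a, b]\<close> the numbers
  \<open>e0\<close>, \<open>L0\<close>, \<open>s0\<close> then bound \<open>exp (- r)\<close>,
  \<open>ln r\<close> and \<open>1 / sqrt r\<close>.\<close>

lemma constant_piece:
  fixes a b e0 L0 s0 g r :: real
  assumes g: "1 / 3 \<le> g" and r: "a \<le> r" "r \<le> b" and a: "1 \<le> a" and b: "b \<le> 8"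
    and e0: "e0 > 0" "e0 * (960 + 240 * b + 24 * b\<^sup>2 + b ^ 3)\<^sup>2 \<le> (960 - 240 * b + 24 * b\<^sup>2 - b ^ 3)\<^sup>2"
    and L0: "0 \<le> L0" "L0 \<le> 8" "(960 + 240 * L0 + 24 * L0\<^sup>2 + L0 ^ 3)\<^sup>2 \<le> a * (960 - 240 * L0 + 24 * L0\<^sup>2 - L0 ^ 3)\<^sup>2"
    and s0: "0 < s0" "1 \<le> s0\<^sup>2 * a"
    and c: "0 \<le> c" "c \<le> 403 / 1000"
    and le: "(1 - e0) * (1 + 403 / 1000 * s0) \<le> 1 + L0 / 3"
  shows "(1 - exp (- r)) * (1 + c / sqrt r) \<le> 1 + g * ln r"
proof -
  have "e0 \<le> exp (- b)" using a b r e0 by (intro exp_minus_ge_of_pade) auto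
  also have "\<dots> \<le> exp (- r)" using r by simp
  finally have e1: "e0 \<le> exp (- r)" .
  have "L0 \<le> ln a" using a L0 by (intro ln_ge_of_pade) auto
  also have "\<dots> \<le> ln r" using a r by simp
  finally have L1: "L0 \<le> ln r" .
  have "1 = sqrt 1" by simp
  also have "\<dots> \<le> sqrt (s0\<^sup>2 * r)"
    using s0 r a by (intro real_sqrt_le_mono order_trans[OF s0(2)] mult_left_mono) auto
  also have "\<dots> = s0 * sqrt r" using s0 by (simp add: real_sqrt_mult)
  finally have s1: "1 / sqrt r \<le> s0" using a r by (simp add: field_simps)
  have "c / sqrt r = c * (1 / sqrt r)" by simp
  also have "\<dots> \<le> 403 / 1000 * s0" using s1 c a r by (intro mult_mono) auto
  finally have "(1 - exp (- r)) * (1 + c / sqrt r) \<le> (1 - e0) * (1 + 403 / 1000 * s0)"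
    using e1 c a r order_trans[OF e1, of 1] by (intro mult_mono) auto
  also have "\<dots> \<le> 1 + 1 / 3 * L0" using le by simp
  also have "\<dots> \<le> 1 + g * ln r" using g L1 L0 by (intro add_left_mono mult_mono) auto
  finally show ?thesis .
qed

lemma profile_coefficient_le:
  fixes g :: real assumes "0 \<le> g" shows "3 * g * (1 - g) / (1 + 2 * g) \<le> 403 / 1000"
proof -
  \<comment> \<open>The maximum over \<open>g\<close> is \<open>3 - 3/2 sqrt 3\<close>, about 0.402.
    After clearing the denominator the difference of the two sides is a quadratic with vertex
    \<open>1097/3000\<close>.\<close>
  have "0 \<le> 3 * (g - 1097/3000)\<^sup>2" by simp
  then have "3 * g * (1 - g) \<le> 403 / 1000 * (1 + 2 * g)" by (simp add: power2_eq_square algebra_simps)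
  then show ?thesis using assms by (simp add: field_simps)
qed

lemma jensen_medium_gamma:
  fixes g r :: real
  assumes g: "1 / 3 \<le> g" "g \<le> 1" and r: "1 \<le> r"
  shows "(1 - exp (- r)) * (1 + 3 * g * (1 - g) / (1 + 2 * g) / sqrt r) \<le> 1 + g * ln r"
proof -
  define c where "c = 3 * g * (1 - g) / (1 + 2 * g)"
  have c: "0 \<le> c" "c \<le> 403 / 1000" using g profile_coefficient_le[of g] by (auto simp: c_def)
  have "(1 - exp (- r)) * (1 + c / sqrt r) \<le> 1 + g * ln r"
  proof (cases "r \<le> 23 / 10")
    case False
    have "83 / 100 \<le> ln (23 / 10 :: real)" by (rule ln_ge_of_pade) (auto simp: power2_eq_square power3_eq_cube)
    also have "\<dots> \<le> ln r" using False by (intro ln_mono) auto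
    finally have L: "83 / 100 \<le> ln r" .
    have s: "3 / 2 \<le> sqrt r" using False by (intro real_le_rsqrt) (auto simp: power2_eq_square power3_eq_cube)
    have "c / sqrt r \<le> (403 / 1000) / (3 / 2)" using s c by (intro frac_le) auto
    also have "\<dots> \<le> 1 / 3 * (83 / 100)" by simp
    also have "\<dots> \<le> g * ln r" using g L by (intro mult_mono) auto
    finally have "1 + c / sqrt r \<le> 1 + g * ln r" by simp
    moreover have "(1 - exp (- r)) * (1 + c / sqrt r) \<le> 1 * (1 + c / sqrt r)"
      using c r by (intro mult_right_mono) auto
    ultimately show ?thesis by (metis mult_1 order_trans)
  next
    case True
    consider "r \<le> 6/5" | "6/5 \<le> r" "r \<le> 7/5" | "7/5 \<le> r" "r \<le> 17/10" | "17/10 \<le> r" "r \<le> 2" | "2 \<le> r" by linarith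
    then show ?thesis
    proof cases
      case 1 then show ?thesis using g r c
        by (intro constant_piece[of g 1 r "6/5" "3/10" 0 1]) (auto simp: power2_eq_square power3_eq_cube)
    next
      case 2 then show ?thesis using g c
        by (intro constant_piece[of g "6/5" r "7/5" "246/1000" "18/100" "913/1000"]) (auto simp: power2_eq_square power3_eq_cube)
    next
      case 3 then show ?thesis using g c
        by (intro constant_piece[of g "7/5" r "17/10" "182/1000" "336/1000" "846/1000"]) (auto simp: power2_eq_square power3_eq_cube)
    next
      case 4 then show ?thesis using g c
        by (intro constant_piece[of g "17/10" r 2 "135/1000" "53/100" "767/1000"]) (auto simp: power2_eq_square power3_eq_cube)
    next
      case 5 then show ?thesis using g True c
        by (intro constant_piece[of g 2 r "23/10" "1/10" "69/100" "708/1000"]) (auto simp: power2_eq_square power3_eq_cube)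
    qed
  qed
  then show ?thesis by (simp add: c_def)
qed

section \<open>The tangent line of the rescaled kernel bound\<close>

text \<open>This makes \<open>W\<close> concave and its slope at \<open>v0\<close> a lower bound for
  the profile on \<open>(0, v0]\<close>. For \<open>g > 1/2\<close> the second summand
  \<open>z powr (g - 1/2)\<close> increases, but the decay of the first one dominates since
  \<open>\<bar>g - 1/2\<bar> sqrt z \<le> 2/3\<close>.\<close>

lemma profile_small_gamma_antimono:
  fixes g v w :: real
  assumes g: "0 < g" "g < 2 / 3" and v: "0 < v" "v \<le> w" "w \<le> 1"
  shows "g * w powr (g - 1) * loss_factor g w \<le> g * v powr (g - 1) * loss_factor g v"
proof -
  let ?F = "\<lambda>z. z powr (g - 1) + 3 / 2 * (1 - g) * z powr (g - 1 / 2)"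
  have eq: "g * z powr (g - 1) * loss_factor g z = g * ?F z" if "0 < z" for z
  proof -
    have "z powr (g - 1) * sqrt z = z powr (g - 1 / 2)"
      using that by (simp add: powr_half_sqrt[symmetric] powr_add[symmetric])
    moreover have "z powr (g - 1) * (1 + 3 / 2 * (1 - g) * sqrt z)
        = z powr (g - 1) + 3 / 2 * (1 - g) * (z powr (g - 1) * sqrt z)" by (simp add: algebra_simps)
    ultimately show ?thesis using g by (simp only: loss_factor_def mult.assoc) simp
  qed
  have "?F w \<le> ?F v"
  proof (rule DERIV_nonpos_imp_nonincreasing[OF v(2)])
    fix z assume z: "v \<le> z" "z \<le> w"
    then have z0: "0 < z" using v by simp
    have "(?F has_real_derivative (g - 1) * z powr (g - 1 - 1) + 3 / 2 * (1 - g) * ((g - 1 / 2) * z powr (g - 1 / 2 - 1))) (at z)"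
      using z0 by (intro DERIV_add DERIV_cmult has_real_derivative_powr)
    moreover have "(g - 1) * z powr (g - 1 - 1) + 3 / 2 * (1 - g) * ((g - 1 / 2) * z powr (g - 1 / 2 - 1))
        = - (1 - g) * z powr (g - 2) * (1 - 3 / 2 * (g - 1 / 2) * sqrt z)"
    proof -
      have "z powr (g - 1 / 2 - 1) = z powr (g - 2) * sqrt z"
        using z0 by (simp add: powr_half_sqrt[symmetric] powr_add[symmetric])
      then show ?thesis by (simp add: field_simps)
    qed
    moreover have "0 \<le> 1 - 3 / 2 * (g - 1 / 2) * sqrt z"
    proof -
      have "(g - 1 / 2) * sqrt z \<le> \<bar>g - 1 / 2\<bar> * sqrt z" using z0 by (intro mult_right_mono) auto
      also have "\<dots> \<le> 2 / 3 * 1" using g z v by (intro mult_mono) (auto simp: abs_if)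
      finally show ?thesis by (simp add: field_simps)
    qed
    ultimately show "\<exists>y. DERIV ?F z :> y \<and> y \<le> 0"
      using g by (intro exI[of _ "- (1 - g) * z powr (g - 2) * (1 - 3 / 2 * (g - 1 / 2) * sqrt z)"])
        (auto intro!: mult_nonpos_nonneg)
  qed
  then show ?thesis using eq v g by simp
qed

text \<open>The value is \<open>W z\<close>. Its coefficient arises from integrating
  \<open>3/2 g (1 - g) v powr (g - 1/2)\<close>, that is, from division by \<open>g + 1/2\<close>.
  As the integrand is singular at 0, only the antiderivative is required to be continuous
  there.\<close>

lemma has_integral_profile_small_gamma:
  fixes g z :: real
  assumes g: "0 < g" "g < 2 / 3" and z: "0 < z"
  shows "((\<lambda>v. g * v powr (g - 1) * loss_factor g v) has_integral
     (z powr g * (1 + 3 * g * (1 - g) / (1 + 2 * g) * sqrt z))) {0..z}"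
proof -
  let ?c = "3 * g * (1 - g) / (1 + 2 * g)"
  let ?W = "\<lambda>v. v powr g + ?c * v powr (g + 1 / 2)"
  have "((\<lambda>v. g * v powr (g - 1) * loss_factor g v) has_integral (?W z - ?W 0)) {0..z}"
  proof (rule fundamental_theorem_of_calculus_interior)
    show "0 \<le> z" using z by simp
    show "continuous_on {0..z} ?W" using g
      by (intro continuous_on_add continuous_on_mult continuous_on_const continuous_on_powr' continuous_on_id) auto
    fix v assume "v \<in> {0<..<z}"
    then have v: "0 < v" by simp
    have "(?W has_real_derivative g * v powr (g - 1) + ?c * ((g + 1 / 2) * v powr (g + 1 / 2 - 1))) (at v)"
      using v by (intro DERIV_add DERIV_cmult has_real_derivative_powr)
    moreover have "g * v powr (g - 1) + ?c * ((g + 1 / 2) * v powr (g + 1 / 2 - 1)) = g * v powr (g - 1) * loss_factor g v"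
    proof -
      have "v powr (g + 1 / 2 - 1) = v powr (g - 1) * sqrt v"
        using v by (simp add: powr_half_sqrt[symmetric] powr_add[symmetric])
      moreover have c2: "?c * (g + 1 / 2) = 3 / 2 * g * (1 - g)" using g by (simp add: field_simps)
      ultimately have "?c * ((g + 1 / 2) * v powr (g + 1 / 2 - 1)) = 3 / 2 * g * (1 - g) * (v powr (g - 1) * sqrt v)"
        by (simp only: mult.assoc[symmetric])
      then show ?thesis using g by (simp add: loss_factor_def) (simp add: algebra_simps)
    qed
    ultimately show "(?W has_vector_derivative g * v powr (g - 1) * loss_factor g v) (at v)"
      by (simp add: has_real_derivative_iff_has_vector_derivative)
  qed
  moreover have "?W z - ?W 0 = z powr g * (1 + ?c * sqrt z)"
    using z g by (simp add: powr_half_sqrt[symmetric] powr_add algebra_simps)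
  ultimately show ?thesis by simp
qed

text \<open>The left-hand side is the intercept of the tangent line of \<open>W\<close> at
  \<open>z\<close>. Since \<open>z powr (- g) \<ge> 1 - g ln z\<close>, it suffices that
  \<open>3/2 t sqrt z \<le> 1 - ln z\<close>. For \<open>z = 1\<close> and \<open>g\<close> near 0
  the intercept does exceed 1, hence the restriction to \<open>z \<le> 36/49\<close> in that
  range.\<close>

lemma profile_intercept_le_1:
  fixes g z :: real
  assumes g: "0 < g" "g < 2 / 3" and z: "0 < z" "z \<le> 1" and d: "z \<le> 36 / 49 \<or> 1 / 3 \<le> g"
  shows "z powr g * (1 - g + 3 * g * (1 - g) / (1 + 2 * g) * (1 / 2 - g) * sqrt z) \<le> 1"
proof -
  define t where "t = (1 - g) * (1 - 2 * g) / (1 + 2 * g)"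
  have s: "0 < sqrt z" "sqrt z \<le> 1" using z by auto
  have key: "3 / 2 * t * sqrt z \<le> 1 - ln z"
  proof (cases "1 / 3 \<le> g")
    case True
    have "t \<le> 2 / 3"
    proof (cases "g \<le> 1 / 2")
      case t: True
      have "(1 - g) * (1 - 2 * g) \<le> (2 / 3) * (1 + 2 * g)" using True t by (intro mult_mono) auto
      then show ?thesis using g by (simp add: t_def field_simps)
    next
      case False
      then have "(1 - g) * (1 - 2 * g) \<le> 0" using g by (intro mult_nonneg_nonpos) auto
      then have "t \<le> 0" using g by (simp add: t_def divide_nonpos_pos)
      then show ?thesis by simp
    qed
    have "t * sqrt z \<le> max 0 t * sqrt z" using s by (intro mult_right_mono) auto
    also have "\<dots> \<le> 2 / 3 * 1" using s \<open>t \<le> 2 / 3\<close> by (intro mult_mono) auto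
    finally have "3 / 2 * t * sqrt z \<le> 1" by simp
    also have "\<dots> \<le> 1 - ln z" using z by simp
    finally show ?thesis .
  next
    case False
    have z': "z \<le> 36 / 49" using False d by simp
    have s': "sqrt z \<le> 6 / 7" using z' by (intro real_le_lsqrt) (auto simp: power2_eq_square)
    have "(1 - g) * (1 - 2 * g) \<le> 1 * (1 + 2 * g)" using g False by (intro mult_mono) auto
    then have "t \<le> 1" using g by (simp add: t_def field_simps)
    moreover have "0 \<le> t" using g False by (auto simp: t_def)
    ultimately have "3 / 2 * t * sqrt z \<le> 3 / 2 * 1 * (6 / 7)" using s s' by (intro mult_mono) auto
    also have "\<dots> \<le> 1 + 2 * (2 / 13)" by simp
    also have "2 / 13 \<le> ln (7 / 6 :: real)" using ln_add_one_lower_bound[of "1 / 6"] by simp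
    also have "1 + 2 * ln (7 / 6) = 1 + ln ((7 / 6)^2 :: real)" by (simp add: ln_realpow)
    also have "\<dots> \<le> 1 + ln (1 / z)" using z z' by (intro add_left_mono ln_mono) (auto simp: field_simps power2_eq_square)
    also have "\<dots> = 1 - ln z" using z by (simp add: ln_div)
    finally show ?thesis by simp
  qed
  have "1 - g + 3 * g * (1 - g) / (1 + 2 * g) * (1 / 2 - g) * sqrt z = 1 - g + g * (3 / 2 * t * sqrt z)"
    using g by (simp add: t_def field_simps)
  also have "\<dots> \<le> 1 - g + g * (1 - ln z)" using key g by (intro add_left_mono mult_left_mono) auto
  also have "\<dots> = 1 + (- g * ln z)" by (simp add: algebra_simps)
  also have "\<dots> \<le> exp (- g * ln z)" by (rule exp_ge_add_one_self)
  also have "\<dots> = z powr (- g)" using z by (simp add: powr_def)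
  finally have "z powr g * (1 - g + 3 * g * (1 - g) / (1 + 2 * g) * (1 / 2 - g) * sqrt z) \<le> z powr g * z powr (- g)"
    by (intro mult_left_mono) auto
  also have "\<dots> = 1" using z by (simp add: powr_add[symmetric])
  finally show ?thesis .
qed

text \<open>A line through \<open>(v, W)\<close> of slope at most 1, followed to the right up to
  \<open>1 / r\<close>, stays below \<open>1 / r + 1 / 2\<close>.\<close>

lemma affine_le_of_tangent:
  fixes W B v r :: real
  assumes "0 < r" "B \<le> 1" "W \<le> v + 1 / 2" "v \<le> 1 / r"
  shows "W - B * v + B / r \<le> 1 / (1 - exp (- r))"
proof -
  have "W - B * v + B / r = W + B * (1 / r - v)" by (simp add: algebra_simps)
  also have "\<dots> \<le> (v + 1 / 2) + 1 * (1 / r - v)" using assms by (intro add_mono mult_right_mono) auto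
  also have "\<dots> \<le> 1 / (1 - exp (- r))" using one_div_one_minus_exp_lower_bound[of r] assms by simp
  finally show ?thesis .
qed

text \<open>The data describe the tangent line of \<open>W\<close> at \<open>v0\<close>: its slope
  is \<open>f v0\<close>, its intercept is \<open>A\<close>, and \<open>A + f v0 * v0\<close> is
  \<open>W v0\<close>.\<close>

lemma profile_exists:
  fixes g r :: real
  assumes g: "0 < g" "g < 1" and r: "0 < r"
  defines "f \<equiv> (\<lambda>v. g * v powr (g - 1) * loss_factor g v)"
  shows "\<exists>v0 A. 0 < v0 \<and> v0 \<le> 1 \<and> (v0 \<le> 36 / 49 \<or> 1 / 3 \<le> g) \<and> (\<forall>v. 0 < v \<and> v \<le> v0 \<longrightarrow> f v0 \<le> f v) \<and>
     (f has_integral (A + f v0 * v0)) {0..v0} \<and> A \<le> 1 \<and> A + f v0 / r \<le> 1 / (1 - exp (- r))"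
proof (cases "2 / 3 \<le> g")
  case True
  let ?A = "(1 - g) * exp (1 - g)"
  have f: "f = (\<lambda>v. exp (1 - g) * (g * v powr (g - 1)))" using True by (auto simp: f_def loss_factor_def)
  have "((\<lambda>v. g * v powr (g - 1)) has_integral (1 powr g - 0 powr g)) {0..1}"
  proof (rule fundamental_theorem_of_calculus_interior)
    show "continuous_on {0..1} (\<lambda>v. v powr g)" using g
      by (intro continuous_on_powr' continuous_on_const continuous_on_id) auto
    fix v :: real assume "v \<in> {0<..<1}"
    then show "((\<lambda>v. v powr g) has_vector_derivative g * v powr (g - 1)) (at v)"
      by (simp add: has_real_derivative_iff_has_vector_derivative[symmetric] has_real_derivative_powr)
  qed simp
  from has_integral_mult_right[OF this, of "exp (1 - g)"]
  have I: "(f has_integral (?A + f 1 * 1)) {0..1}" using g by (simp add: f algebra_simps)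
  have "\<forall>v. 0 < v \<and> v \<le> 1 \<longrightarrow> f 1 \<le> f v"
  proof safe
    fix v :: real assume "0 < v" "v \<le> 1"
    then have "1 \<le> v powr (g - 1)" using g powr_mono2'[of "1 - g" v 1] powr_mono2'[of "g - 1" v 1] by simp
    then show "f 1 \<le> f v" using g by (simp add: f)
  qed
  then show ?thesis using I profile_large_gamma[OF True g(2) r] g True
    by (intro exI[of _ 1] exI[of _ ?A]) (auto simp: f algebra_simps)
next
  case False
  define c where "c = 3 * g * (1 - g) / (1 + 2 * g)"
  define W where "W = (\<lambda>z. z powr g * (1 + c * sqrt z))"
  have c: "0 \<le> c" "c \<le> 403 / 1000" using g profile_coefficient_le[of g] by (auto simp: c_def)
  have A1: "W z - f z * z \<le> 1" if "0 < z" "z \<le> 1" "z \<le> 36 / 49 \<or> 1 / 3 \<le> g" for z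
  proof -
    have "z powr (g - 1) * z = z powr g" using that by (simp add: powr_diff)
    then have "f z * z = g * z powr g * (1 + 3 / 2 * (1 - g) * sqrt z)"
      using False by (simp add: f_def loss_factor_def mult.assoc mult.left_commute[of _ z] mult.commute[of _ z])
    then have "W z - f z * z = z powr g * (1 - g + c * (1 / 2 - g) * sqrt z)"
    proof -
      have "c * (1 + 2 * g) = 3 * g * (1 - g)" using g by (simp add: c_def)
      then have "3 / 2 * g * (1 - g) = c / 2 + c * g" by (simp add: algebra_simps)
      moreover have "g * z powr g * (1 + 3 / 2 * (1 - g) * sqrt z) = z powr g * (g + 3 / 2 * g * (1 - g) * sqrt z)"
        by (simp add: algebra_simps)
      ultimately have "g * z powr g * (1 + 3 / 2 * (1 - g) * sqrt z) = z powr g * (g + (c / 2 + c * g) * sqrt z)"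
        by (simp only:)
      then have "f z * z = z powr g * (g + (c / 2 + c * g) * sqrt z)" using \<open>f z * z = _\<close> by (simp only:)
      then show ?thesis by (simp only: W_def) (simp add: algebra_simps)
    qed
    then show ?thesis using profile_intercept_le_1[of g z] that g False by (simp add: c_def)
  qed
  have ex: ?thesis if v: "0 < v" "v \<le> 1" "v \<le> 36 / 49 \<or> 1 / 3 \<le> g"
      and le: "W v - f v * v + f v / r \<le> 1 / (1 - exp (- r))" for v
  proof (intro exI conjI)
    show "\<forall>w. 0 < w \<and> w \<le> v \<longrightarrow> f v \<le> f w"
      using profile_small_gamma_antimono[of g _ v] v g False by (auto simp: f_def)
    show "(f has_integral W v - f v * v + f v * v) {0..v}"
      using has_integral_profile_small_gamma[of g v] v g False by (simp add: f_def W_def c_def)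
  qed (use v A1 le in auto)
  show ?thesis
  \<comment> \<open>The question is whether \<open>1 / r\<close> is an admissible touching point;
    the limit is 1 for \<open>g \<ge> 1/3\<close> and \<open>36/49\<close> otherwise.\<close>
  proof (cases "if 1 / 3 \<le> g then 1 \<le> r else 49 / 36 \<le> r")
    case r1: True
    then have r': "1 \<le> r" by (auto split: if_splits)
    have "(1 - exp (- r)) * (1 + c / sqrt r) \<le> 1 + g * ln r"
      using jensen_medium_gamma[of g r] jensen_small_gamma[of g r] r1 g by (auto simp: c_def split: if_splits)
    also have "\<dots> \<le> exp (g * ln r)" by (rule exp_ge_add_one_self)
    also have "\<dots> = r powr g" using r by (simp add: powr_def)
    finally have le: "(1 - exp (- r)) * (1 + c / sqrt r) \<le> r powr g" .
    have "W (1 / r) = (1 + c / sqrt r) / r powr g"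
      using r by (simp add: W_def powr_divide real_sqrt_divide)
    also have "\<dots> \<le> 1 / (1 - exp (- r))" using le r by (simp add: field_simps)
    finally have "W (1 / r) - f (1 / r) * (1 / r) + f (1 / r) / r \<le> 1 / (1 - exp (- r))" by simp
    then show ?thesis
      using r1 r' by (intro ex[of "1 / r"]) (auto simp: field_simps split: if_splits)
  next
    case r1: False
    define v where "v = (if 1 / 3 \<le> g then 1 else 36 / 49 :: real)"
    have v: "0 < v" "v \<le> 1" "v \<le> 36 / 49 \<or> 1 / 3 \<le> g" "v \<le> 1 / r"
      using r1 r by (auto simp: v_def field_simps split: if_splits)
    have "f v \<le> 1 \<and> W v \<le> v + 1 / 2"
    proof (cases "1 / 3 \<le> g")
      case True
      \<comment> \<open>The slope at 1 differs from 1 by \<open>3/2 (2/3 - g) (1 - g)\<close>, so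
        the threshold \<open>2/3\<close> is also the right one from below.\<close>
      have "f v = g * (5 / 2 - 3 / 2 * g)" using True False by (simp add: v_def f_def loss_factor_def field_simps)
      also have "\<dots> \<le> 1"
      proof -
        have "0 \<le> (2 / 3 - g) * (1 - g)" using g False by simp
        then show ?thesis by (simp add: field_simps)
      qed
      finally show ?thesis using c True by (simp add: v_def W_def)
    next
      case gs: False
      have sv: "sqrt v = 6 / 7" using gs by (simp add: v_def real_sqrt_divide real_sqrt_unique[of 6 36] real_sqrt_unique[of 7 49])
      have vg: "v powr g \<le> 1 / (1 + 4 / 13 * g)"
      proof -
        have "2 / 13 \<le> ln (7 / 6 :: real)" using ln_add_one_lower_bound[of "1 / 6"] by simp
        then have "4 / 13 \<le> ln ((7 / 6)^2 :: real)" by (simp add: ln_realpow)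
        then have "1 + 4 / 13 * g \<le> 1 + g * ln (49 / 36)" using g by (simp add: power2_eq_square)
        also have "\<dots> \<le> exp (g * ln (49 / 36))" by (rule exp_ge_add_one_self)
        also have "\<dots> = (49 / 36) powr g" by (simp add: powr_def)
        also have "\<dots> = 1 / v powr g" using gs by (simp add: v_def powr_divide)
        finally show ?thesis using g v by (simp add: field_simps)
      qed
      have "W v \<le> 1 / (1 + 4 / 13 * g) * (1 + c * (6 / 7))"
        unfolding W_def sv using vg c by (intro mult_right_mono) auto
      also have "\<dots> \<le> v + 1 / 2"
      proof -
        \<comment> \<open>\<open>26/100\<close> is close to the minimum of the quadratic to be shown
          nonnegative.\<close>
        have "0 \<le> (g - 26 / 100)\<^sup>2" by simp
        then have "(1 + 2 * g) + 3 * g * (1 - g) * (6 / 7) \<le> (121 / 98) * (1 + 4 / 13 * g) * (1 + 2 * g)"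
          using g by (simp add: power2_eq_square field_simps)
        then have "1 + c * (6 / 7) \<le> (121 / 98) * (1 + 4 / 13 * g)"
          using g by (simp add: c_def field_simps)
        then show ?thesis using g gs by (simp add: v_def field_simps)
      qed
      finally have Wv: "W v \<le> v + 1 / 2" .
      have "v powr (g - 1) = v powr g / v" using v by (simp add: powr_diff)
      also have "\<dots> \<le> 1 / v" using v g by (intro divide_right_mono powr_le1) auto
      finally have "v powr (g - 1) \<le> 49 / 36" using gs by (simp add: v_def)
      moreover have "loss_factor g v = 1 + 3 / 2 * (1 - g) * (6 / 7)" using False by (simp add: loss_factor_def sv)
      ultimately have "f v \<le> g * (49 / 36) * (1 + 3 / 2 * (1 - g) * (6 / 7))"
        unfolding f_def using g by (intro mult_mono mult_left_mono) auto
      also have "\<dots> \<le> 1"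
      proof -
        have "0 \<le> (1 / 3 - g) * (13 - 9 * g)" using g gs by (intro mult_nonneg_nonneg) auto
        then show ?thesis by (simp add: field_simps)
      qed
      finally show ?thesis using Wv by simp
    qed
    then show ?thesis using v r by (intro ex[of v] affine_le_of_tangent) auto
  qed
qed

section \<open>The loss factor in the kernel bound\<close>

text \<open>The algebraic core of the next estimate, with \<open>s = sqrt v\<close>. After clearing
  denominators the difference \<open>F\<close> of the two sides is a convex quadratic in
  \<open>d\<close>, so only the endpoints \<open>1/3\<close>, \<open>2/3\<close> and
  \<open>1\<close> have to be checked. At \<open>d = s = 1\<close> the inequality is false, which is
  why the two must not both be large.\<close>

lemma kernel_ratio_polynomial:
  fixes d s :: real
  assumes s: "0 < s" "s \<le> 1" and d: "1 / 3 \<le> d" "d \<le> 1" "s \<le> 6 / 7 \<or> d \<le> 2 / 3"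
  defines "P \<equiv> 70 + 49 * s - 35 * s\<^sup>2" and "Q \<equiv> (5 + 7 * s - 5 * s\<^sup>2) * (5 + 28 * s)"
  shows "d * (99 - 35 * s) / P + 25 * s / Q \<le> 6 * d / (4 + 3 * d * s)"
proof -
  have s2: "s\<^sup>2 \<le> s" using s by (simp add: power2_eq_square)
  have P: "0 < P" using s s2 by (simp add: P_def)
  have Q: "0 < Q" using s s2 by (simp add: Q_def)
  define F where "F = (\<lambda>d. d * (99 - 35 * s) * (4 + 3 * d * s) * Q + 25 * s * (4 + 3 * d * s) * P - 6 * d * P * Q)"
  have conv: "F d \<le> 0" if "a \<le> d" "d \<le> b" "F a \<le> 0" "F b \<le> 0" for a b d
  proof (cases "a = b")
    case True then show ?thesis using that by simp
  next
    case False
    then have ab: "a < b" using that by simp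
    have "(b - a) * F d = (b - d) * F a + (d - a) * F b - (b - a) * (b - d) * (d - a) * (3 * s * (99 - 35 * s) * Q)"
      by (simp add: F_def algebra_simps power2_eq_square)
    moreover have "(b - d) * F a \<le> 0" "(d - a) * F b \<le> 0" using that by (auto intro!: mult_nonneg_nonpos)
    moreover have "0 \<le> (b - a) * (b - d) * (d - a) * (3 * s * (99 - 35 * s) * Q)"
      using that s Q by (intro mult_nonneg_nonneg) auto
    ultimately have "(b - a) * F d \<le> 0" by linarith
    then show ?thesis using ab by (simp add: mult_le_0_iff)
  qed
  have F13: "F (1 / 3) \<le> 0"
  proof -
    have eq: "-3 * F (1 / 3) = 600 - 8425 * s + 38404 * s\<^sup>2 + s\<^sup>2 * (s * (30125 - 74200 * s + 24500 * s\<^sup>2))"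
      by (simp add: F_def P_def Q_def algebra_simps power2_eq_square)
    have "0 \<le> 600 - 8425 * s + 38404 * s\<^sup>2 + s\<^sup>2 * (s * (30125 - 74200 * s + 24500 * s\<^sup>2))"
    proof (cases "s \<le> 2 / 5")
      case True
      have "0 \<le> (8425 / 2 - 38404 * s)\<^sup>2" by simp
      then have "0 \<le> 600 - 8425 * s + 38404 * s\<^sup>2" by (simp add: power2_eq_square algebra_simps)
      moreover have "0 \<le> s\<^sup>2 * (s * (30125 - 74200 * s + 24500 * s\<^sup>2))" using True s by (intro mult_nonneg_nonneg) auto
      ultimately show ?thesis by simp
    next
      case False
      have "0 \<le> s * (s - 1)\<^sup>2" using s by simp
      then have a: "s * (30125 - 74200 * s + 24500 * s\<^sup>2) \<ge> 5625 * s - 25200 * s\<^sup>2"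
        by (simp add: power2_eq_square algebra_simps)
      also have "5625 * s - 25200 * s\<^sup>2 \<ge> - 19575" using s s2 by linarith
      finally have "s\<^sup>2 * (s * (30125 - 74200 * s + 24500 * s\<^sup>2)) \<ge> s\<^sup>2 * (- 19575)"
        by (intro mult_left_mono) auto
      moreover have "0 \<le> 600 - 8425 * s + 18829 * s\<^sup>2"
      proof -
        have "0 \<le> (s - 2 / 5) * (18829 * s - 893)" using False by (intro mult_nonneg_nonneg) auto
        then show ?thesis using s by (simp add: power2_eq_square algebra_simps)
      qed
      ultimately show ?thesis by linarith
    qed
    then show ?thesis using eq by linarith
  qed
  have "F d \<le> 0"
  proof (cases "d \<le> 2 / 3")
    case True
    have eq: "-3 * F (2 / 3) = 1200 - 800 * s + 58608 * s\<^sup>2 + s\<^sup>2 * (s * (28142 - 108710 * s + 39200 * s\<^sup>2))"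
      by (simp add: F_def P_def Q_def algebra_simps power2_eq_square)
    have "0 \<le> s * (s - 1)\<^sup>2" using s by simp
    then have "s * (28142 - 108710 * s + 39200 * s\<^sup>2) \<ge> - 11058 * s - 30310 * s\<^sup>2"
      by (simp add: power2_eq_square algebra_simps)
    also have "- 11058 * s - 30310 * s\<^sup>2 \<ge> - 41368" using s s2 by simp
    finally have "s\<^sup>2 * (s * (28142 - 108710 * s + 39200 * s\<^sup>2)) \<ge> s\<^sup>2 * (- 41368)"
      by (intro mult_left_mono) auto
    moreover have "0 \<le> s\<^sup>2" by simp
    ultimately have "0 \<le> -3 * F (2 / 3)" unfolding eq using s by linarith
    then show ?thesis using conv[of "1 / 3" d "2 / 3"] F13 True d by simp
  next
    case False
    then have s': "s \<le> 6 / 7" using d by simp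
    have eq: "- F 1 = 600 + 625 * s + s\<^sup>2 * (15304 + 1517 * s - 34510 * s\<^sup>2 + 14700 * s ^ 3)"
      by (simp add: F_def P_def Q_def algebra_simps power2_eq_square power3_eq_cube)
    have "s\<^sup>2 * (- 1000) \<le> s\<^sup>2 * (15304 + 1517 * s - 34510 * s\<^sup>2 + 14700 * s ^ 3)"
    proof (rule mult_left_mono)
      have "0 \<le> s * (s - 6 / 7)\<^sup>2" using s by simp
      then have "14700 * s ^ 3 \<ge> 25200 * s\<^sup>2 - 10800 * s" by (simp add: power2_eq_square power3_eq_cube algebra_simps)
      moreover have "s\<^sup>2 \<le> 6 / 7 * s" using s s' by (simp add: power2_eq_square)
      ultimately show "- 1000 \<le> 15304 + 1517 * s - 34510 * s\<^sup>2 + 14700 * s ^ 3" using s' s by linarith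
    qed simp
    then have "0 \<le> - F 1" using eq s s2 by linarith
    then show ?thesis using conv[of "1 / 3" d 1] F13 d by simp
  qed
  moreover have "0 < 4 + 3 * d * s" using s d by (simp add: add_pos_nonneg)
  ultimately show ?thesis using P Q unfolding F_def by (simp add: field_simps)
qed

text \<open>The left-hand side is the logarithm of the interpolated kernel norm divided by its small-time value. The best
  interpolation parameter is close to \<open>h = sqrt (2 v)\<close> for large \<open>p\<close>; \<open>7/5\<close> is a rational number slightly below \<open>sqrt 2\<close>.\<close>
lemma kernel_ratio_bound:
  fixes p d v :: real
  assumes p: "1 < p" and v: "0 < v" "v \<le> 1" and d: "1 / 3 \<le> d" "d \<le> 1" "v \<le> 36 / 49 \<or> d \<le> 2 / 3"
  defines "q \<equiv> p / (p - 1)" and "h \<equiv> 7 / 5 * sqrt v"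
  defines "a \<equiv> q * (1 + h) - 1"
  shows "d * ((p - 1) * ln q - (ln q + ln (1 + h - v)) / a) + ln ((1 + h) / (1 + h - v)) / (p * a) \<le> ln (1 + 3 / 2 * d * sqrt v)"
proof -
  define s where "s = sqrt v"
  have s: "0 < s" "s \<le> 1" "s\<^sup>2 = v" "h = 7 / 5 * s" using v by (auto simp: s_def h_def)
  have s67: "s \<le> 6 / 7 \<or> d \<le> 2 / 3" 
    using d(3) real_sqrt_le_mono[of v "(6 / 7)\<^sup>2"] unfolding s_def real_sqrt_abs by (auto simp: power2_eq_square)
  define x where "x = q - 1"
  have x: "0 < x" "(p - 1) * x = 1" "p * x = 1 + x" "q = 1 + x" using p by (auto simp: x_def q_def field_simps)
  define y where "y = h - v"
  have h: "0 < h" using s by simp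
  have vs: "v \<le> s" using s by (simp add: power2_eq_square[symmetric] s(3)[symmetric]) (simp add: power2_eq_square)
  have y: "0 < y" using vs s by (auto simp: y_def)
  have hv: "1 + h - v = 1 + y" by (simp add: y_def)
  have a: "a = x + (1 + x) * h" by (simp add: a_def x algebra_simps)
  have a0: "0 < a" using x h by (simp add: a add_pos_pos)
  define R where "R = 1 - 2 * y / ((2 + y) * h)"
  have l: "2 * y / (2 + y) \<le> ln (1 + h - v)" unfolding hv using y by (intro ln_add_one_lower_bound) simp
  \<comment> \<open>\<open>ln q \<le> x\<close> turns the left-hand side into a rational function of
    \<open>x\<close>, and \<open>R\<close> is its value at \<open>x = 0\<close>, that is, for
    \<open>p \<rightarrow> \<infinity>\<close>. That this is the worst case amounts to
    \<open>h \<le> R (1 + h)\<close>; here \<open>h * h \<le> 2 v\<close> enters, hence a constant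
    below \<open>sqrt 2\<close>.\<close>
  have R1: "(p - 1) * ln q - (ln q + ln (1 + h - v)) / a \<le> R"
  proof -
    have "ln q \<le> x" using x ln_add_one_self_le_self2[of x] by simp
    have pm: "p - 1 = 1 / x" using x by (simp add: field_simps)
    have "(p - 1) * ln q - (ln q + ln (1 + h - v)) / a = ln q * ((a - x) / (a * x)) - ln (1 + h - v) / a"
      using a0 x by (simp add: pm field_simps)
    also have "\<dots> \<le> x * ((a - x) / (a * x)) - (2 * y / (2 + y)) / a"
      using \<open>ln q \<le> x\<close> l a0 x h by (intro diff_mono mult_right_mono divide_right_mono) (auto simp: a)
    also have "x * ((a - x) / (a * x)) = (a - x) / a" using x a0 by simp
    also have "a - x = (1 + x) * h" by (simp add: a)
    also have "(1 + x) * h / a - 2 * y / (2 + y) / a = ((1 + x) * h - 2 * y / (2 + y)) / a"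
      by (simp only: diff_divide_distrib)
    also have "\<dots> \<le> R"
    proof -
      have "h * h = 49 / 25 * v" by (simp add: s(4) s(3)[symmetric] power2_eq_square)
      moreover have "0 \<le> v * h" using v h by simp
      ultimately have "y * h \<le> 2 * v" using v by (simp add: y_def left_diff_distrib)
      then have "2 * y * (1 + h) \<le> (2 + y) * h" using hv by (simp add: algebra_simps)
      then have "2 * y * (1 + h) / ((2 + y) * h) \<le> 1" using y h by (subst divide_le_eq_1_pos) auto
      moreover have "R * (1 + h) = (1 + h) - 2 * y * (1 + h) / ((2 + y) * h)" by (simp add: R_def left_diff_distrib)
      ultimately have "h \<le> R * (1 + h)" by simp
      then have "x * h \<le> x * (R * (1 + h))" using x by simp
      moreover have "R * h = h - 2 * y / (2 + y)" using h by (simp add: R_def left_diff_distrib)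
      moreover have "R * a = x * (R * (1 + h)) + R * h" "(1 + x) * h = x * h + h" by (auto simp: a algebra_simps)
      ultimately have "(1 + x) * h - 2 * y / (2 + y) \<le> R * a" by linarith
      then show ?thesis using a0 by (simp add: divide_le_eq)
    qed
    finally show ?thesis .
  qed
  \<comment> \<open>Uniform in \<open>p\<close> by \<open>x + 1 / x \<ge> 2\<close>.\<close>
  have pa: "1 + 4 * h \<le> p * a"
  proof -
    have "p * a = (1 + x) * (1 + (1 + x) * h / x)" using x by (simp add: a field_simps)
    also have "\<dots> = 1 + 2 * h + x + x * h + h / x" using x by (simp add: field_simps power2_eq_square)
    also have "\<dots> \<ge> 1 + 4 * h"
    proof -
      have "0 \<le> h * (x - 1)\<^sup>2 / x" using h x by simp
      then have "2 * h \<le> x * h + h / x" using x by (simp add: field_simps power2_eq_square)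
      then show ?thesis using x by simp
    qed
    finally show ?thesis .
  qed
  have l2: "ln ((1 + h) / (1 + h - v)) / (p * a) \<le> v / ((1 + y) * (1 + 4 * h))"
  proof -
    have "(1 + h) / (1 + h - v) = 1 + v / (1 + y)" unfolding hv using y by (simp add: y_def field_simps)
    then have "ln ((1 + h) / (1 + h - v)) \<le> v / (1 + y)" using ln_add_one_self_le_self[of "v / (1 + y)"] v y by simp
    then have "ln ((1 + h) / (1 + h - v)) / (p * a) \<le> v / (1 + y) / (p * a)"
      using p a0 by (intro divide_right_mono) auto
    also have "\<dots> \<le> v / (1 + y) / (1 + 4 * h)"
      using v y h pa p a0 by (intro divide_left_mono mult_pos_pos) auto
    finally show ?thesis by simp
  qed
  have R2: "R = s * ((99 - 35 * s) / (70 + 49 * s - 35 * s\<^sup>2))"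
  proof -
    have e1: "70 + 49 * s - 35 * s\<^sup>2 = 35 * (2 + y)" by (simp add: y_def s(4) s(3))
    have e2: "(2 + y) * h - 2 * y = h * (s * (99 - 35 * s) / 35)"
      by (simp add: y_def s(4) s(3)[symmetric] power2_eq_square algebra_simps)
    have e3: "R = ((2 + y) * h - 2 * y) / ((2 + y) * h)" using y h by (simp add: R_def diff_divide_distrib)
    show ?thesis unfolding e3 e2 e1 using h y by simp
  qed
  have L2: "v / ((1 + y) * (1 + 4 * h)) = s * (25 * s / ((5 + 7 * s - 5 * s\<^sup>2) * (5 + 28 * s)))"
  proof -
    have e: "5 + 7 * s - 5 * s\<^sup>2 = 5 * (1 + y)" "5 + 28 * s = 5 * (1 + 4 * h)" by (auto simp: y_def s(4) s(3))
    have "v / (Y * H) = s * (25 * s / (5 * Y * (5 * H)))" for Y H :: real by (simp add: s(3)[symmetric] power2_eq_square)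
    then show ?thesis unfolding e .
  qed
  have "d * ((p - 1) * ln q - (ln q + ln (1 + h - v)) / a) + ln ((1 + h) / (1 + h - v)) / (p * a)
      \<le> d * R + v / ((1 + y) * (1 + 4 * h))"
    using R1 l2 d by (intro add_mono mult_left_mono) auto
  also have "\<dots> = s * (d * (99 - 35 * s) / (70 + 49 * s - 35 * s\<^sup>2) + 25 * s / ((5 + 7 * s - 5 * s\<^sup>2) * (5 + 28 * s)))"
  proof -
    have "d * (s * (b / c)) + s * e = s * (d * b / c + e)" for b c e :: real by (simp add: algebra_simps)
    then show ?thesis unfolding R2 L2 .
  qed
  also have "\<dots> \<le> s * (6 * d / (4 + 3 * d * s))"
    using kernel_ratio_polynomial[OF s(1,2) d(1,2) s67] s by (intro mult_left_mono) auto
  \<comment> \<open>The right-hand side of the polynomial inequality has this form so that the lower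
    bound for \<open>ln (1 + X)\<close> applies with \<open>X = 3/2 d s\<close>.\<close>
  also have "\<dots> = 2 * (3 / 2 * d * s) / (2 + 3 / 2 * d * s)"
    using s d by (simp add: divide_simps)
  also have "\<dots> \<le> ln (1 + 3 / 2 * d * s)" using s d by (intro ln_add_one_lower_bound) auto
  finally show ?thesis by (simp add: s_def)
qed

section \<open>Lebesgue norms of a Gaussian-bounded kernel\<close>

text \<open>The form with geometric means serves both for pairing the kernel with \<open>V\<close>
  and for interpolating between two integrals of the kernel. Young's inequality is applied pointwise
  to \<open>F / A\<close> and \<open>G / B\<close>, so vanishing bounds are treated first.\<close>

lemma nn_integral_Holder:
  fixes F G :: "'a \<Rightarrow> real"
  assumes [measurable]: "F \<in> borel_measurable M" "G \<in> borel_measurable M"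
    and nn: "\<And>x. 0 \<le> F x" "\<And>x. 0 \<le> G x" and e: "0 < \<alpha>" "0 < \<beta>" "\<alpha> + \<beta> = 1"
    and AB: "0 \<le> A" "0 \<le> B" "(\<integral>\<^sup>+x. F x \<partial>M) \<le> ennreal A" "(\<integral>\<^sup>+x. G x \<partial>M) \<le> ennreal B"
  shows "(\<integral>\<^sup>+x. F x powr \<alpha> * G x powr \<beta> \<partial>M) \<le> ennreal (A powr \<alpha> * B powr \<beta>)"
proof (cases "A = 0 \<or> B = 0")
  case True
  have "AE x in M. F x powr \<alpha> * G x powr \<beta> = 0"
    using True
  proof
    assume "A = 0"
    then have "(\<integral>\<^sup>+x. F x \<partial>M) = 0" using AB by simp
    then have "AE x in M. ennreal (F x) = 0" by (subst (asm) nn_integral_0_iff_AE) auto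
    then show ?thesis by eventually_elim (use nn in \<open>auto simp: ennreal_eq_0_iff order.antisym\<close>)
  next
    assume "B = 0"
    then have "(\<integral>\<^sup>+x. G x \<partial>M) = 0" using AB by simp
    then have "AE x in M. ennreal (G x) = 0" by (subst (asm) nn_integral_0_iff_AE) auto
    then show ?thesis by eventually_elim (use nn in \<open>auto simp: ennreal_eq_0_iff order.antisym\<close>)
  qed
  then have "(\<integral>\<^sup>+x. F x powr \<alpha> * G x powr \<beta> \<partial>M) = (\<integral>\<^sup>+x. 0 \<partial>M)"
    by (intro nn_integral_cong_AE) (auto elim!: eventually_mono)
  then show ?thesis by simp
next
  case False
  then have A: "0 < A" and B: "0 < B" using AB by auto
  define C where "C = A powr \<alpha> * B powr \<beta>"
  have C: "0 \<le> C" by (simp add: C_def)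
  have le: "F x powr \<alpha> * G x powr \<beta> \<le> C * \<alpha> / A * F x + C * \<beta> / B * G x" for x
  proof (cases "F x = 0 \<or> G x = 0")
    case True
    then show ?thesis using nn[of x] A B e C by (auto intro!: mult_nonneg_nonneg add_nonneg_nonneg)
  next
    case False
    then have "0 < F x" "0 < G x" using nn[of x] by auto
    then have "(F x / A) powr \<alpha> * (G x / B) powr \<beta> \<le> \<alpha> * (F x / A) + \<beta> * (G x / B)"
      using A B e by (intro Youngs_inequality_0) auto
    then have "C * ((F x / A) powr \<alpha> * (G x / B) powr \<beta>) \<le> C * (\<alpha> * (F x / A) + \<beta> * (G x / B))"
      using C by (intro mult_left_mono) auto
    moreover have "C * ((F x / A) powr \<alpha> * (G x / B) powr \<beta>) = F x powr \<alpha> * G x powr \<beta>"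
      using A B nn[of x] by (simp add: C_def powr_divide)
    ultimately show ?thesis by (simp add: distrib_left)
  qed
  then have "(\<integral>\<^sup>+x. F x powr \<alpha> * G x powr \<beta> \<partial>M)
      \<le> (\<integral>\<^sup>+x. ennreal (C * \<alpha> / A) * ennreal (F x) + ennreal (C * \<beta> / B) * ennreal (G x) \<partial>M)"
    using C A B e nn
    by (intro nn_integral_mono) (auto simp: ennreal_mult'[symmetric] ennreal_plus[symmetric] simp del: ennreal_plus intro!: ennreal_leI)
  also have "\<dots> = ennreal (C * \<alpha> / A) * (\<integral>\<^sup>+x. F x \<partial>M) + ennreal (C * \<beta> / B) * (\<integral>\<^sup>+x. G x \<partial>M)"
    by (simp add: nn_integral_add nn_integral_cmult)
  also have "\<dots> \<le> ennreal (C * \<alpha> / A) * ennreal A + ennreal (C * \<beta> / B) * ennreal B"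
    using AB by (intro add_mono mult_left_mono) auto
  also have "\<dots> = ennreal (C * \<alpha> + C * \<beta>)"
    using A B C e by (simp add: ennreal_mult'[symmetric] ennreal_plus[symmetric] del: ennreal_plus)
  also have "C * \<alpha> + C * \<beta> = C" using e by (simp add: distrib_left[symmetric])
  finally show ?thesis by (simp add: C_def)
qed

lemma nn_integral_powr_times_exp:
  fixes b z :: real assumes b: "0 < b" and z: "-1 < z"
  shows "(\<integral>\<^sup>+t. ennreal (indicator {0..} t * (t powr z * exp (- b * t))) \<partial>lborel) = ennreal (Gamma (z + 1) / b powr (z + 1))"
proof -
  have "ennreal (Gamma (z + 1)) = (\<integral>\<^sup>+t. ennreal (indicator {0..} t * t powr z / exp t) \<partial>lborel)"
    using Gamma_conv_nn_integral_real[of "z + 1"] z by simp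
  also have "\<dots> = b * (\<integral>\<^sup>+t. ennreal (indicator {0..} (0 + b * t) * (0 + b * t) powr z / exp (0 + b * t)) \<partial>lborel)"
    using b by (subst nn_integral_real_affine[of _ b 0]) auto
  also have "(\<integral>\<^sup>+t. ennreal (indicator {0..} (0 + b * t) * (0 + b * t) powr z / exp (0 + b * t)) \<partial>lborel)
     = (\<integral>\<^sup>+t. ennreal (b powr z) * ennreal (indicator {0..} t * (t powr z * exp (- b * t))) \<partial>lborel)"
    using b by (intro nn_integral_cong)
      (auto simp: indicator_def powr_mult exp_minus divide_inverse ennreal_mult'[symmetric] zero_le_mult_iff)
  also have "\<dots> = ennreal (b powr z) * (\<integral>\<^sup>+t. ennreal (indicator {0..} t * (t powr z * exp (- b * t))) \<partial>lborel)"
    by (intro nn_integral_cmult) auto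
  finally have eq: "ennreal (Gamma (z + 1)) = ennreal (b powr (z + 1)) * (\<integral>\<^sup>+t. ennreal (indicator {0..} t * (t powr z * exp (- b * t))) \<partial>lborel)"
    using b by (simp add: mult.assoc[symmetric] ennreal_mult'[symmetric] powr_mult_base add.commute)
  have "ennreal (1 / b powr (z + 1)) * ennreal (Gamma (z + 1)) = (\<integral>\<^sup>+t. ennreal (indicator {0..} t * (t powr z * exp (- b * t))) \<partial>lborel)"
    unfolding eq using b by (simp add: mult.assoc[symmetric] ennreal_mult'[symmetric])
  then show ?thesis using b z by (simp add: ennreal_mult'[symmetric])
qed

text \<open>Layer-cake formula: with \<open>X = (dist x y)\<^sup>2 / u\<close>, the function
  \<open>exp (- b X)\<close> is the integral of \<open>b exp (- b t)\<close> over
  \<open>t > X\<close>, and the set \<open>X < t\<close> is the ball of radius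
  \<open>sqrt (u t)\<close>. The volume growth costs \<open>c2 u\<close> in the rate and leaves a
  Gamma integral.\<close>

lemma gaussian_integral_le:
  fixes m :: "'a::polish_space measure" and x :: 'a
  assumes sets[measurable_cong]: "sets m = sets borel" and sf: "sigma_finite_measure m"
    and c1: "0 < c1" and n: "0 < n" and u: "0 < u" and b: "0 < b" "c2 * u < b"
    and ball: "\<And>r. 0 < r \<Longrightarrow> emeasure m (ball x r) \<le> ennreal (c1 * r powr n * exp (c2 * r\<^sup>2))"
  shows "(\<integral>\<^sup>+y. ennreal (exp (- b * ((dist x y)\<^sup>2 / u))) \<partial>m)
      \<le> ennreal (c1 * u powr (n / 2) * (b * Gamma (n / 2 + 1) / (b - c2 * u) powr (n / 2 + 1)))"
proof -
  interpret sigma_finite_measure m by fact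
  interpret pair_sigma_finite m lborel ..
  let ?X = "\<lambda>y. (dist x y)\<^sup>2 / u"
  have exp_eq: "ennreal (exp (- b * ?X y)) = (\<integral>\<^sup>+t. ennreal (b * exp (- b * t)) * (if ?X y < t then 1 else 0) \<partial>lborel)" for y
  proof -
    have "(\<integral>\<^sup>+t. ennreal (b * exp (- b * t)) * indicator {?X y..} t \<partial>lborel) = ennreal (0 - (- exp (- b * ?X y)))"
    proof (rule nn_integral_FTC_atLeast)
      show "((\<lambda>t. - exp (- b * t)) \<longlongrightarrow> 0) at_top" using b by real_asymp
    qed (use b in \<open>auto intro!: derivative_eq_intros\<close>)
    moreover have "(\<integral>\<^sup>+t. ennreal (b * exp (- b * t)) * (if ?X y < t then 1 else 0) \<partial>lborel)
        = (\<integral>\<^sup>+t. ennreal (b * exp (- b * t)) * indicator {?X y..} t \<partial>lborel)"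
      by (intro nn_integral_cong_AE) (use AE_lborel_singleton[of "?X y"] in eventually_elim, auto simp: indicator_def)
    ultimately show ?thesis by simp
  qed
  have "(\<integral>\<^sup>+y. ennreal (exp (- b * ?X y)) \<partial>m) = (\<integral>\<^sup>+y. \<integral>\<^sup>+t. ennreal (b * exp (- b * t)) * (if ?X y < t then 1 else 0) \<partial>lborel \<partial>m)"
    by (simp only: exp_eq)
  also have "\<dots> = (\<integral>\<^sup>+t. \<integral>\<^sup>+y. ennreal (b * exp (- b * t)) * (if ?X y < t then 1 else 0) \<partial>m \<partial>lborel)"
    by (intro Fubini'[symmetric]) measurable
  also have "\<dots> \<le> (\<integral>\<^sup>+t. ennreal (c1 * u powr (n / 2) * b) * ennreal (indicator {0..} t * (t powr (n / 2) * exp (- (b - c2 * u) * t))) \<partial>lborel)"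
  proof (intro nn_integral_mono)
    fix t :: real
    have "(\<integral>\<^sup>+y. ennreal (b * exp (- b * t)) * (if ?X y < t then 1 else 0) \<partial>m)
        = ennreal (b * exp (- b * t)) * emeasure m {y. ?X y < t}"
    proof -
      have "(\<integral>\<^sup>+y. ennreal (b * exp (- b * t)) * (if ?X y < t then 1 else 0) \<partial>m)
          = (\<integral>\<^sup>+y. ennreal (b * exp (- b * t)) * indicator {y. ?X y < t} y \<partial>m)"
        by (intro nn_integral_cong) (auto simp: indicator_def)
      also have "\<dots> = ennreal (b * exp (- b * t)) * emeasure m {y. ?X y < t}"
        by (intro nn_integral_cmult_indicator) (auto simp: sets)
      finally show ?thesis .
    qed
    also have "\<dots> \<le> ennreal (c1 * u powr (n / 2) * b) * ennreal (indicator {0..} t * (t powr (n / 2) * exp (- (b - c2 * u) * t)))"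
    proof (cases "0 < t")
      case True
      have "{y. ?X y < t} = ball x (sqrt (u * t))"
      proof (intro set_eqI)
        fix y
        have "?X y < t \<longleftrightarrow> (dist x y)\<^sup>2 < u * t" using u by (simp add: divide_less_eq mult.commute)
        also have "\<dots> \<longleftrightarrow> dist x y < sqrt (u * t)"
          using real_sqrt_less_iff[of "(dist x y)\<^sup>2" "u * t"] by simp
        finally show "y \<in> {y. ?X y < t} \<longleftrightarrow> y \<in> ball x (sqrt (u * t))" by simp
      qed
      then have "emeasure m {y. ?X y < t} \<le> ennreal (c1 * sqrt (u * t) powr n * exp (c2 * (sqrt (u * t))\<^sup>2))"
        using ball[of "sqrt (u * t)"] u True by simp
      also have "c1 * sqrt (u * t) powr n * exp (c2 * (sqrt (u * t))\<^sup>2) = c1 * (u powr (n / 2) * t powr (n / 2)) * exp (c2 * u * t)"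
      proof -
        have "(sqrt (u * t))\<^sup>2 = u * t" using u True by simp
        moreover have "sqrt (u * t) powr n = u powr (n / 2) * t powr (n / 2)"
          using u True by (simp add: powr_half_sqrt[symmetric] powr_powr powr_mult)
        ultimately show ?thesis by (simp only: mult.assoc)
      qed
      finally have "ennreal (b * exp (- b * t)) * emeasure m {y. ?X y < t}
          \<le> ennreal (b * exp (- b * t)) * ennreal (c1 * (u powr (n / 2) * t powr (n / 2)) * exp (c2 * u * t))"
        by (intro mult_left_mono) auto
      also have "\<dots> = ennreal (c1 * u powr (n / 2) * b) * ennreal (indicator {0..} t * (t powr (n / 2) * exp (- (b - c2 * u) * t)))"
        using True c1 b by (simp add: ennreal_mult'[symmetric] exp_add[symmetric] algebra_simps mult_exp_exp)
      finally show ?thesis .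
    next
      case False
      then have "{y. ?X y < t} = {}" using u by (auto simp: not_less intro: order_trans[of t 0])
      then show ?thesis by simp
    qed
    finally show "(\<integral>\<^sup>+y. ennreal (b * exp (- b * t)) * (if ?X y < t then 1 else 0) \<partial>m)
      \<le> ennreal (c1 * u powr (n / 2) * b) * ennreal (indicator {0..} t * (t powr (n / 2) * exp (- (b - c2 * u) * t)))" .
  qed
  also have "\<dots> = ennreal (c1 * u powr (n / 2) * b) * ennreal (Gamma (n / 2 + 1) / (b - c2 * u) powr (n / 2 + 1))"
    using b n nn_integral_powr_times_exp[of "b - c2 * u" "n / 2"] by (subst nn_integral_cmult) auto
  also have "\<dots> = ennreal (c1 * u powr (n / 2) * (b * Gamma (n / 2 + 1) / (b - c2 * u) powr (n / 2 + 1)))"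
    using c1 b by (simp add: ennreal_mult'[symmetric] mult.assoc)
  finally show ?thesis .
qed

text \<open>For \<open>2/3 \<le> g\<close> the bound \<open>\<integral> k\<^sup>q \<le> (sup k)\<^sup>q\<^sup>-\<^sup>1\<close> suffices. Otherwise \<open>\<integral> k exp (- (q - 1) X)\<close> is interpolated
  between \<open>\<integral> k = 1\<close> and the Gaussian estimate of \<open>\<integral> k exp (- a X)\<close>.\<close>
lemma kernel_Lp_estimate:
  fixes m :: "'a::polish_space measure" and x :: 'a and k V :: "'a \<Rightarrow> real"
  assumes sets[measurable_cong]: "sets m = sets borel" and sf: "sigma_finite_measure m"
    and pos: "0 < c1" "0 < c2" "0 < c3" "0 < c4" "0 < n" "0 < s" and p: "1 < p"
    and ball: "\<And>r. 0 < r \<Longrightarrow> emeasure m (ball x r) \<le> ennreal (c1 * r powr n * exp (c2 * r\<^sup>2))"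
    and k[measurable]: "k \<in> borel_measurable m" and k_nn: "\<And>y. 0 \<le> k y"
    and k1: "(\<integral>\<^sup>+y. k y \<partial>m) = 1"
    and k_le: "\<And>y. k y \<le> c3 * s powr (- n / 2) * exp (- ((dist x y)\<^sup>2 / (c4 * s)))"
    and V[measurable]: "V \<in> borel_measurable m" and V_nn: "\<And>y. 0 \<le> V y"
    and I: "0 \<le> I" "(\<integral>\<^sup>+y. V y powr p \<partial>m) \<le> ennreal I"
    and D: "1 \<le> c3 * c1 * c4 powr (n / 2) * Gamma (n / 2 + 1)"
    and g: "g = 1 - n / (2 * p)" "0 < g" and q: "q = p / (p - 1)"
    and v: "0 < v" "v \<le> 1" "v \<le> 36 / 49 \<or> 1 / 3 \<le> g" "c2 * c4 * s \<le> q * v"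
  shows "(\<integral>\<^sup>+y. k y * V y \<partial>m)
     \<le> ennreal ((c1 * c3 powr q * Gamma (n / 2 + 1) * (c4 / q) powr (n / 2)) powr (1 / q) * I powr (1 / p) * loss_factor g v * s powr (g - 1))"
proof -
  define d where "d = n / (2 * p)"
  have d: "0 < d" "d < 1" "g = 1 - d" "n / 2 = p * d" using g p pos by (auto simp: d_def)
  have q1: "1 < q" "1 / p + 1 / q = 1" "(q - 1) * (p - 1) = 1" "q * (p - 1) = p" "q - 1 = q / p"
    using p by (auto simp: q field_simps)
  define g0 where "g0 = c3 * s powr (- n / 2)"
  have g0: "0 < g0" using pos by (simp add: g0_def)
  define Gm where "Gm = Gamma (n / 2 + 1)"
  have G: "0 < Gm" using pos unfolding Gm_def by (intro Gamma_real_pos) auto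
  \<comment> \<open>The bound for the mass of the Gaussian majorant in the limit of small times. In
    terms of it, \<open>R powr q\<close> below is
    \<open>c3 powr (q - 1) * D / q powr (n / 2)\<close>.\<close>
  define D where "D = c3 * c1 * c4 powr (n / 2) * Gm"
  have D1: "1 \<le> D" using D by (simp add: D_def Gm_def)
  have lnD: "ln D = ln c3 + ln c1 + n / 2 * ln c4 + ln (Gm)"
    using pos G by (simp add: D_def ln_mult ln_powr)
  define X where "X = (\<lambda>y. (dist x y)\<^sup>2 / (c4 * s))"
  have Xm[measurable]: "X \<in> borel_measurable m" unfolding X_def by measurable
  have X_nn: "0 \<le> X y" for y using pos by (simp add: X_def)
  have k_le': "k y \<le> g0 * exp (- X y)" for y using k_le by (simp add: g0_def X_def)
  have k_le0: "k y \<le> g0" for y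
  proof -
    have "g0 * exp (- X y) \<le> g0 * 1" using g0 X_nn by (intro mult_left_mono) auto
    then show ?thesis using k_le'[of y] by simp
  qed
  have loss_factor: "0 < loss_factor g v" using d v by (auto simp: loss_factor_def intro!: add_pos_nonneg)
  define R where "R = (c1 * c3 powr q * Gm * (c4 / q) powr (n / 2)) powr (1 / q)"
  \<comment> \<open>By Hoelder only the integral of \<open>k powr q\<close> matters. The factor
    \<open>g0 powr (q - 1)\<close> produces the power of \<open>s\<close> in the conclusion, and the
    remaining factor \<open>Y\<close> is compared on the logarithmic scale.\<close>
  have main: ?thesis if Y: "0 < Y" "(\<integral>\<^sup>+y. k y powr q \<partial>m) \<le> ennreal (g0 powr (q - 1) * Y)"
      and lnY: "ln Y \<le> ln D - n / 2 * ln q + q * ln (loss_factor g v)" for Y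
  proof -
    have "(\<integral>\<^sup>+y. k y * V y \<partial>m) = (\<integral>\<^sup>+y. (V y powr p) powr (1 / p) * (k y powr q) powr (1 / q) \<partial>m)"
      using p q1 k_nn V_nn by (intro nn_integral_cong) (auto simp: powr_powr mult.commute)
    also have "\<dots> \<le> ennreal (I powr (1 / p) * (g0 powr (q - 1) * Y) powr (1 / q))"
      using p q1 I Y g0 by (intro nn_integral_Holder) auto
    also have "\<dots> \<le> ennreal (R * I powr (1 / p) * loss_factor g v * s powr (g - 1))"
    proof -
      have "ln ((g0 powr (q - 1) * Y) powr (1 / q)) = 1 / q * ((q - 1) * (ln c3 - n / 2 * ln s) + ln Y)"
        using g0 Y pos by (simp add: ln_mult ln_powr g0_def)
      also have "\<dots> \<le> 1 / q * ((q - 1) * (ln c3 - n / 2 * ln s) + (ln D - n / 2 * ln q + q * ln (loss_factor g v)))"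
        using lnY q1 by (intro mult_left_mono add_left_mono) auto
      also have "\<dots> = 1 / q * (ln c1 + q * ln c3 + ln (Gm) + n / 2 * (ln c4 - ln q)) + ln (loss_factor g v) - d * ln s"
      proof -
        have "(q - 1) * (n / 2) = q * d" using q1 p by (simp add: d)
        then have "(q - 1) * (n / 2 * ln s) = q * (d * ln s)" by (simp only: mult.assoc[symmetric])
        then show ?thesis using q1(1) by (simp add: lnD field_simps)
      qed
      also have "\<dots> = ln (R * loss_factor g v * s powr (g - 1))"
        using pos G loss_factor q1 by (simp add: R_def ln_mult ln_powr ln_div d)
      finally have "(g0 powr (q - 1) * Y) powr (1 / q) \<le> R * loss_factor g v * s powr (g - 1)"
        using g0 Y pos G loss_factor q1 by (subst (asm) ln_le_cancel_iff) (auto simp: R_def)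
      then have "I powr (1 / p) * (g0 powr (q - 1) * Y) powr (1 / q) \<le> I powr (1 / p) * (R * loss_factor g v * s powr (g - 1))"
        by (intro mult_left_mono) auto
      then show ?thesis by (intro ennreal_leI) (simp add: mult_ac)
    qed
    finally show ?thesis by (simp add: R_def Gm_def)
  qed
  \<comment> \<open>The Gaussian bound is spent on \<open>q - 1\<close> of the \<open>q\<close>
    factors; one factor \<open>k\<close> is kept, because its integral is known exactly.\<close>
  have kq: "k y powr q \<le> g0 powr (q - 1) * (k y * exp (- (q - 1) * X y))" for y
  proof (cases "k y = 0")
    case False
    then have ky: "0 < k y" using k_nn[of y] by simp
    have "k y powr q = k y powr (q - 1) * k y" using ky by (simp add: powr_diff)
    also have "\<dots> \<le> (g0 * exp (- X y)) powr (q - 1) * k y"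
      using k_le'[of y] ky q1 by (intro mult_right_mono powr_mono2) auto
    also have "(g0 * exp (- X y)) powr (q - 1) = g0 powr (q - 1) * exp (- (q - 1) * X y)"
    proof -
      have "exp (- X y) powr (q - 1) = exp (- (q - 1) * X y)" by (simp add: powr_def algebra_simps)
      then show ?thesis using g0 by (simp add: powr_mult)
    qed
    finally show ?thesis by (simp add: mult_ac)
  qed simp
  show ?thesis
  proof (cases "2 / 3 \<le> g")
    case True
    show ?thesis
    proof (rule main[of 1])
      have "(\<integral>\<^sup>+y. k y powr q \<partial>m) \<le> (\<integral>\<^sup>+y. ennreal (g0 powr (q - 1)) * ennreal (k y) \<partial>m)"
      proof (intro nn_integral_mono)
        fix y
        have "k y * exp (- (q - 1) * X y) \<le> k y * 1" using k_nn X_nn[of y] q1(1) by (intro mult_left_mono) (auto intro: mult_nonpos_nonneg)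
        then have "g0 powr (q - 1) * (k y * exp (- (q - 1) * X y)) \<le> g0 powr (q - 1) * k y" by (intro mult_left_mono) auto
        then have "k y powr q \<le> g0 powr (q - 1) * k y" using kq[of y] by linarith
        then show "ennreal (k y powr q) \<le> ennreal (g0 powr (q - 1)) * ennreal (k y)"
          by (simp add: ennreal_mult'[symmetric] ennreal_leI)
      qed
      also have "\<dots> = ennreal (g0 powr (q - 1) * 1)" using k1 by (simp add: nn_integral_cmult)
      finally show "(\<integral>\<^sup>+y. k y powr q \<partial>m) \<le> ennreal (g0 powr (q - 1) * 1)" .
      \<comment> \<open>Together with \<open>q - 1 = q / p\<close> this gives
        \<open>n / 2 * ln q \<le> q d\<close>: dropping the Gaussian decay altogether costs a factor
        of at most \<open>exp d\<close>.\<close>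
      have "ln q \<le> q - 1" using q1 by (intro ln_le_minus_one) auto
      then have "p * d * ln q \<le> p * d * (q / p)" using q1 p d by (intro mult_left_mono) auto
      then have "n / 2 * ln q \<le> q * d" using p d by (simp add: mult.commute)
      moreover have "0 \<le> ln D" using D1 by simp
      moreover have "ln (loss_factor g v) = d" using True d by (simp add: loss_factor_def)
      ultimately show "ln 1 \<le> ln D - n / 2 * ln q + q * ln (loss_factor g v)" by simp
    qed simp
  next
    case False
    define h where "h = 7 / 5 * sqrt v"
    define a where "a = q * (1 + h) - 1"
    have h: "0 < h" using v by (simp add: h_def)
    have hv: "0 < 1 + h - v" using h v by simp
    have "0 < q * h" using h q1(1) by simp
    then have a: "q - 1 < a" "0 < a" using q1(1) by (auto simp: a_def distrib_left)
    have ratio: "d * ((p - 1) * ln q - (ln q + ln (1 + h - v)) / a) + ln ((1 + h) / (1 + h - v)) / (p * a) \<le> ln (loss_factor g v)"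
      using kernel_ratio_bound[of p v d] p v d False unfolding a_def h_def q by (auto simp: loss_factor_def)
    \<comment> \<open>The weight that brings the decay rate \<open>a\<close> back to
      \<open>q - 1\<close>.\<close>
    define \<theta> where "\<theta> = (q - 1) / a"
    have "0 < \<theta>" "\<theta> < 1" "\<theta> * a = q - 1" using a q1(1) by (auto simp: \<theta>_def)
    moreover have "\<theta> = q / (p * a)" by (simp add: \<theta>_def q1(5))
    ultimately have \<theta>: "0 < \<theta>" "\<theta> < 1" "\<theta> * a = q - 1" "\<theta> = q / (p * a)" .
    define w where "w = c2 * (c4 * s)"
    have w: "q * (1 + h - v) \<le> 1 + a - w" using v by (simp add: w_def a_def algebra_simps)
    have w0: "0 < 1 + a - w" using w hv q1 by (smt (verit) mult_pos_pos)
    define B where "B = D * ((1 + a) / (1 + a - w) powr (n / 2 + 1))"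
    have B: "0 < B" using D1 a w0 by (auto simp: B_def)
    have "(\<integral>\<^sup>+y. k y * exp (- a * X y) \<partial>m) \<le> (\<integral>\<^sup>+y. ennreal g0 * ennreal (exp (- (1 + a) * X y)) \<partial>m)"
    proof (intro nn_integral_mono)
      fix y
      have "k y * exp (- a * X y) \<le> g0 * exp (- X y) * exp (- a * X y)" using k_le' by (intro mult_right_mono) auto
      also have "\<dots> = g0 * exp (- (1 + a) * X y)" by (simp add: exp_add[symmetric] algebra_simps mult_exp_exp)
      finally show "ennreal (k y * exp (- a * X y)) \<le> ennreal g0 * ennreal (exp (- (1 + a) * X y))"
        using g0 by (simp add: ennreal_mult'[symmetric] ennreal_leI)
    qed
    also have "\<dots> = ennreal g0 * (\<integral>\<^sup>+y. ennreal (exp (- (1 + a) * X y)) \<partial>m)" by (intro nn_integral_cmult) measurable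
    also have "\<dots> \<le> ennreal g0 * ennreal (c1 * (c4 * s) powr (n / 2) * ((1 + a) * Gm / (1 + a - w) powr (n / 2 + 1)))"
      unfolding X_def w_def Gm_def using pos a w0 ball sf
      by (intro mult_left_mono gaussian_integral_le sets) (auto simp: w_def)
    also have "\<dots> = ennreal B"
    proof -
      have "g0 * (c4 * s) powr (n / 2) = c3 * c4 powr (n / 2)"
        using pos by (simp add: g0_def powr_mult powr_minus powr_minus_divide)
      then have "g0 * (c1 * (c4 * s) powr (n / 2) * ((1 + a) * Gm / (1 + a - w) powr (n / 2 + 1))) = B"
        by (simp add: B_def D_def mult_ac)
      then show ?thesis using g0 by (simp add: ennreal_mult'[symmetric])
    qed
    finally have kB: "(\<integral>\<^sup>+y. k y * exp (- a * X y) \<partial>m) \<le> ennreal B" .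
    show ?thesis
    proof (rule main[of "B powr \<theta>"])
      show "0 < B powr \<theta>" using B by simp
      have "(\<integral>\<^sup>+y. k y powr q \<partial>m) \<le> (\<integral>\<^sup>+y. ennreal (g0 powr (q - 1)) * ennreal (k y powr (1 - \<theta>) * (k y * exp (- a * X y)) powr \<theta>) \<partial>m)"
      proof (intro nn_integral_mono)
        fix y
        have "k y powr (1 - \<theta>) * (k y * exp (- a * X y)) powr \<theta> = k y * exp (- (q - 1) * X y)"
        proof (cases "k y = 0")
          case False
          then have ky: "0 < k y" using k_nn[of y] by simp
          have "k y powr (1 - \<theta>) * (k y * exp (- a * X y)) powr \<theta> = (k y powr (1 - \<theta>) * k y powr \<theta>) * exp (- (\<theta> * a) * X y)"
            using ky by (simp add: powr_mult powr_def[of "exp _"] mult_ac)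
          also have "k y powr (1 - \<theta>) * k y powr \<theta> = k y" using ky by (simp add: powr_add[symmetric])
          finally show ?thesis by (simp only: \<theta>(3))
        qed simp
        then show "ennreal (k y powr q) \<le> ennreal (g0 powr (q - 1)) * ennreal (k y powr (1 - \<theta>) * (k y * exp (- a * X y)) powr \<theta>)"
          using kq[of y] by (simp add: ennreal_mult'[symmetric] ennreal_leI)
      qed
      also have "\<dots> = ennreal (g0 powr (q - 1)) * (\<integral>\<^sup>+y. k y powr (1 - \<theta>) * (k y * exp (- a * X y)) powr \<theta> \<partial>m)"
        by (intro nn_integral_cmult) measurable
      also have "\<dots> \<le> ennreal (g0 powr (q - 1)) * ennreal (1 powr (1 - \<theta>) * B powr \<theta>)"
        using \<theta> k_nn kB k1 B by (intro mult_left_mono nn_integral_Holder) auto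
      also have "\<dots> = ennreal (g0 powr (q - 1) * B powr \<theta>)" by (simp add: ennreal_mult'[symmetric])
      finally show "(\<integral>\<^sup>+y. k y powr q \<partial>m) \<le> ennreal (g0 powr (q - 1) * B powr \<theta>)" .
      have lB: "ln B = ln D + (ln (1 + a) - (n / 2 + 1) * ln (1 + a - w))"
        using D1 a w0 by (simp add: B_def ln_mult ln_div ln_powr)
      have a1: "1 + a = q * (1 + h)" by (simp add: a_def)
      have "ln (q * (1 + h - v)) \<le> ln (1 + a - w)" using w w0 hv q1 by (intro ln_mono) auto
      then have l1: "ln q + ln (1 + h - v) \<le> ln (1 + a - w)" using q1 hv by (simp add: ln_mult)
      have "ln (B powr \<theta>) = \<theta> * ln D + \<theta> * (ln (1 + a) - (n / 2 + 1) * ln (1 + a - w))"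
        using B by (simp add: ln_powr lB distrib_left)
      \<comment> \<open>Interpolation only produces \<open>D powr \<theta>\<close>, whereas the
        target constant contains \<open>D\<close> itself; the passage rests on
        \<open>D \<ge> 1\<close>.\<close>
      also have "\<dots> \<le> 1 * ln D + \<theta> * ((ln q + ln (1 + h)) - (n / 2 + 1) * (ln q + ln (1 + h - v)))"
        using \<theta> D1 l1 pos a1 q1 h by (intro add_mono mult_right_mono mult_left_mono diff_mono) (auto simp: ln_mult)
      also have "\<theta> * ((ln q + ln (1 + h)) - (n / 2 + 1) * (ln q + ln (1 + h - v)))
          = q * (d * ((p - 1) * ln q - (ln q + ln (1 + h - v)) / a) + ln ((1 + h) / (1 + h - v)) / (p * a)) - n / 2 * ln q"
      proof -
        have "q * (d * ((p - 1) * ln q)) = n / 2 * ln q"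
          using q1(4) by (simp add: d(4))
        moreover have "q * (d * (L / a)) = \<theta> * (n / 2 * L)" for L
          using p a by (simp add: \<theta>(4) d(4))
        moreover have "q * (L / (p * a)) = \<theta> * L" for L by (simp add: \<theta>(4))
        moreover have "ln ((1 + h) / (1 + h - v)) = ln (1 + h) - ln (1 + h - v)" using h hv by (simp add: ln_div)
        moreover have "q * (d * (x - y) + z) = q * (d * x) - q * (d * y) + q * z" for x y z by (simp add: algebra_simps)
        ultimately show ?thesis by (simp only:) (simp add: algebra_simps)
      qed
      also have "\<dots> \<le> q * ln (loss_factor g v) - n / 2 * ln q" using q1(1) by (intro diff_right_mono mult_left_mono[OF ratio]) simp
      finally show "ln (B powr \<theta>) \<le> ln D - n / 2 * ln q + q * ln (loss_factor g v)" by simp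
    qed
  qed
qed

section \<open>Exponential series along a path\<close>

text \<open>Expanding \<open>Q\<^sup>k\<^sup>+\<^sup>1\<close> as a double integral and splitting it along the diagonal.\<close>
lemma nn_integral_power_tail:
  fixes v :: "real \<Rightarrow> ennreal"
  assumes [measurable]: "v \<in> borel_measurable borel"
  defines "Q \<equiv> \<lambda>r. \<integral>\<^sup>+s. v s * indicator {r<..} s \<partial>lborel"
  shows "of_nat (Suc k) * (\<integral>\<^sup>+s. v s * indicator {r<..} s * Q s ^ k \<partial>lborel) = Q r ^ Suc k"
proof (induction k arbitrary: r)
  case 0
  then show ?case by (simp add: Q_def)
next
  case (Suc k)
  have Qm[measurable]: "Q \<in> borel_measurable borel"
  proof -
    have "(\<lambda>r. \<integral>\<^sup>+s. v s * (if r < s then 1 else 0) \<partial>lborel) \<in> borel_measurable borel" by measurable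
    also have "(\<lambda>r. \<integral>\<^sup>+s. v s * (if r < s then 1 else 0) \<partial>lborel) = Q"
      by (auto simp: Q_def indicator_def intro!: ext nn_integral_cong)
    finally show ?thesis .
  qed
  let ?K = "\<integral>\<^sup>+s. v s * indicator {r<..} s * Q s ^ Suc k \<partial>lborel"
  have "Q r ^ Suc (Suc k) = Q r * (of_nat (Suc k) * (\<integral>\<^sup>+w. v w * indicator {r<..} w * Q w ^ k \<partial>lborel))"
    by (subst Suc.IH) (rule power_Suc)
  also have "\<dots> = of_nat (Suc k) * (\<integral>\<^sup>+s. (v s * indicator {r<..} s) * (\<integral>\<^sup>+w. v w * indicator {r<..} w * Q w ^ k \<partial>lborel) \<partial>lborel)"
    by (subst nn_integral_multc) (auto simp: Q_def mult_ac)
  also have "(\<integral>\<^sup>+s. (v s * indicator {r<..} s) * (\<integral>\<^sup>+w. v w * indicator {r<..} w * Q w ^ k \<partial>lborel) \<partial>lborel)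
     = (\<integral>\<^sup>+s. (\<integral>\<^sup>+w. (v s * indicator {r<..} s) * (v w * indicator {r<..} w * Q w ^ k) \<partial>lborel) \<partial>lborel)"
    by (intro nn_integral_cong nn_integral_cmult[symmetric]) measurable
  also have "\<dots> = (\<integral>\<^sup>+s. (\<integral>\<^sup>+w. (v s * indicator {r<..} s) * (v w * (if s < w then 1 else 0) * Q w ^ k)
        + (v s * (if w < s then 1 else 0)) * (v w * indicator {r<..} w * Q w ^ k) \<partial>lborel) \<partial>lborel)"
  proof (rule nn_integral_cong)
    fix s :: real
    show "(\<integral>\<^sup>+w. (v s * indicator {r<..} s) * (v w * indicator {r<..} w * Q w ^ k) \<partial>lborel)
      = (\<integral>\<^sup>+w. (v s * indicator {r<..} s) * (v w * (if s < w then 1 else 0) * Q w ^ k)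
        + (v s * (if w < s then 1 else 0)) * (v w * indicator {r<..} w * Q w ^ k) \<partial>lborel)"
      by (intro nn_integral_cong_AE) (use AE_lborel_singleton[of s] in eventually_elim, auto simp: indicator_def)
  qed
  also have "\<dots> = (\<integral>\<^sup>+s. (\<integral>\<^sup>+w. (v s * indicator {r<..} s) * (v w * (if s < w then 1 else 0) * Q w ^ k) \<partial>lborel) \<partial>lborel)
      + (\<integral>\<^sup>+s. (\<integral>\<^sup>+w. (v s * (if w < s then 1 else 0)) * (v w * indicator {r<..} w * Q w ^ k) \<partial>lborel) \<partial>lborel)"
    by (simp add: nn_integral_add)
  also have "(\<integral>\<^sup>+s. (\<integral>\<^sup>+w. (v s * (if w < s then 1 else 0)) * (v w * indicator {r<..} w * Q w ^ k) \<partial>lborel) \<partial>lborel)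
     = (\<integral>\<^sup>+w. (\<integral>\<^sup>+s. (v s * (if w < s then 1 else 0)) * (v w * indicator {r<..} w * Q w ^ k) \<partial>lborel) \<partial>lborel)"
    by (intro lborel_pair.Fubini') measurable
  also have "\<dots> = ?K"
  proof (intro nn_integral_cong)
    fix w :: real
    have "(\<integral>\<^sup>+s. (v s * (if w < s then 1 else 0)) * (v w * indicator {r<..} w * Q w ^ k) \<partial>lborel)
       = (\<integral>\<^sup>+s. v s * indicator {w<..} s \<partial>lborel) * (v w * indicator {r<..} w * Q w ^ k)"
      by (subst nn_integral_multc[symmetric]) (auto intro!: nn_integral_cong simp: indicator_def)
    then show "(\<integral>\<^sup>+s. (v s * (if w < s then 1 else 0)) * (v w * indicator {r<..} w * Q w ^ k) \<partial>lborel)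
      = v w * indicator {r<..} w * Q w ^ Suc k" by (simp add: Q_def mult_ac)
  qed
  also have "of_nat (Suc k) * ((\<integral>\<^sup>+s. (\<integral>\<^sup>+w. (v s * indicator {r<..} s) * (v w * (if s < w then 1 else 0) * Q w ^ k) \<partial>lborel) \<partial>lborel) + ?K)
     = (\<integral>\<^sup>+s. of_nat (Suc k) * (\<integral>\<^sup>+w. (v s * indicator {r<..} s) * (v w * (if s < w then 1 else 0) * Q w ^ k) \<partial>lborel) \<partial>lborel)
       + of_nat (Suc k) * ?K"
    by (subst nn_integral_cmult) (auto simp: distrib_left)
  also have "(\<integral>\<^sup>+s. of_nat (Suc k) * (\<integral>\<^sup>+w. (v s * indicator {r<..} s) * (v w * (if s < w then 1 else 0) * Q w ^ k) \<partial>lborel) \<partial>lborel) = ?K"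
  proof (intro nn_integral_cong)
    fix s :: real
    have "(\<integral>\<^sup>+w. (v s * indicator {r<..} s) * (v w * (if s < w then 1 else 0) * Q w ^ k) \<partial>lborel)
       = (v s * indicator {r<..} s) * (\<integral>\<^sup>+w. v w * indicator {s<..} w * Q w ^ k \<partial>lborel)"
      by (subst nn_integral_cmult[symmetric]) (auto intro!: nn_integral_cong simp: indicator_def)
    then have "of_nat (Suc k) * (\<integral>\<^sup>+w. (v s * indicator {r<..} s) * (v w * (if s < w then 1 else 0) * Q w ^ k) \<partial>lborel)
       = (v s * indicator {r<..} s) * (of_nat (Suc k) * (\<integral>\<^sup>+w. v w * indicator {s<..} w * Q w ^ k \<partial>lborel))"
      by (simp only: mult.left_commute)
    then show "of_nat (Suc k) * (\<integral>\<^sup>+w. (v s * indicator {r<..} s) * (v w * (if s < w then 1 else 0) * Q w ^ k) \<partial>lborel)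
      = v s * indicator {r<..} s * Q s ^ Suc k" by (simp only: Suc.IH)
  qed
  also have "?K + of_nat (Suc k) * ?K = of_nat (Suc (Suc k)) * ?K" by (simp add: distrib_right)
  finally show ?case ..
qed

text \<open>Picard iterates for \<open>u r = 1 + \<integral> v s u s ds\<close> over
  \<open>s > r\<close>, which is solved by the exponential of the tail integral of \<open>v\<close>.
  Since the integral extends over the future of \<open>r\<close>, one step corresponds to one use of
  the Markov property.\<close>

primrec path_iter :: "(real \<Rightarrow> ennreal) \<Rightarrow> nat \<Rightarrow> real \<Rightarrow> ennreal" where
  "path_iter v 0 r = 1"
| "path_iter v (Suc K) r = 1 + (\<integral>\<^sup>+s. v s * indicator {r<..} s * path_iter v K s \<partial>lborel)"

lemma path_iter_eq:
  fixes v :: "real \<Rightarrow> ennreal"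
  assumes [measurable]: "v \<in> borel_measurable borel"
  defines "Q \<equiv> \<lambda>r. \<integral>\<^sup>+s. v s * indicator {r<..} s \<partial>lborel"
  shows "path_iter v K r = (\<Sum>k\<le>K. Q r ^ k * ennreal (1 / fact k))"
proof (induction K arbitrary: r)
  case 0
  then show ?case by simp
next
  case (Suc K)
  have Qm[measurable]: "Q \<in> borel_measurable borel"
  proof -
    have "(\<lambda>r. \<integral>\<^sup>+s. v s * (if r < s then 1 else 0) \<partial>lborel) \<in> borel_measurable borel" by measurable
    also have "(\<lambda>r. \<integral>\<^sup>+s. v s * (if r < s then 1 else 0) \<partial>lborel) = Q"
      by (auto simp: Q_def indicator_def intro!: ext nn_integral_cong)
    finally show ?thesis .
  qed
  have "(\<integral>\<^sup>+s. v s * indicator {r<..} s * path_iter v K s \<partial>lborel)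
      = (\<integral>\<^sup>+s. (\<Sum>k\<le>K. (v s * indicator {r<..} s * Q s ^ k) * ennreal (1 / fact k)) \<partial>lborel)"
    by (intro nn_integral_cong) (simp add: Suc.IH sum_distrib_left mult.assoc)
  also have "\<dots> = (\<Sum>k\<le>K. (\<integral>\<^sup>+s. v s * indicator {r<..} s * Q s ^ k \<partial>lborel) * ennreal (1 / fact k))"
    by (simp add: nn_integral_sum nn_integral_multc)
  also have "\<dots> = (\<Sum>k\<le>K. Q r ^ Suc k * ennreal (1 / fact (Suc k)))"
  proof (intro sum.cong refl)
    fix k
    let ?I = "\<integral>\<^sup>+s. v s * indicator {r<..} s * Q s ^ k \<partial>lborel"
    have "Q r ^ Suc k = of_nat (Suc k) * ?I" using nn_integral_power_tail[of v k r] by (simp add: Q_def)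
    then have "Q r ^ Suc k * ennreal (1 / fact (Suc k)) = ?I * (ennreal (real (Suc k)) * ennreal (1 / fact (Suc k)))"
      by (simp only: ennreal_of_nat_eq_real_of_nat mult_ac)
    also have "ennreal (real (Suc k)) * ennreal (1 / fact (Suc k)) = ennreal (1 / fact k)"
      by (subst ennreal_mult'[symmetric]) auto
    finally show "?I * ennreal (1 / fact k) = Q r ^ Suc k * ennreal (1 / fact (Suc k))" ..
  qed
  finally have "path_iter v (Suc K) r = 1 + (\<Sum>k\<le>K. Q r ^ Suc k * ennreal (1 / fact (Suc k)))"
    by (simp only: path_iter.simps)
  then show ?case by (simp only: sum.atMost_Suc_shift) simp
qed

lemma ennexp_eq_SUP: "ennexp a = (SUP K. \<Sum>k\<le>K. a ^ k * ennreal (1 / fact k))"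
proof (cases a)
  case (real r)
  have "(\<lambda>k. ennreal (r ^ k / fact k)) sums ennreal (exp r)"
    using exp_converges[of r] real by (subst sums_ennreal) (auto simp: divide_inverse mult.commute)
  then have "ennreal (exp r) = (\<Sum>k. ennreal (r ^ k / fact k))" by (simp add: sums_iff)
  also have "\<dots> = (SUP K. \<Sum>k<K. ennreal (r ^ k / fact k))" by (rule suminf_eq_SUP)
  also have "\<dots> = (SUP K. \<Sum>k\<le>K. ennreal (r ^ k / fact k))"
  proof (rule antisym)
    show "(SUP K. \<Sum>k<K. ennreal (r ^ k / fact k)) \<le> (SUP K. \<Sum>k\<le>K. ennreal (r ^ k / fact k))"
    proof (rule SUP_least)
      fix K
      show "(\<Sum>k<K. ennreal (r ^ k / fact k)) \<le> (SUP K. \<Sum>k\<le>K. ennreal (r ^ k / fact k))"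
        by (rule SUP_upper2[of K]) (auto intro: sum_mono2)
    qed
    show "(SUP K. \<Sum>k\<le>K. ennreal (r ^ k / fact k)) \<le> (SUP K. \<Sum>k<K. ennreal (r ^ k / fact k))"
    proof (rule SUP_least)
      fix K
      show "(\<Sum>k\<le>K. ennreal (r ^ k / fact k)) \<le> (SUP K. \<Sum>k<K. ennreal (r ^ k / fact k))"
        by (rule SUP_upper2[of "Suc K"]) (auto simp: lessThan_Suc_atMost)
    qed
  qed
  finally show ?thesis using real by (simp add: ennexp_def ennreal_power ennreal_mult'[symmetric])
next
  case top
  \<comment> \<open>An infinite exponent is already visible in the linear term.\<close>
  have "(\<Sum>k\<le>1. a ^ k * ennreal (1 / fact k)) = \<top>" using top by simp
  then have "\<top> \<le> (SUP K. \<Sum>k\<le>K. a ^ k * ennreal (1 / fact k))" by (intro SUP_upper2[of 1]) auto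
  then have "(SUP K. \<Sum>k\<le>K. a ^ k * ennreal (1 / fact k)) = \<top>" by (simp only: top_unique)
  moreover have "ennexp a = \<top>" using top by (simp add: ennexp_def)
  ultimately show ?thesis by (simp only:)
qed

lemma path_iter_SUP:
  fixes v :: "real \<Rightarrow> ennreal"
  assumes "v \<in> borel_measurable borel"
  shows "ennexp (\<integral>\<^sup>+s. v s * indicator {r<..} s \<partial>lborel) = (SUP K. path_iter v K r)"
  by (simp add: ennexp_eq_SUP path_iter_eq[OF assms])

section \<open>Markov property and iterated kernels\<close>

text \<open>The values of \<open>p\<close> at nonpositive times are arbitrary; cutting them off
  makes the kernel measurable in all three variables on the whole product.\<close>

definition kern :: "(real \<Rightarrow> 'a \<Rightarrow> 'a \<Rightarrow> real) \<Rightarrow> real \<Rightarrow> 'a \<Rightarrow> 'a \<Rightarrow> ennreal" where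
  "kern p s x y = ennreal (if 0 < s then p s x y else 0)"

text \<open>Substitute for conditional expectations: \<open>F\<close> and \<open>G\<close> have the
  same conditional expectation given \<open>Y\<close>, so they can be exchanged against every
  function of \<open>Y\<close>.\<close>

lemma nn_integral_eq_of_indicators:
  assumes [measurable]: "Y \<in> measurable M N" "F \<in> borel_measurable M" "G \<in> borel_measurable M"
    and eq: "\<And>A. A \<in> sets N \<Longrightarrow> (\<integral>\<^sup>+\<omega>. F \<omega> * indicator A (Y \<omega>) \<partial>M) = (\<integral>\<^sup>+\<omega>. G \<omega> * indicator A (Y \<omega>) \<partial>M)"
    and f: "f \<in> borel_measurable N"
  shows "(\<integral>\<^sup>+\<omega>. F \<omega> * f (Y \<omega>) \<partial>M) = (\<integral>\<^sup>+\<omega>. G \<omega> * f (Y \<omega>) \<partial>M)"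
  using f
proof (induction f rule: borel_measurable_induct)
  case (cong f g)
  have "(\<integral>\<^sup>+\<omega>. H \<omega> * g (Y \<omega>) \<partial>M) = (\<integral>\<^sup>+\<omega>. H \<omega> * f (Y \<omega>) \<partial>M)" for H
    using cong(3) measurable_space[OF assms(1)] by (intro nn_integral_cong) auto
  then show ?case using cong by simp
next
  case (set A)
  then show ?case by (rule eq)
next
  case (mult u c)
  note [measurable] = mult(2)
  have "(\<integral>\<^sup>+\<omega>. H \<omega> * (c * u (Y \<omega>)) \<partial>M) = c * (\<integral>\<^sup>+\<omega>. H \<omega> * u (Y \<omega>) \<partial>M)" if [measurable]: "H \<in> borel_measurable M" for H
    by (subst nn_integral_cmult[symmetric]) (auto simp: mult_ac)
  then show ?case using mult by simp
next
  case (add u v)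
  note [measurable] = add(1,3)
  have "(\<integral>\<^sup>+\<omega>. H \<omega> * (v (Y \<omega>) + u (Y \<omega>)) \<partial>M) = (\<integral>\<^sup>+\<omega>. H \<omega> * v (Y \<omega>) \<partial>M) + (\<integral>\<^sup>+\<omega>. H \<omega> * u (Y \<omega>) \<partial>M)"
    if [measurable]: "H \<in> borel_measurable M" for H
    by (subst nn_integral_add[symmetric]) (auto simp: distrib_left)
  then show ?case using add by simp
next
  case (seq U)
  note [measurable] = seq(1)
  have "(\<integral>\<^sup>+\<omega>. H \<omega> * (SUP i. U i) (Y \<omega>) \<partial>M) = (SUP i. \<integral>\<^sup>+\<omega>. H \<omega> * U i (Y \<omega>) \<partial>M)"
    if [measurable]: "H \<in> borel_measurable M" for H
  proof -
    have "(\<integral>\<^sup>+\<omega>. H \<omega> * (SUP i. U i) (Y \<omega>) \<partial>M) = (\<integral>\<^sup>+\<omega>. (SUP i. H \<omega> * U i (Y \<omega>)) \<partial>M)"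
      by (simp add: SUP_mult_left_ennreal image_image)
    also have "\<dots> = (SUP i. \<integral>\<^sup>+\<omega>. H \<omega> * U i (Y \<omega>) \<partial>M)"
      using \<open>incseq U\<close> by (intro nn_integral_monotone_convergence_SUP) (auto simp: incseq_def le_fun_def intro!: mult_left_mono)
    finally show ?thesis .
  qed
  then show ?case using seq by simp
qed

section \<open>The operators of a measurable kernel and the renewal iterates\<close>

locale transition_kernel =
  fixes m :: "'a::polish_space measure" and p :: "real \<Rightarrow> 'a \<Rightarrow> 'a \<Rightarrow> real"
  assumes sets_m[measurable_cong]: "sets m = sets borel" and sf: "sigma_finite_measure m"
    and kern_measurable': "(\<lambda>(s, x, y). kern p s x y) \<in> borel_measurable (borel \<Otimes>\<^sub>M borel \<Otimes>\<^sub>M borel)"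
begin

lemma kern_measurable[measurable (raw)]:
  assumes [measurable]: "s \<in> borel_measurable N" "x \<in> measurable N borel" "y \<in> measurable N borel"
  shows "(\<lambda>a. kern p (s a) (x a) (y a)) \<in> borel_measurable N"
proof -
  have "(\<lambda>a. (s a, x a, y a)) \<in> measurable N (borel \<Otimes>\<^sub>M borel \<Otimes>\<^sub>M borel)" by measurable
  from measurable_compose[OF this kern_measurable'] show ?thesis by simp
qed

definition heat :: "real \<Rightarrow> ('a \<Rightarrow> ennreal) \<Rightarrow> 'a \<Rightarrow> ennreal" where
  "heat s f x = (\<integral>\<^sup>+y. kern p s x y * f y \<partial>m)"

lemma heat_measurable[measurable (raw)]:
  assumes [measurable]: "s \<in> borel_measurable N" "x \<in> measurable N borel"
    "(\<lambda>(a, y). f a y) \<in> borel_measurable (N \<Otimes>\<^sub>M borel)"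
  shows "(\<lambda>a. heat (s a) (f a) (x a)) \<in> borel_measurable N"
proof -
  interpret sigma_finite_measure m by (rule sf)
  have "(\<lambda>(a, y). f a y) \<in> borel_measurable (N \<Otimes>\<^sub>M m)"
    using assms(3) sets_m by (simp cong: measurable_cong_sets sets_pair_measure_cong)
  then show ?thesis unfolding heat_def by measurable
qed

primrec iter_heat :: "('a \<Rightarrow> ennreal) \<Rightarrow> nat \<Rightarrow> real \<Rightarrow> 'a \<Rightarrow> ennreal" where
  "iter_heat V 0 t x = 1"
| "iter_heat V (Suc K) t x =
     1 + (\<integral>\<^sup>+s. indicator {0<..t} s * heat s (\<lambda>y. V y * iter_heat V K (t - s) y) x \<partial>lborel)"

lemma iter_heat_measurable':
  assumes V[measurable]: "V \<in> borel_measurable borel"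
  shows "(\<lambda>(t, x). iter_heat V K t x) \<in> borel_measurable (borel \<Otimes>\<^sub>M borel)"
proof (induction K)
  case (Suc K)
  have [measurable]: "(\<lambda>b. iter_heat V K (fst (fst (fst b)) - snd (fst b)) (snd b)) \<in> borel_measurable (((borel \<Otimes>\<^sub>M borel) \<Otimes>\<^sub>M lborel) \<Otimes>\<^sub>M borel)"
    (is "_ \<in> borel_measurable ?N")
  proof -
    have "(\<lambda>b. (fst (fst (fst b)) - snd (fst b), snd b)) \<in> measurable ?N (borel \<Otimes>\<^sub>M borel)" by measurable
    from measurable_compose[OF this Suc.IH] show ?thesis by simp
  qed
  \<comment> \<open>The interval depends on the variable, so its indicator is written as a condition
    that is jointly measurable in \<open>s\<close> and \<open>a\<close>.\<close>
  have "(\<lambda>a. 1 + (\<integral>\<^sup>+s. (if 0 < s \<and> s \<le> fst a then 1 else 0) * heat s (\<lambda>y. V y * iter_heat V K (fst a - s) y) (snd a) \<partial>lborel)) \<in> borel_measurable (borel \<Otimes>\<^sub>M borel)"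
    by measurable
  also have "(\<lambda>a. 1 + (\<integral>\<^sup>+s. (if 0 < s \<and> s \<le> fst a then 1 else 0) * heat s (\<lambda>y. V y * iter_heat V K (fst a - s) y) (snd a) \<partial>lborel))
     = (\<lambda>(t, x). iter_heat V (Suc K) t x)"
    by (auto intro!: ext nn_integral_cong arg_cong[where f="\<lambda>z. 1 + z"] simp: indicator_def)
  finally show ?case .
qed simp

lemma iter_heat_measurable[measurable (raw)]:
  assumes "V \<in> borel_measurable borel" and [measurable]: "t \<in> borel_measurable N" "x \<in> measurable N borel"
  shows "(\<lambda>a. iter_heat V K (t a) (x a)) \<in> borel_measurable N"
proof -
  have "(\<lambda>a. (t a, x a)) \<in> measurable N (borel \<Otimes>\<^sub>M borel)" by measurable
  from measurable_compose[OF this iter_heat_measurable'[OF assms(1)]] show ?thesis by simp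
qed

primrec fdd_heat :: "(real \<times> 'a set) list \<Rightarrow> ('a \<Rightarrow> ennreal) \<Rightarrow> 'a \<Rightarrow> ennreal" where
  "fdd_heat [] g x = g x"
| "fdd_heat (sA # L) g x = heat (fst sA) (\<lambda>y. indicator (snd sA) y * fdd_heat L g y) x"

definition valid :: "(real \<times> 'a set) list \<Rightarrow> bool" where
  "valid L \<longleftrightarrow> (\<forall>(s, A)\<in>set L. s > 0 \<and> A \<in> sets borel)"

lemma valid_simps[simp]: "valid []" "valid (sA # L) \<longleftrightarrow> fst sA > 0 \<and> snd sA \<in> sets borel \<and> valid L"
  "valid (L @ L') \<longleftrightarrow> valid L \<and> valid L'"
  by (auto simp: valid_def split_beta)

lemma fdd_heat_measurable[measurable]:
  assumes "valid L" and [measurable]: "g \<in> borel_measurable borel"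
  shows "fdd_heat L g \<in> borel_measurable borel"
  using assms(1)
proof (induction L)
  case (Cons sA L)
  then have [measurable]: "fdd_heat L g \<in> borel_measurable borel" "snd sA \<in> sets borel" by auto
  have "fdd_heat (sA # L) g = heat (fst sA) (\<lambda>y. indicator (snd sA) y * fdd_heat L g y)" by (rule ext) simp
  then show ?case by simp
next
  case Nil
  have "fdd_heat [] g = g" by (rule ext) simp
  then show ?case by simp
qed

text \<open>Splitting the last set keeps \<open>A\<close> as a constraint and makes \<open>B\<close>
  a test function, the starting point for passing from sets to functions.\<close>

lemma fdd_eq_fdd_heat:
  assumes "valid L" "0 < s"
  shows "fdd m p (L @ [(s, A \<inter> B)]) x = fdd_heat (L @ [(s, A)]) (indicator B) x"
  using assms(1)
proof (induction L arbitrary: x)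
  case Nil
  show ?case using assms by (auto simp: heat_def kern_def indicator_def intro!: nn_integral_cong)
next
  case (Cons sA L)
  then show ?case by (cases sA) (auto simp: heat_def kern_def mult.assoc)
qed

lemma fdd_heat_append: "fdd_heat (L @ L') g x = fdd_heat L (fdd_heat L' g) x"
proof (induction L arbitrary: x)
  case (Cons sA L)
  have "fdd_heat (L @ L') g = fdd_heat L (fdd_heat L' g)" using Cons.IH by (intro ext)
  then show ?case by simp
qed simp

end

section \<open>Paths with prescribed finite-dimensional distributions\<close>

locale transition_paths = transition_kernel m p + prob_space M
  for m :: "'a::polish_space measure" and p and M :: "'w measure" +
  fixes Y :: "real \<Rightarrow> 'w \<Rightarrow> 'a" and x :: 'a
  assumes Y_measurable': "(\<lambda>(s, \<omega>). Y s \<omega>) \<in> measurable (borel \<Otimes>\<^sub>M M) borel"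
    and Y_0: "AE \<omega> in M. Y 0 \<omega> = x"
    and fdd: "\<And>L. (\<forall>(s, A)\<in>set L. s > 0 \<and> A \<in> sets borel) \<Longrightarrow>
       emeasure M {\<omega>\<in>space M. \<forall>i<length L. Y (sum_list (map fst (take (Suc i) L))) \<omega> \<in> snd (L ! i)} = fdd m p L x"
begin

lemma Y_measurable[measurable (raw)]:
  assumes [measurable]: "s \<in> borel_measurable N" "w \<in> measurable N M"
  shows "(\<lambda>a. Y (s a) (w a)) \<in> measurable N borel"
proof -
  have "(\<lambda>a. (s a, w a)) \<in> measurable N (borel \<Otimes>\<^sub>M M)" by measurable
  from measurable_compose[OF this Y_measurable'] show ?thesis by simp
qed

definition cyl :: "(real \<times> 'a set) list \<Rightarrow> 'w set" where
  "cyl L = {\<omega>\<in>space M. \<forall>i<length L. Y (sum_list (map fst (take (Suc i) L))) \<omega> \<in> snd (L ! i)}"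

abbreviation tot :: "(real \<times> 'a set) list \<Rightarrow> real" where
  "tot L \<equiv> sum_list (map fst L)"

lemma cyl_Nil[simp]: "cyl [] = space M" by (simp add: cyl_def)

lemma cyl_snoc: "cyl (L @ [(s, A)]) = cyl L \<inter> {\<omega>\<in>space M. Y (tot L + s) \<omega> \<in> A}"
  by (auto simp: cyl_def less_Suc_eq nth_append all_conj_distrib)

lemma emeasure_cyl: "valid L \<Longrightarrow> emeasure M (cyl L) = fdd m p L x"
  unfolding cyl_def valid_def by (rule fdd)

lemma cyl_measurable[measurable]: "valid L \<Longrightarrow> cyl L \<in> sets M"
proof (induction L rule: rev_induct)
  case (snoc sA L)
  obtain s A where sA: "sA = (s, A)" by (cases sA)
  have [measurable]: "cyl L \<in> sets M" "A \<in> sets borel" using snoc sA by auto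
  show ?case unfolding sA cyl_snoc by measurable
qed simp

text \<open>For indicators this is the formula for the finite-dimensional distributions. Both sides
  are additive, homogeneous and continuous along increasing sequences in \<open>g\<close>. The empty
  list is the case of the deterministic starting point.\<close>

lemma nn_integral_cyl:
  assumes L: "valid L" and g[measurable]: "g \<in> borel_measurable borel"
  shows "(\<integral>\<^sup>+\<omega>. indicator (cyl L) \<omega> * g (Y (tot L) \<omega>) \<partial>M) = fdd_heat L g x"
proof (cases L rule: rev_cases)
  case Nil
  have "(\<integral>\<^sup>+\<omega>. indicator (cyl L) \<omega> * g (Y (tot L) \<omega>) \<partial>M) = (\<integral>\<^sup>+\<omega>. g x \<partial>M)"
    using Y_0 by (intro nn_integral_cong_AE) (auto simp: Nil elim!: eventually_mono)
  then show ?thesis by (simp add: Nil emeasure_space_1)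
next
  case (snoc L' sA)
  obtain s A where sA: "sA = (s, A)" by (cases sA)
  have L': "valid L'" "0 < s" and [measurable]: "A \<in> sets borel" using L snoc sA by auto
  note [measurable] = cyl_measurable[OF L]
  show ?thesis
    using g
  proof (induction g rule: borel_measurable_induct)
    case (set B)
    have "(\<integral>\<^sup>+\<omega>. indicator (cyl L) \<omega> * indicator B (Y (tot L) \<omega>) \<partial>M) = (\<integral>\<^sup>+\<omega>. indicator (cyl (L' @ [(s, A \<inter> B)])) \<omega> \<partial>M)"
      by (intro nn_integral_cong) (auto simp: snoc sA cyl_snoc indicator_def)
    also have "\<dots> = fdd_heat L (indicator B) x"
      using L' set \<open>A \<in> sets borel\<close> by (simp add: emeasure_cyl fdd_eq_fdd_heat snoc sA)
    finally show ?case .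
  next
    case (cong f g)
    then have "f = g" by auto
    then show ?case using cong by simp
  next
    case (mult u c)
    note [measurable] = mult(2)
    have "fdd_heat L (\<lambda>y. c * u y) z = c * fdd_heat L u z" for z
      using L
    proof (induction L arbitrary: z)
      case (Cons tB L)
      then have [measurable]: "fdd_heat L u \<in> borel_measurable borel" "snd tB \<in> sets borel" by auto
      show ?case using Cons by (simp add: heat_def mult.left_commute[of _ c] nn_integral_cmult)
    qed simp
    moreover have "(\<integral>\<^sup>+\<omega>. indicator (cyl L) \<omega> * (c * u (Y (tot L) \<omega>)) \<partial>M) = c * (\<integral>\<^sup>+\<omega>. indicator (cyl L) \<omega> * u (Y (tot L) \<omega>) \<partial>M)"
      by (subst nn_integral_cmult[symmetric]) (auto simp: mult_ac)
    ultimately show ?case using mult by simp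
  next
    case (add u v)
    note [measurable] = add(1,3)
    have "fdd_heat L (\<lambda>y. v y + u y) z = fdd_heat L v z + fdd_heat L u z" for z
      using L
    proof (induction L arbitrary: z)
      case (Cons tB L)
      then have [measurable]: "fdd_heat L u \<in> borel_measurable borel" "fdd_heat L v \<in> borel_measurable borel" "snd tB \<in> sets borel" by auto
      show ?case using Cons by (simp add: heat_def distrib_left nn_integral_add)
    qed simp
    moreover have "(\<integral>\<^sup>+\<omega>. indicator (cyl L) \<omega> * (v (Y (tot L) \<omega>) + u (Y (tot L) \<omega>)) \<partial>M)
        = (\<integral>\<^sup>+\<omega>. indicator (cyl L) \<omega> * v (Y (tot L) \<omega>) \<partial>M) + (\<integral>\<^sup>+\<omega>. indicator (cyl L) \<omega> * u (Y (tot L) \<omega>) \<partial>M)"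
      by (subst nn_integral_add[symmetric]) (auto simp: distrib_left)
    ultimately show ?case using add by simp
  next
    case (seq U)
    note [measurable] = seq(1)
    have incU: "U i y \<le> U j y" if "i \<le> j" for i j y using seq(3) that by (auto simp: incseq_def le_fun_def)
    have "fdd_heat L (SUP i. U i) z = (SUP i. fdd_heat L (U i) z) \<and> incseq (\<lambda>i. fdd_heat L (U i) z)" for z
      using L
    proof (induction L arbitrary: z)
      case Nil
      then show ?case using incU by (auto simp: image_image incseq_def)
    next
      case (Cons tB L)
      then have [measurable]: "\<And>i. fdd_heat L (U i) \<in> borel_measurable borel" "snd tB \<in> sets borel" by auto
      have vL: "valid L" using Cons.prems by simp
      have IH: "fdd_heat L (SUP i. U i) y = (SUP i. fdd_heat L (U i) y)" "incseq (\<lambda>i. fdd_heat L (U i) y)" for y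
        using Cons.IH[OF vL, of y] by blast+
      have mono: "incseq (\<lambda>i y. kern p (fst tB) z y * (indicator (snd tB) y * fdd_heat L (U i) y))"
        using IH(2) by (auto simp: incseq_def le_fun_def intro!: mult_left_mono)
      have "fdd_heat (tB # L) (SUP i. U i) z = (\<integral>\<^sup>+y. (SUP i. kern p (fst tB) z y * (indicator (snd tB) y * fdd_heat L (U i) y)) \<partial>m)"
        by (simp add: heat_def IH(1) SUP_mult_left_ennreal image_image)
      also have "\<dots> = (SUP i. fdd_heat (tB # L) (U i) z)"
        using mono by (subst nn_integral_monotone_convergence_SUP) (auto simp: heat_def)
      finally have "fdd_heat (tB # L) (SUP i. U i) z = (SUP i. fdd_heat (tB # L) (U i) z)" .
      moreover have "incseq (\<lambda>i. fdd_heat (tB # L) (U i) z)"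
        using mono by (auto simp: incseq_def le_fun_def heat_def intro!: nn_integral_mono)
      ultimately show ?case by blast
    qed
    moreover have "(\<integral>\<^sup>+\<omega>. indicator (cyl L) \<omega> * (SUP i. U i) (Y (tot L) \<omega>) \<partial>M) = (SUP i. \<integral>\<^sup>+\<omega>. indicator (cyl L) \<omega> * U i (Y (tot L) \<omega>) \<partial>M)"
    proof -
      have "(\<integral>\<^sup>+\<omega>. indicator (cyl L) \<omega> * (SUP i. U i) (Y (tot L) \<omega>) \<partial>M) = (\<integral>\<^sup>+\<omega>. (SUP i. indicator (cyl L) \<omega> * U i (Y (tot L) \<omega>)) \<partial>M)"
        by (simp add: SUP_mult_left_ennreal image_image)
      also have "\<dots> = (SUP i. \<integral>\<^sup>+\<omega>. indicator (cyl L) \<omega> * U i (Y (tot L) \<omega>) \<partial>M)"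
        using incU by (intro nn_integral_monotone_convergence_SUP) (auto simp: incseq_def le_fun_def intro!: mult_left_mono)
      finally show ?thesis .
    qed
    ultimately show ?case by (simp only: seq.IH)
  qed
qed

text \<open>The Markov property tested on cylinder events only. Appending \<open>(s, UNIV)\<close>
  imposes no condition at the new time, so \<open>g\<close> is evaluated there through one more step
  of the kernel.\<close>

lemma markov:
  assumes L: "valid L" and s: "0 < s" and g[measurable]: "g \<in> borel_measurable borel"
  shows "(\<integral>\<^sup>+\<omega>. indicator (cyl L) \<omega> * g (Y (tot L + s) \<omega>) \<partial>M) = (\<integral>\<^sup>+\<omega>. indicator (cyl L) \<omega> * heat s g (Y (tot L) \<omega>) \<partial>M)"
proof -
  have "(\<integral>\<^sup>+\<omega>. indicator (cyl L) \<omega> * g (Y (tot L + s) \<omega>) \<partial>M)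
      = (\<integral>\<^sup>+\<omega>. indicator (cyl (L @ [(s, UNIV)])) \<omega> * g (Y (tot (L @ [(s, UNIV)])) \<omega>) \<partial>M)"
    by (intro nn_integral_cong) (auto simp: cyl_snoc indicator_def)
  also have "\<dots> = fdd_heat (L @ [(s, UNIV)]) g x" using L s by (intro nn_integral_cyl) auto
  also have "\<dots> = fdd_heat L (heat s g) x" 
  proof -
    have "fdd_heat [(s, UNIV)] g = heat s g" by (rule ext) simp
    then show ?thesis by (simp only: fdd_heat_append)
  qed
  also have "\<dots> = (\<integral>\<^sup>+\<omega>. indicator (cyl L) \<omega> * heat s g (Y (tot L) \<omega>) \<partial>M)"
    using L by (intro nn_integral_cyl[symmetric]) measurable
  finally show ?thesis .
qed

end

section \<open>Comparison of the renewal iterates with a supersolution\<close>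

context transition_kernel
begin

lemma heat_mono: "(\<And>y. f y \<le> g y) \<Longrightarrow> heat s f x \<le> heat s g x"
  unfolding heat_def by (intro nn_integral_mono mult_left_mono) auto

lemma heat_cmult:
  assumes [measurable]: "f \<in> borel_measurable borel"
  shows "heat s (\<lambda>y. f y * c) x = heat s f x * c"
  unfolding heat_def by (subst nn_integral_multc[symmetric]) (auto simp: mult.assoc)

text \<open>Any such \<open>G\<close> is at least 1, which starts the induction. The bound on the
  iterates is uniform in the point, so \<open>G (t - s)\<close> is a constant inside
  \<open>heat\<close> and can be taken out.\<close>

lemma iter_heat_le:
  assumes V[measurable]: "V \<in> borel_measurable borel"
    and le: "\<And>s x. 0 < s \<Longrightarrow> heat s V x \<le> b s"
    and G: "\<And>t. 0 \<le> t \<Longrightarrow> 1 + (\<integral>\<^sup>+s. indicator {0<..t} s * (b s * G (t - s)) \<partial>lborel) \<le> G t"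
    and t: "0 \<le> t"
  shows "iter_heat V K t x \<le> G t"
  using t
proof (induction K arbitrary: t x)
  case 0
  then show ?case using G[of t] by (auto intro: order_trans[rotated])
next
  case (Suc K)
  have "iter_heat V (Suc K) t x \<le> 1 + (\<integral>\<^sup>+s. indicator {0<..t} s * (b s * G (t - s)) \<partial>lborel)"
    unfolding iter_heat.simps
  proof (intro add_left_mono nn_integral_mono)
    fix s :: real
    show "indicator {0<..t} s * heat s (\<lambda>y. V y * iter_heat V K (t - s) y) x \<le> indicator {0<..t} s * (b s * G (t - s))"
    proof (cases "s \<in> {0<..t}")
      case True
      have "heat s (\<lambda>y. V y * iter_heat V K (t - s) y) x \<le> heat s (\<lambda>y. V y * G (t - s)) x"
        using True by (intro heat_mono mult_left_mono Suc.IH) auto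
      also have "\<dots> = heat s V x * G (t - s)" by (intro heat_cmult) measurable
      also have "\<dots> \<le> b s * G (t - s)" using True by (intro mult_right_mono le) auto
      finally show ?thesis using True by simp
    qed simp
  qed
  also have "\<dots> \<le> G t" using Suc.prems by (rule G)
  finally show ?case .
qed

end

section \<open>The exponential moment as supremum of the renewal iterates\<close>

context transition_paths
begin

lemma heat_eq_expectation:
  assumes [measurable]: "f \<in> borel_measurable borel" and s: "0 < s"
  shows "(\<integral>\<^sup>+\<omega>. f (Y s \<omega>) \<partial>M) = heat s f x"
proof -
  have "(\<integral>\<^sup>+\<omega>. f (Y s \<omega>) \<partial>M) = (\<integral>\<^sup>+\<omega>. indicator (cyl []) \<omega> * f (Y (tot [] + s) \<omega>) \<partial>M)"
    by (intro nn_integral_cong) auto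
  also have "\<dots> = (\<integral>\<^sup>+\<omega>. indicator (cyl []) \<omega> * heat s f (Y (tot []) \<omega>) \<partial>M)" using s by (intro markov) auto
  also have "\<dots> = (\<integral>\<^sup>+\<omega>. heat s f x \<partial>M)"
    using Y_0 by (intro nn_integral_cong_AE) (auto elim!: eventually_mono)
  finally show ?thesis by (simp add: emeasure_space_1)
qed

text \<open>Conservation of mass is inherited from the paths, whose law has total mass 1.\<close>

lemma heat_const: "0 < s \<Longrightarrow> heat s (\<lambda>_. c) x = c"
  by (subst heat_eq_expectation[symmetric]) (auto simp: emeasure_space_1)

text \<open>The semigroup property in integrated form: a bound that is uniform in the starting point
  survives averaging over the position at time \<open>s\<close>.\<close>

lemma heat_le_later:
  assumes [measurable]: "f \<in> borel_measurable borel" and s: "0 < s" "0 < r" and le: "\<And>y. heat r f y \<le> C"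
  shows "heat (s + r) f x \<le> C"
proof -
  have "heat (s + r) f x = (\<integral>\<^sup>+\<omega>. f (Y (s + r) \<omega>) \<partial>M)" using s by (intro heat_eq_expectation[symmetric]) auto
  also have "\<dots> = (\<integral>\<^sup>+\<omega>. indicator (cyl [(s, UNIV)]) \<omega> * f (Y (tot [(s, UNIV)] + r) \<omega>) \<partial>M)"
    by (intro nn_integral_cong) (auto simp: cyl_def)
  also have "\<dots> = (\<integral>\<^sup>+\<omega>. indicator (cyl [(s, UNIV)]) \<omega> * heat r f (Y (tot [(s, UNIV)]) \<omega>) \<partial>M)"
    using s by (intro markov) auto
  also have "\<dots> \<le> (\<integral>\<^sup>+\<omega>. C \<partial>M)" using le by (intro nn_integral_mono) (auto simp: indicator_def)
  finally show ?thesis by (simp add: emeasure_space_1)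
qed

definition pot :: "('a \<Rightarrow> ennreal) \<Rightarrow> real \<Rightarrow> 'w \<Rightarrow> real \<Rightarrow> ennreal" where
  "pot V t \<omega> s = V (Y s \<omega>) * (if s \<le> t then 1 else 0)"

lemma pot_measurable[measurable (raw)]:
  assumes [measurable]: "V \<in> borel_measurable borel" "s \<in> borel_measurable N" "w \<in> measurable N M"
  shows "(\<lambda>a. pot V t (w a) (s a)) \<in> borel_measurable N"
  unfolding pot_def by measurable

lemma path_iter_measurable':
  assumes [measurable]: "V \<in> borel_measurable borel"
  shows "(\<lambda>(r, \<omega>). path_iter (pot V t \<omega>) K r) \<in> borel_measurable (borel \<Otimes>\<^sub>M M)"
proof (induction K)
  case (Suc K)
  have [measurable]: "(\<lambda>b. path_iter (pot V t (snd (fst b))) K (snd b)) \<in> borel_measurable ((borel \<Otimes>\<^sub>M M) \<Otimes>\<^sub>M lborel)"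
    (is "_ \<in> borel_measurable ?N")
  proof -
    have "(\<lambda>b. (snd b, snd (fst b))) \<in> measurable ?N (borel \<Otimes>\<^sub>M M)" by measurable
    from measurable_compose[OF this Suc.IH] show ?thesis by simp
  qed
  have "(\<lambda>a. 1 + (\<integral>\<^sup>+s. pot V t (snd a) s * (if fst a < s then 1 else 0) * path_iter (pot V t (snd a)) K s \<partial>lborel)) \<in> borel_measurable (borel \<Otimes>\<^sub>M M)"
    by measurable
  also have "(\<lambda>a. 1 + (\<integral>\<^sup>+s. pot V t (snd a) s * (if fst a < s then 1 else 0) * path_iter (pot V t (snd a)) K s \<partial>lborel))
     = (\<lambda>(r, \<omega>). path_iter (pot V t \<omega>) (Suc K) r)"
    by (auto intro!: ext nn_integral_cong arg_cong[where f="\<lambda>z. 1 + z"] simp: indicator_def)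
  finally show ?case .
qed simp

lemma path_iter_measurable[measurable (raw)]:
  assumes "V \<in> borel_measurable borel" and [measurable]: "r \<in> borel_measurable N" "w \<in> measurable N M"
  shows "(\<lambda>a. path_iter (pot V t (w a)) K (r a)) \<in> borel_measurable N"
proof -
  have "(\<lambda>a. (r a, w a)) \<in> measurable N (borel \<Otimes>\<^sub>M M)" by measurable
  from measurable_compose[OF this path_iter_measurable'[OF assms(1)]] show ?thesis by simp
qed

text \<open>The induction runs over all cylinders at once. The outermost time integral is exchanged
  with the expectation; at its time \<open>s\<close> the induction hypothesis, for the cylinder
  prolonged to \<open>s\<close>, replaces the rest of the path by a function of \<open>Y s\<close>,
  and the Markov property carries that back to time \<open>tot L\<close>.\<close>

lemma path_iter_cyl:
  assumes V[measurable]: "V \<in> borel_measurable borel" and L: "valid L"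
  shows "(\<integral>\<^sup>+\<omega>. indicator (cyl L) \<omega> * path_iter (pot V t \<omega>) K (tot L) \<partial>M)
       = (\<integral>\<^sup>+\<omega>. indicator (cyl L) \<omega> * iter_heat V K (t - tot L) (Y (tot L) \<omega>) \<partial>M)"
  using L
proof (induction K arbitrary: L)
  case (Suc K)
  note L = \<open>valid L\<close> and [measurable] = cyl_measurable[OF \<open>valid L\<close>]
  interpret pair_sigma_finite M lborel ..
  define \<sigma> where "\<sigma> = tot L"
  let ?c = "indicator (cyl L) :: 'w \<Rightarrow> ennreal"
  let ?J = "\<lambda>\<omega> s. path_iter (pot V t \<omega>) K s"
  let ?S = "\<lambda>s y. V y * iter_heat V K (t - s) y"
  have step: "(\<integral>\<^sup>+\<omega>. ?c \<omega> * (pot V t \<omega> s * (if \<sigma> < s then 1 else 0) * ?J \<omega> s) \<partial>M)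
      = (\<integral>\<^sup>+\<omega>. ?c \<omega> * ((if \<sigma> < s \<and> s \<le> t then 1 else 0) * heat (s - \<sigma>) (?S s) (Y \<sigma> \<omega>)) \<partial>M)" for s
  proof (cases "\<sigma> < s \<and> s \<le> t")
    case True
    have "(\<integral>\<^sup>+\<omega>. ?c \<omega> * (pot V t \<omega> s * (if \<sigma> < s then 1 else 0) * ?J \<omega> s) \<partial>M) = (\<integral>\<^sup>+\<omega>. (?c \<omega> * ?J \<omega> s) * V (Y s \<omega>) \<partial>M)"
      using True by (intro nn_integral_cong) (auto simp: pot_def mult_ac)
    \<comment> \<open>With the indicator of \<open>A\<close> in place of \<open>V\<close>, this is
      the induction hypothesis for \<open>L @ [(s - \<sigma>, A)]\<close>; this is why arbitrary
      sets are carried in the cylinders.\<close>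
    also have "\<dots> = (\<integral>\<^sup>+\<omega>. (?c \<omega> * iter_heat V K (t - s) (Y s \<omega>)) * V (Y s \<omega>) \<partial>M)"
    proof (rule nn_integral_eq_of_indicators[where N=borel and Y="Y s" and f=V
          and F="\<lambda>\<omega>. ?c \<omega> * ?J \<omega> s" and G="\<lambda>\<omega>. ?c \<omega> * iter_heat V K (t - s) (Y s \<omega>)"])
      fix A :: "'a set" assume A: "A \<in> sets borel"
      have ind: "?c \<omega> * z * indicator A (Y s \<omega>) = indicator (cyl (L @ [(s - \<sigma>, A)])) \<omega> * z"
        if "\<omega> \<in> space M" for \<omega> z
        using that by (auto simp: cyl_snoc indicator_def \<sigma>_def)
      have "(\<integral>\<^sup>+\<omega>. ?c \<omega> * ?J \<omega> s * indicator A (Y s \<omega>) \<partial>M)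
          = (\<integral>\<^sup>+\<omega>. indicator (cyl (L @ [(s - \<sigma>, A)])) \<omega> * path_iter (pot V t \<omega>) K (tot (L @ [(s - \<sigma>, A)])) \<partial>M)"
        by (intro nn_integral_cong) (simp only: ind, simp add: \<sigma>_def)
      also have "\<dots> = (\<integral>\<^sup>+\<omega>. indicator (cyl (L @ [(s - \<sigma>, A)])) \<omega> * iter_heat V K (t - tot (L @ [(s - \<sigma>, A)])) (Y (tot (L @ [(s - \<sigma>, A)])) \<omega>) \<partial>M)"
        using L True A by (intro Suc.IH) auto
      also have "\<dots> = (\<integral>\<^sup>+\<omega>. ?c \<omega> * iter_heat V K (t - s) (Y s \<omega>) * indicator A (Y s \<omega>) \<partial>M)"
        by (intro nn_integral_cong) (simp only: ind, simp add: \<sigma>_def)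
      finally show "(\<integral>\<^sup>+\<omega>. ?c \<omega> * ?J \<omega> s * indicator A (Y s \<omega>) \<partial>M) = (\<integral>\<^sup>+\<omega>. ?c \<omega> * iter_heat V K (t - s) (Y s \<omega>) * indicator A (Y s \<omega>) \<partial>M)" .
    qed measurable
    also have "\<dots> = (\<integral>\<^sup>+\<omega>. ?c \<omega> * ?S s (Y (tot L + (s - \<sigma>)) \<omega>) \<partial>M)"
      by (intro nn_integral_cong) (simp add: \<sigma>_def mult_ac)
    also have "\<dots> = (\<integral>\<^sup>+\<omega>. ?c \<omega> * heat (s - \<sigma>) (?S s) (Y (tot L) \<omega>) \<partial>M)"
      using L True by (intro markov) auto
    finally show ?thesis using True by (simp add: \<sigma>_def)
  next
    case False
    then have "(\<integral>\<^sup>+\<omega>. ?c \<omega> * (pot V t \<omega> s * (if \<sigma> < s then 1 else 0) * ?J \<omega> s) \<partial>M) = 0"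
      by (auto simp: pot_def)
    then show ?thesis using False by auto
  qed
  have "(\<integral>\<^sup>+\<omega>. ?c \<omega> * path_iter (pot V t \<omega>) (Suc K) \<sigma> \<partial>M)
      = (\<integral>\<^sup>+\<omega>. ?c \<omega> + (\<integral>\<^sup>+s. ?c \<omega> * (pot V t \<omega> s * (if \<sigma> < s then 1 else 0) * ?J \<omega> s) \<partial>lborel) \<partial>M)"
  proof (intro nn_integral_cong)
    fix \<omega> assume [measurable]: "\<omega> \<in> space M"
    have "(\<integral>\<^sup>+s. ?c \<omega> * (pot V t \<omega> s * (if \<sigma> < s then 1 else 0) * ?J \<omega> s) \<partial>lborel)
       = ?c \<omega> * (\<integral>\<^sup>+s. pot V t \<omega> s * (if \<sigma> < s then 1 else 0) * ?J \<omega> s \<partial>lborel)"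
      by (intro nn_integral_cmult) measurable
    moreover have "(\<integral>\<^sup>+s. pot V t \<omega> s * (if \<sigma> < s then 1 else 0) * ?J \<omega> s \<partial>lborel) = (\<integral>\<^sup>+s. pot V t \<omega> s * indicator {\<sigma><..} s * ?J \<omega> s \<partial>lborel)"
      by (intro nn_integral_cong) (auto simp: indicator_def)
    ultimately show "?c \<omega> * path_iter (pot V t \<omega>) (Suc K) \<sigma> = ?c \<omega> + (\<integral>\<^sup>+s. ?c \<omega> * (pot V t \<omega> s * (if \<sigma> < s then 1 else 0) * ?J \<omega> s) \<partial>lborel)"
      by (simp add: distrib_left)
  qed
  also have "\<dots> = (\<integral>\<^sup>+\<omega>. ?c \<omega> \<partial>M) + (\<integral>\<^sup>+\<omega>. \<integral>\<^sup>+s. ?c \<omega> * (pot V t \<omega> s * (if \<sigma> < s then 1 else 0) * ?J \<omega> s) \<partial>lborel \<partial>M)"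
    by (intro nn_integral_add) measurable
  also have "(\<integral>\<^sup>+\<omega>. \<integral>\<^sup>+s. ?c \<omega> * (pot V t \<omega> s * (if \<sigma> < s then 1 else 0) * ?J \<omega> s) \<partial>lborel \<partial>M)
      = (\<integral>\<^sup>+s. \<integral>\<^sup>+\<omega>. ?c \<omega> * (pot V t \<omega> s * (if \<sigma> < s then 1 else 0) * ?J \<omega> s) \<partial>M \<partial>lborel)"
    by (intro Fubini'[symmetric]) measurable
  also have "\<dots> = (\<integral>\<^sup>+s. \<integral>\<^sup>+\<omega>. ?c \<omega> * ((if \<sigma> < s \<and> s \<le> t then 1 else 0) * heat (s - \<sigma>) (?S s) (Y \<sigma> \<omega>)) \<partial>M \<partial>lborel)"
    by (simp only: step)
  also have "\<dots> = (\<integral>\<^sup>+\<omega>. \<integral>\<^sup>+s. ?c \<omega> * ((if \<sigma> < s \<and> s \<le> t then 1 else 0) * heat (s - \<sigma>) (?S s) (Y \<sigma> \<omega>)) \<partial>lborel \<partial>M)"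
    by (intro Fubini') measurable
  also have "(\<integral>\<^sup>+\<omega>. ?c \<omega> \<partial>M) + \<dots> = (\<integral>\<^sup>+\<omega>. ?c \<omega> + (\<integral>\<^sup>+s. ?c \<omega> * ((if \<sigma> < s \<and> s \<le> t then 1 else 0) * heat (s - \<sigma>) (?S s) (Y \<sigma> \<omega>)) \<partial>lborel) \<partial>M)"
    by (intro nn_integral_add[symmetric]) measurable
  also have "\<dots> = (\<integral>\<^sup>+\<omega>. ?c \<omega> * iter_heat V (Suc K) (t - \<sigma>) (Y \<sigma> \<omega>) \<partial>M)"
  proof (intro nn_integral_cong)
    fix \<omega> assume [measurable]: "\<omega> \<in> space M"
    have "(\<integral>\<^sup>+s. ?c \<omega> * ((if \<sigma> < s \<and> s \<le> t then 1 else 0) * heat (s - \<sigma>) (?S s) (Y \<sigma> \<omega>)) \<partial>lborel)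
       = ?c \<omega> * (\<integral>\<^sup>+s. (if \<sigma> < s \<and> s \<le> t then 1 else 0) * heat (s - \<sigma>) (?S s) (Y \<sigma> \<omega>) \<partial>lborel)"
      by (intro nn_integral_cmult) measurable
    also have "(\<integral>\<^sup>+s. (if \<sigma> < s \<and> s \<le> t then 1 else 0) * heat (s - \<sigma>) (?S s) (Y \<sigma> \<omega>) \<partial>lborel)
       = (\<integral>\<^sup>+u. (if \<sigma> < \<sigma> + 1 * u \<and> \<sigma> + 1 * u \<le> t then 1 else 0) * heat (\<sigma> + 1 * u - \<sigma>) (?S (\<sigma> + 1 * u)) (Y \<sigma> \<omega>) \<partial>lborel)"
      by (subst nn_integral_real_affine[of _ 1 \<sigma>]) auto
    also have "\<dots> = (\<integral>\<^sup>+u. indicator {0<..t - \<sigma>} u * heat u (\<lambda>y. V y * iter_heat V K (t - \<sigma> - u) y) (Y \<sigma> \<omega>) \<partial>lborel)"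
      by (intro nn_integral_cong) (auto simp: indicator_def diff_diff_eq)
    finally show "?c \<omega> + (\<integral>\<^sup>+s. ?c \<omega> * ((if \<sigma> < s \<and> s \<le> t then 1 else 0) * heat (s - \<sigma>) (?S s) (Y \<sigma> \<omega>)) \<partial>lborel)
      = ?c \<omega> * iter_heat V (Suc K) (t - \<sigma>) (Y \<sigma> \<omega>)"
      by (simp add: distrib_left)
  qed
  finally show ?case by (simp only: \<sigma>_def)
qed simp

lemma exponential_moment_eq:
  assumes V[measurable]: "V \<in> borel_measurable borel"
  shows "(\<integral>\<^sup>+\<omega>. ennexp (\<integral>\<^sup>+s. V (Y s \<omega>) * indicator {0..t} s \<partial>lborel) \<partial>M) = (SUP K. iter_heat V K t x)"
proof -
  have "(\<integral>\<^sup>+\<omega>. ennexp (\<integral>\<^sup>+s. V (Y s \<omega>) * indicator {0..t} s \<partial>lborel) \<partial>M) = (\<integral>\<^sup>+\<omega>. (SUP K. path_iter (pot V t \<omega>) K 0) \<partial>M)"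
  proof (intro nn_integral_cong)
    fix \<omega> assume [measurable]: "\<omega> \<in> space M"
    have "(\<integral>\<^sup>+s. V (Y s \<omega>) * indicator {0..t} s \<partial>lborel) = (\<integral>\<^sup>+s. pot V t \<omega> s * indicator {0<..} s \<partial>lborel)"
      by (intro nn_integral_cong_AE) (use AE_lborel_singleton[of 0] in eventually_elim, auto simp: pot_def indicator_def)
    moreover have "pot V t \<omega> \<in> borel_measurable borel" by measurable
    ultimately show "ennexp (\<integral>\<^sup>+s. V (Y s \<omega>) * indicator {0..t} s \<partial>lborel) = (SUP K. path_iter (pot V t \<omega>) K 0)"
      by (simp add: path_iter_SUP)
  qed
  also have "\<dots> = (SUP K. \<integral>\<^sup>+\<omega>. path_iter (pot V t \<omega>) K 0 \<partial>M)"
  proof (intro nn_integral_monotone_convergence_SUP_AE AE_I2)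
    fix K \<omega> assume [measurable]: "\<omega> \<in> space M"
    have "pot V t \<omega> \<in> borel_measurable borel" by measurable
    then show "path_iter (pot V t \<omega>) K 0 \<le> path_iter (pot V t \<omega>) (Suc K) 0"
      by (simp only: path_iter_eq) simp
  qed measurable
  also have "\<dots> = (SUP K. iter_heat V K t x)"
  proof (intro SUP_cong refl)
    fix K
    have "(\<integral>\<^sup>+\<omega>. path_iter (pot V t \<omega>) K 0 \<partial>M) = (\<integral>\<^sup>+\<omega>. indicator (cyl []) \<omega> * path_iter (pot V t \<omega>) K (tot []) \<partial>M)"
      by (intro nn_integral_cong) auto
    also have "\<dots> = (\<integral>\<^sup>+\<omega>. indicator (cyl []) \<omega> * iter_heat V K (t - tot []) (Y (tot []) \<omega>) \<partial>M)"
      by (intro path_iter_cyl) auto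
    also have "\<dots> = (\<integral>\<^sup>+\<omega>. iter_heat V K t x \<partial>M)"
      using Y_0 by (intro nn_integral_cong_AE) (auto elim!: eventually_mono)
    finally show "(\<integral>\<^sup>+\<omega>. path_iter (pot V t \<omega>) K 0 \<partial>M) = iter_heat V K t x" by (simp add: emeasure_space_1)
  qed
  finally show ?thesis .
qed

end

text \<open>The process is measurable at each fixed time only, while exchanging time integral and
  expectation needs joint measurability. Outside a measurable null set \<open>N\<close> containing
  the bad paths, values are limits along dyadic times. On \<open>N\<close> the path is frozen at
  \<open>x\<close>, and negative times are sent to 0.\<close>

lemma (in prob_space) measurable_version_exists:
  fixes X :: "real \<Rightarrow> 'a \<Rightarrow> 'b::polish_space"
  assumes X[measurable]: "\<And>t. 0 \<le> t \<Longrightarrow> X t \<in> borel_measurable M"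
    and cont: "AE \<omega> in M. X 0 \<omega> = x \<and> continuous_on {0..} (\<lambda>t. X t \<omega>)"
  obtains Y where "(\<lambda>(s, \<omega>). Y s \<omega>) \<in> measurable (borel \<Otimes>\<^sub>M M) borel" "AE \<omega> in M. Y 0 \<omega> = x"
    "AE \<omega> in M. \<forall>s\<ge>0. Y s \<omega> = X s \<omega>"
proof -
  obtain N where N: "{\<omega> \<in> space M. \<not> (X 0 \<omega> = x \<and> continuous_on {0..} (\<lambda>t. X t \<omega>))} \<subseteq> N" "emeasure M N = 0" "N \<in> sets M"
    using cont by (rule AE_E)
  note [measurable] = N(3)
  define Y where "Y = (\<lambda>s \<omega>. if \<omega> \<in> N then x else X (max 0 s) \<omega>)"
  have Ym[measurable]: "Y s \<in> borel_measurable M" for s unfolding Y_def by measurable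
  have "(\<lambda>z. Y (fst z) (snd z)) \<in> measurable (borel \<Otimes>\<^sub>M M) borel"
  proof (rule borel_measurable_LIMSEQ_metric)
    fix i :: nat
    show "(\<lambda>z::real \<times> 'a. Y (real_of_int \<lfloor>fst z * 2 ^ i\<rfloor> / 2 ^ i) (snd z)) \<in> borel_measurable (borel \<Otimes>\<^sub>M M)"
      by (rule measurable_compose_countable[where f="\<lambda>j z. Y (real_of_int j / 2 ^ i) (snd z)" and g="\<lambda>z. \<lfloor>fst z * 2 ^ i\<rfloor>"]) measurable
  next
    fix z :: "real \<times> 'a" assume z: "z \<in> space (borel \<Otimes>\<^sub>M M)"
    have lim: "(\<lambda>i. real_of_int \<lfloor>fst z * 2 ^ i\<rfloor> / 2 ^ i) \<longlonglongrightarrow> fst z"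
    proof (rule tendsto_sandwich)
      show "(\<lambda>i. fst z - (1 / 2) ^ i) \<longlonglongrightarrow> fst z"
        by (rule tendsto_eq_intros LIMSEQ_power_zero | simp)+
      show "\<forall>\<^sub>F i in sequentially. fst z - (1 / 2) ^ i \<le> real_of_int \<lfloor>fst z * 2 ^ i\<rfloor> / 2 ^ i"
      proof (intro always_eventually allI)
        fix i :: nat
        have "fst z * 2 ^ i - 1 \<le> real_of_int \<lfloor>fst z * 2 ^ i\<rfloor>" by linarith
        then have "(fst z * 2 ^ i - 1) / 2 ^ i \<le> real_of_int \<lfloor>fst z * 2 ^ i\<rfloor> / 2 ^ i" by (intro divide_right_mono) auto
        then show "fst z - (1 / 2) ^ i \<le> real_of_int \<lfloor>fst z * 2 ^ i\<rfloor> / 2 ^ i" by (simp add: diff_divide_distrib power_divide)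
      qed
      show "\<forall>\<^sub>F i in sequentially. real_of_int \<lfloor>fst z * 2 ^ i\<rfloor> / 2 ^ i \<le> fst z"
        by (intro always_eventually allI) (simp add: divide_le_eq)
    qed simp
    show "(\<lambda>i. Y (real_of_int \<lfloor>fst z * 2 ^ i\<rfloor> / 2 ^ i) (snd z)) \<longlonglongrightarrow> Y (fst z) (snd z)"
    proof (cases "snd z \<in> N")
      case True then show ?thesis by (simp add: Y_def)
    next
      case False
      then have c: "continuous_on {0..} (\<lambda>t. X t (snd z))" using N(1) z by (auto simp: space_pair_measure)
      have "continuous_on UNIV (\<lambda>s. X (max 0 s) (snd z))"
        by (rule continuous_on_compose2[OF c]) (auto intro!: continuous_intros)
      then have "isCont (\<lambda>s. X (max 0 s) (snd z)) (fst z)" by (simp add: continuous_on_eq_continuous_at)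
      from isCont_tendsto_compose[OF this lim] show ?thesis using False by (simp add: Y_def)
    qed
  qed
  then have 1: "(\<lambda>(s, \<omega>). Y s \<omega>) \<in> measurable (borel \<Otimes>\<^sub>M M) borel" by (simp add: split_beta')
  have "AE \<omega> in M. \<omega> \<notin> N" using N by (intro AE_not_in) auto
  then have 2: "AE \<omega> in M. \<forall>s\<ge>0. Y s \<omega> = X s \<omega>" by eventually_elim (simp add: Y_def)
  have 3: "AE \<omega> in M. Y 0 \<omega> = x" using 2 cont by eventually_elim auto
  show ?thesis using 1 2 3 that by blast
qed

section \<open>Supersolution and conclusion\<close>

text \<open>Dropping the factor \<open>exp (- r s / \<tau>)\<close> on the singular part of the kernel leaves an estimate that is
  affine in \<open>exp (- r t / \<tau>)\<close>; the hypotheses on \<open>A\<close> and \<open>B\<close> are its two endpoint cases.\<close>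
lemma exponential_supersolution:
  fixes f :: "real \<Rightarrow> real" and r \<tau> v0 A B t :: real
  assumes r: "0 < r" and \<tau>: "0 < \<tau>" and t: "0 \<le> t" and v0: "0 < v0" and B: "0 \<le> B"
    and f[measurable]: "f \<in> borel_measurable borel" and fB: "\<And>v. 0 < v \<Longrightarrow> v \<le> v0 \<Longrightarrow> B \<le> f v"
    and int: "(f has_integral (A + B * v0)) {0..v0}"
    and A1: "A \<le> 1" and AB: "A + B / r \<le> 1 / (1 - exp (- r))"
  defines "G \<equiv> \<lambda>t. ennreal (exp (r * (t / \<tau> + 1)))"
  defines "b \<equiv> \<lambda>s. ennreal ((1 - exp (- r)) / \<tau> * (if s < v0 * \<tau> then f (s / \<tau>) else B))"
  shows "1 + (\<integral>\<^sup>+s. indicator {0<..t} s * (b s * G (t - s)) \<partial>lborel) \<le> G t"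
proof -
  define E where "E = 1 - exp (- r)"
  have E: "0 < E" "E < 1" using r by (auto simp: E_def)
  define H where "H = exp (r * (t / \<tau> + 1))"
  have H: "0 < H" by (simp add: H_def)
  \<comment> \<open>Since \<open>H * exp (- r) * \<epsilon> = 1\<close>, division by
    \<open>H\<close> turns the claim into an affine inequality in \<open>\<epsilon>\<close> on
    \<open>[0, 1]\<close>.\<close>
  define \<epsilon> where "\<epsilon> = exp (- (r / \<tau>) * t)"
  have \<epsilon>: "0 < \<epsilon>" "\<epsilon> \<le> 1" using r \<tau> t by (auto simp: \<epsilon>_def)
  have intA: "((\<lambda>v. f v - B) has_integral A) {0<..<v0}"
  proof -
    have "((\<lambda>v. B) has_integral B * v0) {0..v0}" using has_integral_const_real[of B 0 v0] v0 by (simp add: mult.commute)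
    from has_integral_diff[OF int this] show ?thesis by (simp add: has_integral_Icc_iff_Ioo)
  qed
  have A0: "0 \<le> A" using fB by (intro has_integral_nonneg[OF intA]) auto
  have nnA: "(\<integral>\<^sup>+v. ennreal (f v - B) * indicator {0<..<v0} v \<partial>lborel) = ennreal A"
    using fB by (intro nn_integral_has_integral_lebesgue' intA) auto
  have I1: "(\<integral>\<^sup>+s. (if 0 < s \<and> s < v0 * \<tau> then ennreal (f (s / \<tau>) - B) else 0) \<partial>lborel) = ennreal (\<tau> * A)"
  proof -
    have "(\<integral>\<^sup>+s. (if 0 < s \<and> s < v0 * \<tau> then ennreal (f (s / \<tau>) - B) else 0) \<partial>lborel)
       = \<tau> * (\<integral>\<^sup>+v. (if 0 < 0 + \<tau> * v \<and> 0 + \<tau> * v < v0 * \<tau> then ennreal (f ((0 + \<tau> * v) / \<tau>) - B) else 0) \<partial>lborel)"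
      using \<tau> by (subst nn_integral_real_affine[of _ \<tau> 0]) auto
    also have "(\<integral>\<^sup>+v. (if 0 < 0 + \<tau> * v \<and> 0 + \<tau> * v < v0 * \<tau> then ennreal (f ((0 + \<tau> * v) / \<tau>) - B) else 0) \<partial>lborel)
       = (\<integral>\<^sup>+v. ennreal (f v - B) * indicator {0<..<v0} v \<partial>lborel)"
      using \<tau> by (intro nn_integral_cong) (auto simp: indicator_def zero_less_mult_iff mult.commute)
    finally show ?thesis using \<tau> by (simp add: nnA ennreal_mult')
  qed
  have I2: "(\<integral>\<^sup>+s. ennreal (exp (- (r / \<tau>) * s)) * indicator {0..t} s \<partial>lborel) = ennreal (\<tau> / r * (1 - \<epsilon>))"
  proof -
    have "((\<lambda>s. exp (- (r / \<tau>) * s)) has_integral (- (\<tau> / r) * exp (- (r / \<tau>) * t) - (- (\<tau> / r) * exp (- (r / \<tau>) * 0)))) {0..t}"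
      using r \<tau> t by (intro fundamental_theorem_of_calculus)
        (auto intro!: derivative_eq_intros simp: has_real_derivative_iff_has_vector_derivative[symmetric])
    also have "- (\<tau> / r) * exp (- (r / \<tau>) * t) - (- (\<tau> / r) * exp (- (r / \<tau>) * 0)) = \<tau> / r * (1 - \<epsilon>)"
      by (simp add: \<epsilon>_def algebra_simps)
    finally show ?thesis by (intro nn_integral_has_integral_lebesgue') auto
  qed
  have "(\<integral>\<^sup>+s. indicator {0<..t} s * (b s * G (t - s)) \<partial>lborel)
     \<le> (\<integral>\<^sup>+s. ennreal (E / \<tau> * H) * (ennreal B * (ennreal (exp (- (r / \<tau>) * s)) * indicator {0..t} s)
          + (if 0 < s \<and> s < v0 * \<tau> then ennreal (f (s / \<tau>) - B) else 0)) \<partial>lborel)"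
  proof (intro nn_integral_mono)
    fix s :: real
    show "indicator {0<..t} s * (b s * G (t - s)) \<le> ennreal (E / \<tau> * H) * (ennreal B * (ennreal (exp (- (r / \<tau>) * s)) * indicator {0..t} s)
          + (if 0 < s \<and> s < v0 * \<tau> then ennreal (f (s / \<tau>) - B) else 0))"
    proof (cases "0 < s \<and> s \<le> t")
      case True
      define e where "e = exp (- (r / \<tau>) * s)"
      have e: "0 < e" "e \<le> 1" using True r \<tau> by (auto simp: e_def)
      have G: "G (t - s) = ennreal (H * e)"
        using \<tau> by (simp add: G_def H_def e_def exp_add[symmetric] field_simps)
      define w where "w = (if s < v0 * \<tau> then f (s / \<tau>) - B else 0)"
      have w: "0 \<le> w" using True \<tau> fB[of "s / \<tau>"] by (auto simp: w_def field_simps)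
      have "b s = ennreal (E / \<tau> * (B + w))" by (auto simp: b_def E_def w_def)
      then have "b s * G (t - s) = ennreal (E / \<tau> * (B + w) * (H * e))"
        using E \<tau> B w by (simp only: G) (intro ennreal_mult'[symmetric] mult_nonneg_nonneg add_nonneg_nonneg divide_nonneg_pos, auto)
      also have "E / \<tau> * (B + w) * (H * e) = E / \<tau> * H * (B * e + w * e)" by (simp add: algebra_simps add_divide_distrib)
      also have "ennreal \<dots> \<le> ennreal (E / \<tau> * H * (B * e + w))"
        using E \<tau> H w e by (intro ennreal_leI mult_left_mono add_left_mono) (auto simp: mult_left_le)
      also have "\<dots> = ennreal (E / \<tau> * H) * ennreal (B * e + w)" using E \<tau> H by (intro ennreal_mult') auto
      also have "ennreal (B * e + w) = ennreal B * (ennreal e * indicator {0..t} s) + ennreal w"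
        using B e w True by (simp add: ennreal_mult)
      finally show ?thesis using True by (auto simp: e_def w_def)
    qed auto
  qed
  also have "\<dots> = ennreal (E / \<tau> * H) * (ennreal B * ennreal (\<tau> / r * (1 - \<epsilon>)) + ennreal (\<tau> * A))"
    by (subst nn_integral_cmult, measurable, subst nn_integral_add, measurable, subst nn_integral_cmult, measurable) (simp only: I1 I2)
  also have "\<dots> = ennreal (E * H * (A + B * (1 - \<epsilon>) / r))"
  proof -
    have "ennreal B * ennreal (\<tau> / r * (1 - \<epsilon>)) + ennreal (\<tau> * A) = ennreal (B * (\<tau> / r * (1 - \<epsilon>)) + \<tau> * A)"
      using B \<tau> r \<epsilon> A0 by (simp add: ennreal_mult'[symmetric] ennreal_plus[symmetric] del: ennreal_plus)
    moreover have "ennreal (E / \<tau> * H) * ennreal (B * (\<tau> / r * (1 - \<epsilon>)) + \<tau> * A) = ennreal (E / \<tau> * H * (B * (\<tau> / r * (1 - \<epsilon>)) + \<tau> * A))"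
      using E \<tau> H by (intro ennreal_mult'[symmetric]) auto
    moreover have "E / \<tau> * H * (B * (\<tau> / r * (1 - \<epsilon>)) + \<tau> * A) = E * H * (A + B * (1 - \<epsilon>) / r)"
      using \<tau> r by (simp add: field_simps)
    ultimately show ?thesis by simp
  qed
  also have "1 + \<dots> = ennreal (1 + E * H * (A + B * (1 - \<epsilon>) / r))"
    using E H A0 B \<epsilon> r by (subst ennreal_plus) auto
  also have "\<dots> \<le> G t"
  proof -
    have "E * (A + B * (1 - \<epsilon>) / r) = \<epsilon> * (E * A) + (1 - \<epsilon>) * (E * (A + B / r))"
      using r by (simp add: field_simps)
    also have "\<dots> \<le> \<epsilon> * E + (1 - \<epsilon>) * 1"
    proof (intro add_mono mult_left_mono)
      show "E * A \<le> E" using E A1 by (simp add: mult_left_le)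
      show "E * (A + B / r) \<le> 1" using AB E by (simp add: E_def field_simps)
    qed (use \<epsilon> in auto)
    also have "\<dots> = 1 - exp (- r) * \<epsilon>" by (simp add: E_def algebra_simps)
    finally have "H * (E * (A + B * (1 - \<epsilon>) / r)) \<le> H * (1 - exp (- r) * \<epsilon>)" using H by (intro mult_left_mono) auto
    moreover have "H * (exp (- r) * \<epsilon>) = 1" by (simp add: H_def \<epsilon>_def exp_add[symmetric] algebra_simps)
    ultimately have "1 + E * H * (A + B * (1 - \<epsilon>) / r) \<le> H" by (simp add: algebra_simps)
    then show ?thesis unfolding G_def H_def by (intro ennreal_leI)
  qed
  finally show ?thesis by (simp add: add_left_mono)
qed

section \<open>From the given heat kernel and diffusion to the abstract setting\<close>

lemma loc_holder_on_imp_continuous_on: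
  assumes "loc_holder_on F S" shows "continuous_on S F"
  unfolding continuous_on_def
proof
  fix z assume z: "z \<in> S"
  obtain r \<alpha> C where r: "0 < r" "0 < \<alpha>"
    and h: "\<And>z1 z2. z1 \<in> S \<inter> ball z r \<Longrightarrow> z2 \<in> S \<inter> ball z r \<Longrightarrow> \<bar>F z1 - F z2\<bar> \<le> C * dist z1 z2 powr \<alpha>"
    using assms z unfolding loc_holder_on_def by blast
  have "((\<lambda>y. F y - F z) \<longlongrightarrow> 0) (at z within S)"
  proof (rule Lim_null_comparison)
    have "\<forall>\<^sub>F y in at z within S. dist y z < r" using r eventually_at by blast
    then have "\<forall>\<^sub>F y in at z within S. dist y z < r \<and> y \<in> S" by (simp add: eventually_at_filter eventually_conj_iff)
    then show "\<forall>\<^sub>F y in at z within S. norm (F y - F z) \<le> C * dist y z powr \<alpha>"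
      by eventually_elim (use h z r in \<open>auto simp: dist_commute\<close>)
    have "((\<lambda>y. dist y z) \<longlongrightarrow> dist z z) (at z within S)" by (intro tendsto_intros)
    then have "((\<lambda>y. C * dist y z powr \<alpha>) \<longlongrightarrow> C * 0 powr \<alpha>) (at z within S)"
      using r by (intro tendsto_mult tendsto_const tendsto_powr2) auto
    then show "((\<lambda>y. C * dist y z powr \<alpha>) \<longlongrightarrow> 0) (at z within S)" by simp
  qed
  then show "(F \<longlongrightarrow> F z) (at z within S)" by (simp add: Lim_null[symmetric])
qed

text \<open>The kernel is continuous on an open set and extended by 0. Separability identifies the
  Borel sets of the product with the product sigma-algebra.\<close>

lemma kern_measurable_of_loc_holder:
  fixes p :: "real \<Rightarrow> 'a::polish_space \<Rightarrow> 'a \<Rightarrow> real"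
  assumes "loc_holder_on (\<lambda>(x, y, t). p t x y) (UNIV \<times> UNIV \<times> {0<..})"
  shows "(\<lambda>(s, x, y). kern p s x y) \<in> borel_measurable (borel \<Otimes>\<^sub>M borel \<Otimes>\<^sub>M borel)"
proof -
  let ?S = "UNIV \<times> UNIV \<times> {0<..} :: ('a \<times> 'a \<times> real) set" and ?F = "\<lambda>(x, y, t). p t x y"
  have "?S \<in> sets borel" by (intro borel_open open_Times) auto
  then have "(\<lambda>w. indicator ?S w *\<^sub>R ?F w) \<in> borel_measurable borel"
    by (intro borel_measurable_continuous_on_indicator loc_holder_on_imp_continuous_on assms)
  moreover have "(\<lambda>(s, x, y). (x, y, s)) \<in> (borel :: real measure) \<Otimes>\<^sub>M (borel :: 'a measure) \<Otimes>\<^sub>M (borel :: 'a measure) \<rightarrow>\<^sub>M borel"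
    unfolding borel_prod[symmetric] by measurable
  ultimately have "(\<lambda>z. indicator ?S ((\<lambda>(s, x, y). (x, y, s)) z) *\<^sub>R ?F ((\<lambda>(s, x, y). (x, y, s)) z))
      \<in> borel_measurable (borel \<Otimes>\<^sub>M borel \<Otimes>\<^sub>M borel)"
    by (rule measurable_compose_rev)
  then have "(\<lambda>z. ennreal (indicator ?S ((\<lambda>(s, x, y). (x, y, s)) z) *\<^sub>R ?F ((\<lambda>(s, x, y). (x, y, s)) z)))
      \<in> borel_measurable (borel \<Otimes>\<^sub>M borel \<Otimes>\<^sub>M borel)" by measurable
  also have "(\<lambda>z. ennreal (indicator ?S ((\<lambda>(s, x, y). (x, y, s)) z) *\<^sub>R ?F ((\<lambda>(s, x, y). (x, y, s)) z))) = (\<lambda>(s, x, y). kern p s x y)"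
    by (auto simp: kern_def indicator_def)
  finally show ?thesis .
qed

text \<open>The measurable version agrees almost surely with the process at all nonnegative times,
  so it has the same finite-dimensional distributions.\<close>

lemma canonical_diffusion_paths:
  fixes m :: "'a::polish_space measure"
  assumes K: "transition_kernel m p" and diff: "canonical_diffusion m p P X" and x: "x \<in> msupp m"
  obtains Y where "transition_paths m p (P x) Y x" "AE \<omega> in P x. \<forall>s\<ge>0. Y s \<omega> = X s \<omega>"
proof -
  interpret transition_kernel m p by fact
  have d: "prob_space (P x)" "\<And>t. 0 \<le> t \<Longrightarrow> X t \<in> borel_measurable (P x)"
    "AE \<omega> in P x. X 0 \<omega> = x \<and> continuous_on {0..} (\<lambda>t. X t \<omega>)"
    "\<And>L. (\<forall>(s, A)\<in>set L. s > 0 \<and> A \<in> sets borel) \<Longrightarrow>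
       emeasure (P x) {\<omega> \<in> space (P x). \<forall>i<length L. X (sum_list (map fst (take (Suc i) L))) \<omega> \<in> snd (L ! i)} = fdd m p L x"
    using diff x unfolding canonical_diffusion_def by blast+
  interpret prob_space "P x" by fact
  obtain Y where Y: "(\<lambda>(s, \<omega>). Y s \<omega>) \<in> measurable (borel \<Otimes>\<^sub>M P x) borel" "AE \<omega> in P x. Y 0 \<omega> = x"
    "AE \<omega> in P x. \<forall>s\<ge>0. Y s \<omega> = X s \<omega>"
    using measurable_version_exists[of X x] d by blast
  have "transition_paths m p (P x) Y x"
  proof unfold_locales
    fix L :: "(real \<times> 'a set) list" assume L: "\<forall>(s, A)\<in>set L. s > 0 \<and> A \<in> sets borel"
    have t0: "0 \<le> sum_list (map fst (take i L))" for i
      using L by (intro sum_list_nonneg) (auto dest!: in_set_takeD)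
    have A: "snd (L ! i) \<in> sets borel" if "i < length L" for i using L nth_mem[OF that] by (auto simp: split_beta)
    have Ym: "Y s \<in> borel_measurable (P x)" for s
      using measurable_compose[OF measurable_Pair1' Y(1), of s] by simp
    have sets: "{\<omega> \<in> space (P x). \<forall>i<length L. Z (sum_list (map fst (take (Suc i) L))) \<omega> \<in> snd (L ! i)} \<in> sets (P x)"
      if Z: "\<And>s. 0 \<le> s \<Longrightarrow> Z s \<in> borel_measurable (P x)" for Z
    proof -
      have "{\<omega> \<in> space (P x). \<forall>i\<in>{..<length L}. Z (sum_list (map fst (take (Suc i) L))) \<omega> \<in> snd (L ! i)} \<in> sets (P x)"
      proof (rule sets.sets_Collect_finite_All)
        fix i assume "i \<in> {..<length L}"
        then have "Z (sum_list (map fst (take (Suc i) L))) -` (snd (L ! i)) \<inter> space (P x) \<in> sets (P x)"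
          by (intro measurable_sets[OF Z[OF t0] A]) auto
        also have "Z (sum_list (map fst (take (Suc i) L))) -` (snd (L ! i)) \<inter> space (P x)
            = {\<omega> \<in> space (P x). Z (sum_list (map fst (take (Suc i) L))) \<omega> \<in> snd (L ! i)}" by blast
        finally show "{\<omega> \<in> space (P x). Z (sum_list (map fst (take (Suc i) L))) \<omega> \<in> snd (L ! i)} \<in> sets (P x)" .
      qed simp
      then show ?thesis by (simp only: Ball_def lessThan_iff)
    qed
    have "emeasure (P x) {\<omega> \<in> space (P x). \<forall>i<length L. Y (sum_list (map fst (take (Suc i) L))) \<omega> \<in> snd (L ! i)}
       = emeasure (P x) {\<omega> \<in> space (P x). \<forall>i<length L. X (sum_list (map fst (take (Suc i) L))) \<omega> \<in> snd (L ! i)}"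
    proof (intro emeasure_eq_AE sets Ym d(2))
      show "AE \<omega> in P x. \<omega> \<in> {\<omega> \<in> space (P x). \<forall>i<length L. Y (sum_list (map fst (take (Suc i) L))) \<omega> \<in> snd (L ! i)} \<longleftrightarrow>
          \<omega> \<in> {\<omega> \<in> space (P x). \<forall>i<length L. X (sum_list (map fst (take (Suc i) L))) \<omega> \<in> snd (L ! i)}"
        using Y(3) by eventually_elim (simp add: t0 del: sum_list.Cons)
    qed
    then show "emeasure (P x) {\<omega> \<in> space (P x). \<forall>i<length L. Y (sum_list (map fst (take (Suc i) L))) \<omega> \<in> snd (L ! i)} = fdd m p L x"
      using d(4)[OF L] by simp
  qed (use Y in auto)
  then show ?thesis using Y(3) that by blast
qed

text \<open>The hypothesis expresses that a Gaussian majorant of a probability density has mass at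
  least 1. The powers of \<open>s\<close> cancel, and \<open>s \<rightarrow> 0\<close> removes the
  volume growth factor.\<close>

lemma gaussian_constant_ge_1:
  fixes c1 c2 c3 c4 n T0 G :: real
  assumes pos: "0 < c1" "0 < c2" "0 < c3" "0 < c4" "0 < n" "0 < T0"
    and le: "\<And>s. 0 < s \<Longrightarrow> s \<le> T0 \<Longrightarrow> c2 * (c4 * s) < 1 \<Longrightarrow> 1 \<le> c3 * s powr (- n / 2) * (c1 * (c4 * s) powr (n / 2) * (1 * G / (1 - c2 * (c4 * s)) powr (n / 2 + 1)))"
  shows "1 \<le> c3 * c1 * c4 powr (n / 2) * G"
proof -
  define s1 where "s1 = min T0 (1 / (2 * c2 * c4))"
  have s1: "0 < s1" using pos by (simp add: s1_def)
  have "((\<lambda>s. (1 - c2 * (c4 * s)) powr (n / 2 + 1)) \<longlongrightarrow> (1 - c2 * (c4 * 0)) powr (n / 2 + 1)) (at_right 0)"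
    by (intro tendsto_intros) auto
  then have lim: "((\<lambda>s. (1 - c2 * (c4 * s)) powr (n / 2 + 1)) \<longlongrightarrow> 1) (at_right 0)" by simp
  have "\<forall>\<^sub>F s in at_right 0. s \<in> {0<..<s1}" using s1 by (rule eventually_at_right_real)
  then have "\<forall>\<^sub>F s in at_right 0. (1 - c2 * (c4 * s)) powr (n / 2 + 1) \<le> c3 * c1 * c4 powr (n / 2) * G"
  proof eventually_elim
    case (elim s)
    then have s: "0 < s" "s \<le> T0" "c2 * (c4 * s) < 1" using pos by (auto simp: s1_def field_simps)
    have "s powr (- n / 2) * (c4 * s) powr (n / 2) = c4 powr (n / 2)"
      using s pos by (simp add: powr_mult powr_minus)
    then have "c3 * s powr (- n / 2) * (c1 * (c4 * s) powr (n / 2) * (1 * G / (1 - c2 * (c4 * s)) powr (n / 2 + 1)))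
        = c3 * c1 * c4 powr (n / 2) * G / (1 - c2 * (c4 * s)) powr (n / 2 + 1)"
      by (simp add: mult_ac)
    then have "1 \<le> c3 * c1 * c4 powr (n / 2) * G / (1 - c2 * (c4 * s)) powr (n / 2 + 1)" using le[OF s] by (simp only:)
    then show ?case using s by (simp add: le_divide_eq)
  qed
  then show ?thesis using lim by (intro tendsto_upperbound[OF lim]) auto
qed

theorem theorem2p8:
  fixes m :: "'a::polish_space measure" and K N :: real
    and p :: "real \<Rightarrow> 'a \<Rightarrow> 'a \<Rightarrow> real"
    and P :: "'a \<Rightarrow> 'w measure" and X :: "real \<Rightarrow> 'w \<Rightarrow> 'a"
    and n T0 c1 c2 c3 c4 :: real
    and V :: "'a \<Rightarrow> real" and pp T1 \<rho> t :: real and x :: 'a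
  assumes RCD: "RCD_star m K N"
    and hk: "heat_kernel m p"
    and diff: "canonical_diffusion m p P X"
    and n: "1 \<le> n" and T0: "T0 > 0"
    and c3: "c3 > 0" and c4: "c4 > 0"
    and A1: "\<forall>x\<in>msupp m. \<forall>y\<in>msupp m. \<forall>s\<in>{0<..T0}.
               p s x y \<le> c3 * s powr (- n / 2) * exp (- (dist x y)\<^sup>2 / (c4 * s))"
    and c1: "c1 > 0" and c2: "c2 > 0"
    and A2: "\<forall>r>0. \<forall>z\<in>msupp m. emeasure m (ball z r) \<le> ennreal (c1 * r powr n * exp (c2 * r\<^sup>2))"
    and Vmeas: "V \<in> borel_measurable m" and Vnonneg: "\<forall>y. 0 \<le> V y"
    and pp: "pp > 1" and Vp: "integrable m (\<lambda>y. V y powr pp)"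
    and gamma: "1 - n / (2 * pp) > 0"
    and T1: "0 < T1" "T1 < min T0 ((pp / (pp - 1)) / (c4 * c2))"
    and rho: "\<rho> > 0" and t: "t \<ge> 0" and x: "x \<in> msupp m"
  shows
    "let q = pp / (pp - 1); \<gamma> = 1 - n / (2 * pp);
         normV = (\<integral>y. V y powr pp \<partial>m) powr (1 / pp);
         C1 = (c1 * c3 powr q * q * Gamma (n / 2 + 1)
                / (c4 * ((q - c2 * T1 * c4) / c4) powr (n / 2 + 1))) powr (1 / q)
     in (\<integral>\<^sup>+ \<omega>. ennexp (\<integral>\<^sup>+ s. ennreal (V (X s \<omega>)) * indicator {0..t} s \<partial>lborel) \<partial>P x)
        \<le> ennreal (exp (\<rho> * (t * max (1 / T0) (max (c4 * c2 / q)
                ((C1 * normV / (\<gamma> * (1 - exp (- \<rho>)))) powr (1 / \<gamma>))) + 1)))"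
proof -
  define q where "q = pp / (pp - 1)"
  define \<gamma> where "\<gamma> = 1 - n / (2 * pp)"
  define I where "I = (\<integral>y. V y powr pp \<partial>m)"
  define normV where "normV = I powr (1 / pp)"
  define Gm where "Gm = Gamma (n / 2 + 1)"
  define C1 where "C1 = (c1 * c3 powr q * q * Gm / (c4 * ((q - c2 * T1 * c4) / c4) powr (n / 2 + 1))) powr (1 / q)"
  \<comment> \<open>The value of \<open>C1\<close> for \<open>T1 = 0\<close>. As \<open>C1\<close>
    increases with \<open>T1\<close>, an estimate with \<open>C0\<close> is stronger.\<close>
  define C0 where "C0 = (c1 * c3 powr q * Gm * (c4 / q) powr (n / 2)) powr (1 / q)"
  define E where "E = 1 - exp (- \<rho>)"
  define Mx where "Mx = max (1 / T0) (max (c4 * c2 / q) ((C1 * normV / (\<gamma> * E)) powr (1 / \<gamma>)))"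
  define \<tau> where "\<tau> = 1 / Mx"
  have q: "1 < q" using pp by (simp add: q_def)
  have g: "0 < \<gamma>" "\<gamma> < 1" using gamma n pp by (auto simp: \<gamma>_def)
  have E: "0 < E" using rho by (simp add: E_def)
  have Gm: "0 < Gm" unfolding Gm_def using n by (intro Gamma_real_pos) auto
  have Mx: "0 < Mx" "1 / T0 \<le> Mx" "c4 * c2 / q \<le> Mx" "(C1 * normV / (\<gamma> * E)) powr (1 / \<gamma>) \<le> Mx"
    using T0 by (auto simp: Mx_def less_max_iff_disj)
  have \<tau>: "0 < \<tau>" "\<tau> \<le> T0" "c2 * c4 * \<tau> \<le> q"
    using Mx T0 q by (auto simp: \<tau>_def field_simps)
  have C: "0 \<le> C0" "C0 \<le> C1" "0 \<le> normV"
  proof -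
    define z where "z = (q - c2 * T1 * c4) / c4"
    have "T1 < q / (c4 * c2)" using T1 by (simp add: q_def)
    then have "c2 * T1 * c4 < q" using c2 c4 by (simp add: field_simps)
    then have z: "0 < z" "z \<le> q / c4" using c2 c4 T1 by (auto simp: z_def field_simps)
    have "z powr (n / 2 + 1) \<le> (q / c4) powr (n / 2 + 1)" using z n by (intro powr_mono2) auto
    also have "\<dots> = (q / c4) * (q / c4) powr (n / 2)" using q c4 by (simp add: powr_add)
    finally have "c4 * z powr (n / 2 + 1) \<le> q * (q / c4) powr (n / 2)" using c4 by (simp add: field_simps)
    then have "q / (q * (q / c4) powr (n / 2)) \<le> q / (c4 * z powr (n / 2 + 1))"
      using q c4 z by (intro divide_left_mono mult_pos_pos) auto
    moreover have "q / (q * (q / c4) powr (n / 2)) = (c4 / q) powr (n / 2)" using q c4 by (simp add: powr_divide)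
    ultimately have "(c4 / q) powr (n / 2) \<le> q / (c4 * z powr (n / 2 + 1))" by simp
    then have "(c1 * c3 powr q * Gm) * (c4 / q) powr (n / 2) \<le> (c1 * c3 powr q * Gm) * (q / (c4 * z powr (n / 2 + 1)))"
      using c1 Gm by (intro mult_left_mono) auto
    also have "\<dots> = c1 * c3 powr q * q * Gm / (c4 * z powr (n / 2 + 1))" by simp
    finally show "C0 \<le> C1" unfolding C0_def C1_def z_def[symmetric] using q c1 Gm by (intro powr_mono2) auto
  qed (auto simp: C0_def normV_def)
  \<comment> \<open>The third entry of the maximum, solved for the norm of \<open>V\<close>.\<close>
  have small: "C0 * normV * \<tau> powr \<gamma> \<le> \<gamma> * E"
  proof -
    have "C1 * normV / (\<gamma> * E) = ((C1 * normV / (\<gamma> * E)) powr (1 / \<gamma>)) powr \<gamma>"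
      using C g E by (simp add: powr_powr)
    also have "\<dots> \<le> Mx powr \<gamma>" using Mx g by (intro powr_mono2) auto
    finally have "C1 * normV \<le> \<gamma> * E * Mx powr \<gamma>" using g E by (simp add: field_simps)
    then have "C0 * normV \<le> \<gamma> * E * Mx powr \<gamma>" using C mult_right_mono[of C0 C1 normV] by linarith
    then have "C0 * normV / Mx powr \<gamma> \<le> \<gamma> * E" using Mx(1) by (simp add: pos_divide_le_eq)
    moreover have "\<tau> powr \<gamma> = 1 / Mx powr \<gamma>" using Mx by (simp add: \<tau>_def powr_divide)
    ultimately show ?thesis by simp
  qed
  have mm: "mm_space m" using RCD by (simp add: RCD_star_def)
  have sets[measurable_cong]: "sets m = sets borel" and sf: "sigma_finite_measure m"
    using mm by (auto simp: mm_space_def)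
  \<comment> \<open>All balls have positive measure, so (A1) and (A2) hold at every point.\<close>
  have supp: "msupp m = UNIV" using mm by (auto simp: mm_space_def msupp_def)
  have Vm[measurable]: "V \<in> borel_measurable borel" using Vmeas sets by (simp cong: measurable_cong_sets)
  have TK: "transition_kernel m p"
    using hk sets sf kern_measurable_of_loc_holder[of p]
    by (auto simp: transition_kernel_def heat_kernel_def supp)
  interpret transition_kernel m p by (rule TK)
  let ?V = "\<lambda>y. ennreal (V y)"
  have heat1: "heat s (\<lambda>_. 1) y = 1" if "0 < s" for s y
  proof -
    obtain Y where "transition_paths m p (P y) Y y" using canonical_diffusion_paths[OF TK diff, of y] supp by auto
    from transition_paths.heat_const[OF this that] show ?thesis by simp
  qed
  \<comment> \<open>\<open>ennreal\<close> sends negative values to 0, so the actual density is the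
    positive part of \<open>p\<close>.\<close>
  have kern_le: "max 0 (p s y z) \<le> c3 * s powr (- n / 2) * exp (- ((dist y z)\<^sup>2 / (c4 * s)))" if "0 < s" "s \<le> T0" for s y z
  proof -
    have "p s y z \<le> c3 * s powr (- n / 2) * exp (- (dist y z)\<^sup>2 / (c4 * s))"
      using A1[rule_format, of y z s] that supp by simp
    then show ?thesis unfolding minus_divide_left using c3 by (intro max.boundedI mult_nonneg_nonneg) auto
  qed
  have kern_eq: "kern p s y z = ennreal (max 0 (p s y z))" if "0 < s" for s y z
    using that by (simp add: kern_def ennreal_max_0)
  have kern_int: "(\<integral>\<^sup>+z. ennreal (max 0 (p s y z)) \<partial>m) = 1" if "0 < s" for s y
    using heat1[OF that, of y] kern_eq[OF that] by (simp add: heat_def)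
  have kern_meas: "(\<lambda>z. max 0 (p s y z)) \<in> borel_measurable m" if "0 < s" for s y
  proof -
    have "(\<lambda>z. enn2real (kern p s y z)) \<in> borel_measurable m" by measurable
    moreover have "enn2real (kern p s y z) = max 0 (p s y z)" for z
      by (simp only: kern_eq[OF that] enn2real_ennreal max.cobounded1)
    ultimately show ?thesis by (simp only:)
  qed
  have ball: "emeasure m (ball y r) \<le> ennreal (c1 * r powr n * exp (c2 * r\<^sup>2))" if "0 < r" for y r
    using A2 that supp by auto
  have D: "1 \<le> c3 * c1 * c4 powr (n / 2) * Gm"
  proof (rule gaussian_constant_ge_1[of c1 c2 c3 c4 n T0])
    fix s assume s: "0 < s" "s \<le> T0" "c2 * (c4 * s) < 1"
    let ?R = "c1 * (c4 * s) powr (n / 2) * (1 * Gm / (1 - c2 * (c4 * s)) powr (n / 2 + 1))"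
    have "1 = (\<integral>\<^sup>+z. ennreal (max 0 (p s x z)) \<partial>m)" using kern_int s by simp
    also have "\<dots> \<le> (\<integral>\<^sup>+z. ennreal (c3 * s powr (- n / 2)) * ennreal (exp (- 1 * ((dist x z)\<^sup>2 / (c4 * s)))) \<partial>m)"
      using kern_le[OF s(1,2)] c3 by (intro nn_integral_mono) (simp add: ennreal_mult'[symmetric] ennreal_leI)
    also have "\<dots> = ennreal (c3 * s powr (- n / 2)) * (\<integral>\<^sup>+z. ennreal (exp (- 1 * ((dist x z)\<^sup>2 / (c4 * s)))) \<partial>m)"
      by (intro nn_integral_cmult) measurable
    also have "\<dots> \<le> ennreal (c3 * s powr (- n / 2)) * ennreal ?R"
      unfolding Gm_def using c1 n c4 s ball by (intro mult_left_mono gaussian_integral_le sets sf) auto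
    also have "\<dots> = ennreal (c3 * s powr (- n / 2) * ?R)" using c3 by (intro ennreal_mult'[symmetric]) auto
    finally show "1 \<le> c3 * s powr (- n / 2) * ?R" by simp
  qed (use c1 c2 c3 c4 n T0 in auto)
  have Iint: "(\<integral>\<^sup>+y. V y powr pp \<partial>m) = ennreal I" "0 \<le> I"
    unfolding I_def using Vp by (auto intro!: nn_integral_eq_integral)
  define f where "f = (\<lambda>v. \<gamma> * v powr (\<gamma> - 1) * loss_factor \<gamma> v)"
  \<comment> \<open>In the time unit \<open>\<tau>\<close> all constants are absorbed:
    \<open>small\<close> replaces them by \<open>\<gamma> * E\<close>, and
    \<open>c2 * c4 * \<tau> \<le> q\<close> is the smallness of the volume growth that the kernel
    estimate requires.\<close>
  have est: "heat s ?V y \<le> ennreal (E / \<tau> * f (s / \<tau>))"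
    if s: "0 < s" "s \<le> \<tau>" and c: "s / \<tau> \<le> 36 / 49 \<or> 1 / 3 \<le> \<gamma>" for s y
  proof -
    define v where "v = s / \<tau>"
    have v: "0 < v" "v \<le> 1" "s = \<tau> * v" "c2 * c4 * s \<le> q * v"
      using s \<tau> mult_right_mono[OF \<tau>(3), of v] by (auto simp: v_def)
    have "heat s ?V y = (\<integral>\<^sup>+z. ennreal (max 0 (p s y z) * V z) \<partial>m)"
      using Vnonneg by (simp add: heat_def kern_eq[OF s(1)] ennreal_mult'')
    also have "\<dots> \<le> ennreal (C0 * I powr (1 / pp) * loss_factor \<gamma> v * s powr (\<gamma> - 1))"
    proof -
      have n0: "0 < n" and sT: "s \<le> T0" and Vn: "0 \<le> V z" and c': "v \<le> 36 / 49 \<or> 1 / 3 \<le> \<gamma>"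
        and Ile: "(\<integral>\<^sup>+y. V y powr pp \<partial>m) \<le> ennreal I" for z
        using n s \<tau> Vnonneg c Iint by (auto simp: v_def)
      show ?thesis
        unfolding C0_def Gm_def
        by (rule kernel_Lp_estimate[where ?c2.0=c2 and q=q])
          (fact sets sf c1 c2 c3 c4 n0 s(1) pp ball kern_meas[OF s(1)] max.cobounded1 kern_int[OF s(1)] kern_le[OF s(1) sT]
            Vmeas Vn Iint(2) Ile D[unfolded Gm_def] \<gamma>_def g(1) q_def v(1,2,4) c')+
    qed
    also have "\<dots> \<le> ennreal (E / \<tau> * f v)"
    proof (rule ennreal_leI)
      have loss_factor: "0 \<le> loss_factor \<gamma> v" using v g by (simp add: loss_factor_def)
      have "\<tau> powr (\<gamma> - 1) = \<tau> powr \<gamma> / \<tau>" using \<tau> by (simp add: powr_diff)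
      then have "C0 * normV * loss_factor \<gamma> v * s powr (\<gamma> - 1) = (C0 * normV * \<tau> powr \<gamma>) * (loss_factor \<gamma> v * v powr (\<gamma> - 1) / \<tau>)"
        using v \<tau> by (simp add: v(3) powr_mult)
      also have "\<dots> \<le> (\<gamma> * E) * (loss_factor \<gamma> v * v powr (\<gamma> - 1) / \<tau>)"
        using small loss_factor \<tau> by (intro mult_right_mono) auto
      also have "\<dots> = E / \<tau> * f v" by (simp add: f_def)
      finally show "C0 * I powr (1 / pp) * loss_factor \<gamma> v * s powr (\<gamma> - 1) \<le> E / \<tau> * f v" by (simp add: normV_def)
    qed
    finally show ?thesis by (simp add: v_def)
  qed
  obtain v0 A where v0: "0 < v0" "v0 \<le> 1" "v0 \<le> 36 / 49 \<or> 1 / 3 \<le> \<gamma>"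
    and anti: "\<And>v. 0 < v \<Longrightarrow> v \<le> v0 \<Longrightarrow> f v0 \<le> f v"
    and int: "(f has_integral (A + f v0 * v0)) {0..v0}" and A: "A \<le> 1" "A + f v0 / \<rho> \<le> 1 / (1 - exp (- \<rho>))"
    using profile_exists[OF g rho] unfolding f_def by blast
  define b where "b = (\<lambda>s. ennreal ((1 - exp (- \<rho>)) / \<tau> * (if s < v0 * \<tau> then f (s / \<tau>) else f v0)))"
  have bound: "heat s ?V y \<le> b s" if s: "0 < s" for s y
  proof (cases "s < v0 * \<tau>")
    case True
    have "v0 * \<tau> \<le> \<tau>" using v0 \<tau> by (simp add: mult_left_le_one_le)
    moreover have "s / \<tau> \<le> v0" using True \<tau> by (simp add: field_simps)
    then have "s / \<tau> \<le> 36 / 49 \<or> 1 / 3 \<le> \<gamma>" using v0(3) by linarith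
    ultimately have "heat s ?V y \<le> ennreal (E / \<tau> * f (s / \<tau>))" using s True by (intro est) auto
    then show ?thesis using True by (simp add: b_def E_def)
  next
    case False
    have e0: "heat (v0 * \<tau>) ?V z \<le> ennreal (E / \<tau> * f v0)" for z
      using est[of "v0 * \<tau>" z] v0 \<tau> by (simp add: mult_left_le_one_le)
    have "heat s ?V y \<le> ennreal (E / \<tau> * f v0)"
    proof (cases "s = v0 * \<tau>")
      case neq: False
      obtain Y where Y: "transition_paths m p (P y) Y y" using canonical_diffusion_paths[OF TK diff, of y] supp by auto
      have "heat ((s - v0 * \<tau>) + v0 * \<tau>) ?V y \<le> ennreal (E / \<tau> * f v0)"
        by (rule transition_paths.heat_le_later[OF Y]) (use neq False v0 \<tau> e0 in auto)
      then show ?thesis by simp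
    qed (use e0 in simp)
    then show ?thesis using False by (simp add: b_def E_def)
  qed
  have fm: "f \<in> borel_measurable borel" unfolding f_def loss_factor_def by (cases "2 / 3 \<le> \<gamma>") auto
  have f0: "0 \<le> f v0" using g v0 by (auto simp: f_def loss_factor_def)
  have iter: "iter_heat ?V k t x \<le> ennreal (exp (\<rho> * (t / \<tau> + 1)))" for k
  proof (rule iter_heat_le[where b=b and G="\<lambda>t. ennreal (exp (\<rho> * (t / \<tau> + 1)))"])
    show "1 + (\<integral>\<^sup>+s. indicator {0<..t'} s * (b s * ennreal (exp (\<rho> * ((t' - s) / \<tau> + 1)))) \<partial>lborel)
        \<le> ennreal (exp (\<rho> * (t' / \<tau> + 1)))" if "0 \<le> t'" for t'
      unfolding b_def
      by (rule exponential_supersolution[OF rho \<tau>(1) that v0(1) f0 fm anti int A])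
  qed (use bound t in auto)
  obtain Y where Y: "transition_paths m p (P x) Y x" "AE \<omega> in P x. \<forall>s\<ge>0. Y s \<omega> = X s \<omega>"
    using canonical_diffusion_paths[OF TK diff x] by blast
  have "(\<integral>\<^sup>+ \<omega>. ennexp (\<integral>\<^sup>+ s. ennreal (V (X s \<omega>)) * indicator {0..t} s \<partial>lborel) \<partial>P x)
      = (\<integral>\<^sup>+ \<omega>. ennexp (\<integral>\<^sup>+ s. ?V (Y s \<omega>) * indicator {0..t} s \<partial>lborel) \<partial>P x)"
  proof (rule nn_integral_cong_AE)
    show "AE \<omega> in P x. ennexp (\<integral>\<^sup>+ s. ennreal (V (X s \<omega>)) * indicator {0..t} s \<partial>lborel)
        = ennexp (\<integral>\<^sup>+ s. ?V (Y s \<omega>) * indicator {0..t} s \<partial>lborel)"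
      using Y(2) by eventually_elim (auto intro!: arg_cong[where f=ennexp] nn_integral_cong simp: indicator_def)
  qed
  also have "\<dots> = (SUP k. iter_heat ?V k t x)" by (rule transition_paths.exponential_moment_eq[OF Y(1)]) measurable
  also have "\<dots> \<le> ennreal (exp (\<rho> * (t / \<tau> + 1)))" by (intro SUP_least iter)
  also have "t / \<tau> = t * Mx" by (simp add: \<tau>_def)
  finally show ?thesis
    unfolding Let_def Mx_def E_def normV_def I_def \<gamma>_def C1_def Gm_def q_def .
qed

end
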